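(* Let $\delta_{opt}(\Gamma)$ denote the optimal horoball packing density of the Coxeter simplex tiling $\mathcal{T}_\Gamma$ of hyperbolic $3$-space, and let $C=\sum_{n=0}^\infty \frac{(-1)^n}{(2n+1)^2}$ be Catalan's constant. For every $\Gamma\in\{\overline{R}_3,\overline{O}_3,\widehat{BR}_3,\overline{N}_3,\overline{M}_3,\widehat{RR}_3\}$, $$\delta_{opt}(\Gamma)=\frac{3}{4}\,C^{-1}\approx 0.818808.$$
   Context: $\mathbb{H}^3$ is hyperbolic $3$-space of curvature $-1$ and $\overline{\mathbb{H}}^3=\mathbb{H}^3\cup\partial\mathbb{H}^3$. A Coxeter simplex in $\overline{\mathbb{H}}^3$ is a tetrahedron, possibly with ideal vertices (on $\partial\mathbb{H}^3$), of finite volume, whose dihedral angles are integer submultiples of $\pi$. It is determined up to isometry by its Coxeter diagram: one node per facet; two facets orthogonal if the nodes are not joined, dihedral angle $\pi/3$ if joined by an unlabeled edge (label 3), and dihedral angle $\pi/k$ if joined by an edge labeled $k$. $\Gamma$ is the discrete group generated by reflections in the facets, $\mathcal{F}_\Gamma$ is the simplex (a fundamental domain), and $\mathcal{T}_\Gamma$ is the tiling by the images of $\mathcal{F}_\Gamma$ under $\Gamma$. Diagrams of the groups (a "path" or "cycle" $a,b,\dots$ lists consecutive edge labels; each diagram has four nodes): - $\overline{R}_3=[3,4,4]$: path $3,4,4$. - $\overline{O}_3=[3,4^{1,1}]$: a central node joined to three leaves by edges labeled $3,4,4$. - $\widehat{BR}_3=[(3^2,4^2)]$: a $4$-cycle with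 labels $3,3,4,4$. - $\overline{N}_3=[4,4,4]$: path $4,4,4$. - $\overline{M}_3=[4^{1,1,1}]$: a central node joined to three leaves by edges labeled $4,4,4$. - $\widehat{RR}_3=[4^{[4]}]$: a $4$-cycle with labels $4,4,4,4$. Horoball packing associated to $\mathcal{T}_\Gamma$: let $v_1,\dots,v_m$ be the ideal vertices of $\mathcal{F}_\Gamma$. It is a $\Gamma$-invariant collection $\mathcal{B}$ of horoballs which restricts on $\mathcal{F}_\Gamma$ to a set $\{B_1,\dots,B_m\}$ such that (1) $B_i$ is centered at $v_i$; (2) horoballs have pairwise disjoint interiors; (3) each $B_i$ is contained in the half-space (containing $\mathcal{F}_\Gamma$) bounded by the plane of the facet of $\mathcal{F}_\Gamma$ opposite $v_i$. The sizes of horoballs at different ideal vertices may be chosen differently. Its density is $$\delta(\mathcal{B})=\frac{\sum_{i=1}^m \mathrm{vol}_{\mathbb{H}^3}(B_i\cap\mathcal{F}_\Gamma)}{\mathrm{vol}_{\mathbb{H}^3}(\mathcal{F}_\Gamma)},$$ and $\delta_{opt}(\Gamma)$ is the supremum of $\delta(\mathcal{B})$ over all such packings. *)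

theory Defs
  imports "HOL-Analysis.Analysis"
begin

section \<open>Hyperbolic 3-space (hyperboloid model)\<close>

text \<open>Vectors of Lorentz space are pairs (time coordinate, space coordinates).\<close>

type_synonym lorentz = "real \<times> (real^3)"

definition lor :: "lorentz \<Rightarrow> lorentz \<Rightarrow> real" where
  "lor x y = snd x \<bullet> snd y - fst x * fst y"

definition hyp3 :: "lorentz set" where
  "hyp3 = {x. lor x x = -1 \<and> fst x > 0}"

text \<open>The points of the sphere at infinity are the rays spanned by future light-like vectors;
  an ideal point is represented by any vector on its ray.\<close>

definition ideal :: "lorentz \<Rightarrow> bool" where
  "ideal v \<longleftrightarrow> lor v v = 0 \<and> fst v > 0"

text \<open>In the chart \<open>(sqrt (1 + |x|\<^sup>2), x) \<mapsto> x\<close> of the hyperboloid, the Riemannian volume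
  element of the metric of curvature -1 induced by the Lorentz form is
  \<open>dx / sqrt (1 + |x|\<^sup>2)\<close>.\<close>

definition hyp_vol :: "lorentz measure" where
  "hyp_vol = distr (density lborel (\<lambda>x :: real^3. ennreal (1 / sqrt (1 + (norm x)\<^sup>2)))) borel
                   (\<lambda>x. (sqrt (1 + (norm x)\<^sup>2), x))"

abbreviation hyp_interior :: "lorentz set \<Rightarrow> lorentz set" where
  "hyp_interior S \<equiv> (top_of_set hyp3) interior_of S"

text \<open>A unit space-like vector \<open>e\<close> determines the plane \<open>lor x e = 0\<close>, the half-space with
  outward normal \<open>e\<close>, and the reflection in the plane.\<close>

definition halfspace :: "lorentz \<Rightarrow> lorentz set" where
  "halfspace e = {x \<in> hyp3. lor x e \<le> 0}"

definition reflection :: "lorentz \<Rightarrow> lorentz \<Rightarrow> lorentz" where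
  "reflection e x = x - (2 * lor x e) *\<^sub>R e"

text \<open>At a common point of two planes the unit vectors \<open>e\<close> and \<open>f\<close> are tangent to the hyperboloid
  and normal to the planes, pointing out of the half-spaces; the dihedral angle of the
  intersection of the half-spaces is \<open>pi\<close> minus the angle between \<open>e\<close> and \<open>f\<close>.\<close>

definition has_dihedral_angle :: "lorentz \<Rightarrow> lorentz \<Rightarrow> real \<Rightarrow> bool" where
  "has_dihedral_angle e f \<theta> \<longleftrightarrow> 0 < \<theta> \<and> \<theta> < pi \<and> lor e f = - cos \<theta>"

text \<open>The horoballs centered at the ideal point \<open>v\<close> are the sublevel sets of
  \<open>x \<mapsto> - lor x v\<close>; rescaling \<open>v\<close> only changes the parameter \<open>s\<close>.\<close>

definition horoball_at :: "lorentz \<Rightarrow> lorentz set \<Rightarrow> bool" where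
  "horoball_at v b \<longleftrightarrow> ideal v \<and> (\<exists>s>0. b = {x \<in> hyp3. - lor x v \<le> s})"


section \<open>Coxeter simplices\<close>

text \<open>A Coxeter diagram on the nodes \<open>0, 1, 2, 3\<close> is given by its labels; nodes which are not
  joined have label 2.\<close>

type_synonym diagram = "nat \<Rightarrow> nat \<Rightarrow> nat"

definition path_diagram :: "nat \<Rightarrow> nat \<Rightarrow> nat \<Rightarrow> diagram" where
  "path_diagram a b c i j =
     (if {i, j} = {0, 1} then a else if {i, j} = {1, 2} then b
      else if {i, j} = {2, 3} then c else 2)"

definition star_diagram :: "nat \<Rightarrow> nat \<Rightarrow> nat \<Rightarrow> diagram" where
  "star_diagram a b c i j =
     (if {i, j} = {0, 1} then a else if {i, j} = {0, 2} then b
      else if {i, j} = {0, 3} then c else 2)"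

definition cycle_diagram :: "nat \<Rightarrow> nat \<Rightarrow> nat \<Rightarrow> nat \<Rightarrow> diagram" where
  "cycle_diagram a b c d i j =
     (if {i, j} = {0, 1} then a else if {i, j} = {1, 2} then b
      else if {i, j} = {2, 3} then c else if {i, j} = {3, 0} then d else 2)"

definition R3_diagram :: diagram where "R3_diagram = path_diagram 3 4 4"
definition O3_diagram :: diagram where "O3_diagram = star_diagram 3 4 4"
definition BR3_diagram :: diagram where "BR3_diagram = cycle_diagram 3 3 4 4"
definition N3_diagram :: diagram where "N3_diagram = path_diagram 4 4 4"
definition M3_diagram :: diagram where "M3_diagram = star_diagram 4 4 4"
definition RR3_diagram :: diagram where "RR3_diagram = cycle_diagram 4 4 4 4"

text \<open>A simplex is given by its vertices \<open>v i\<close>, which may be ideal, together with the outward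
  unit normals \<open>e i\<close> of its facets, for \<open>i < 4\<close>; facet \<open>i\<close> is opposite to vertex \<open>i\<close>. The
  conditions force the vertices to be linearly independent.\<close>

definition hyp_simplex :: "(nat \<Rightarrow> lorentz) \<Rightarrow> (nat \<Rightarrow> lorentz) \<Rightarrow> bool" where
  "hyp_simplex v e \<longleftrightarrow>
     (\<forall>i<4. v i \<in> hyp3 \<or> ideal (v i)) \<and>
     (\<forall>i<4. lor (e i) (e i) = 1) \<and>
     (\<forall>i<4. \<forall>j<4. i \<noteq> j \<longrightarrow> lor (v i) (e j) = 0) \<and>
     (\<forall>i<4. lor (v i) (e i) < 0)"

definition simplex_body :: "(nat \<Rightarrow> lorentz) \<Rightarrow> lorentz set" where
  "simplex_body e = (\<Inter>i<4. halfspace (e i))"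

definition ideal_vertices :: "(nat \<Rightarrow> lorentz) \<Rightarrow> nat set" where
  "ideal_vertices v = {i. i < 4 \<and> ideal (v i)}"

definition coxeter_simplex ::
    "diagram \<Rightarrow> (nat \<Rightarrow> lorentz) \<Rightarrow> (nat \<Rightarrow> lorentz) \<Rightarrow> bool" where
  "coxeter_simplex D v e \<longleftrightarrow>
     hyp_simplex v e \<and>
     emeasure hyp_vol (simplex_body e) < \<infinity> \<and>
     (\<forall>i<4. \<forall>j<4. i \<noteq> j \<longrightarrow> has_dihedral_angle (e i) (e j) (pi / real (D i j)))"

text \<open>Reflections are involutions, so closure under composition with generators yields the
  whole group.\<close>

inductive_set reflection_group :: "(nat \<Rightarrow> lorentz) \<Rightarrow> (lorentz \<Rightarrow> lorentz) set"
  for e :: "nat \<Rightarrow> lorentz" where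
  id: "id \<in> reflection_group e"
| step: "g \<in> reflection_group e \<Longrightarrow> i < 4 \<Longrightarrow> reflection (e i) \<circ> g \<in> reflection_group e"


section \<open>Horoball packings\<close>

text \<open>\<open>B\<close> is the collection of horoballs and \<open>b i\<close> its member at the ideal vertex \<open>i\<close>. That \<open>B\<close>
  restricts on the simplex to the \<open>b i\<close> refers to the interior of the simplex, because a mirror
  image of \<open>b i\<close> may touch the simplex from outside.\<close>

definition horoball_packing ::
    "(nat \<Rightarrow> lorentz) \<Rightarrow> (nat \<Rightarrow> lorentz) \<Rightarrow> lorentz set set \<Rightarrow> (nat \<Rightarrow> lorentz set) \<Rightarrow> bool" where
  "horoball_packing v e B b \<longleftrightarrow>
     (\<forall>S\<in>B. \<exists>w. horoball_at w S) \<and>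
     (\<forall>g\<in>reflection_group e. \<forall>S\<in>B. g ` S \<in> B) \<and>
     {S \<in> B. S \<inter> hyp_interior (simplex_body e) \<noteq> {}} = b ` ideal_vertices v \<and>
     (\<forall>i\<in>ideal_vertices v. horoball_at (v i) (b i)) \<and>
     pairwise (\<lambda>S T. hyp_interior S \<inter> hyp_interior T = {}) B \<and>
     (\<forall>i\<in>ideal_vertices v. b i \<subseteq> halfspace (e i))"

definition packing_density ::
    "(nat \<Rightarrow> lorentz) \<Rightarrow> (nat \<Rightarrow> lorentz) \<Rightarrow> (nat \<Rightarrow> lorentz set) \<Rightarrow> ennreal" where
  "packing_density v e b =
     (\<Sum>i\<in>ideal_vertices v. emeasure hyp_vol (b i \<inter> simplex_body e))
       / emeasure hyp_vol (simplex_body e)"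

definition optimal_density :: "(nat \<Rightarrow> lorentz) \<Rightarrow> (nat \<Rightarrow> lorentz) \<Rightarrow> ennreal" where
  "optimal_density v e = Sup {packing_density v e b | B b. horoball_packing v e B b}"

definition catalan_const :: real where
  "catalan_const = (\<Sum>n. (-1) ^ n / (2 * real n + 1)\<^sup>2)"

end

theory Submission
  imports Defs
begin

text \<open>
  Move an ideal vertex to \<open>\<infinity>\<close> in the upper half-space model. Each of the six simplices then
  lies over a right isosceles triangle and outside the unit sphere, and the triangle consists of
  1, 2 or 4 copies of a right isosceles triangle with a vertex at the centre of the sphere and legs
  \<open>c = 1 / 2\<close> or \<open>c = 1 / sqrt 2\<close>. The part of the simplex over one copy has volume \<open>C / 12\<close> or
  \<open>C / 4\<close>, by the triplication formula for Lobachevsky's function, and a horoball whose radius is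
  \<open>s\<close> times that of the horoball touching the opposite facet cuts off the volume \<open>s\<^sup>2 c\<^sup>2 / 4\<close> over
  each copy. Condition (3) means \<open>s \<le> 1\<close>, and disjointness bounds the product of the radii at
  two ideal vertices. Under these constraints the sum of the \<open>s\<^sup>2\<close> is at most 1 or \<open>3 / 2\<close>, and
  in all six cases the density is at most \<open>3 / (4 C)\<close>.

  The bound is attained by horoballs at the primitive light-like vectors of the lattice of Hermitian
  matrices over the Gaussian integers. This lattice is invariant under the reflections, and because
  the product of two distinct vectors is a negative even integer the horoballs do not overlap.
\<close>

section \<open>Lobachevsky's function and Catalan's constant\<close>

text \<open>The upper bound looks only at the horoballs at the ideal vertices of one simplex:
  condition (3) for each of them and disjointness for each pair. That the extremal radii come from
  an invariant packing concerns the whole infinite group. The lattice settles this without a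
  tessellation theorem: invariance under the four generators and the gap between integers are finite
  checks. Each ideal vertex belongs to a node whose removal leaves the diagram of the Euclidean
  triangle group (2, 4, 4), and all ideal vertices of one simplex have the same shape and the same
  \<open>c\<close>. So one volume computation at infinity serves all of them. The number
  \<open>c\<close> is the cosine of the dihedral angle between the unit sphere and a side at
  distance \<open>c\<close> from its centre, hence of pi / 3 or pi / 4. The number of copies of the
  small triangle cancels from the density, leaving c^2 / (4 I) times the sum of the squared radii,
  with I the volume over one copy. Thus 3 / (4 C) arises as 1 * (1/4) / (C/3) and as (3/2) * (1/2) /
  C.\<close>

definition lobachevsky :: "real \<Rightarrow> real" where
  "lobachevsky x = (\<Sum>n. sin (2 * real (Suc n) * x) / (2 * (real (Suc n))\<^sup>2))"

lemma summable_inverse_squares: "summable (\<lambda>n. 1 / (2 * (real (Suc n))\<^sup>2))"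
proof -
  have "summable (\<lambda>n. inverse ((real (Suc n))\<^sup>2))"
    by (rule inverse_power_summable[THEN summable_Suc_iff[THEN iffD2]]) simp
  from summable_mult[OF this, of "1/2"] show ?thesis by (simp add: field_simps)
qed

lemma lobachevsky_sums: "(\<lambda>n. sin (2 * real (Suc n) * x) / (2 * (real (Suc n))\<^sup>2)) sums lobachevsky x"
  unfolding lobachevsky_def
  by (intro summable_sums summable_comparison_test'[OF summable_inverse_squares, of 0])
     (auto simp: divide_simps)

lemma continuous_on_lobachevsky: "continuous_on A lobachevsky"
proof -
  have "uniform_limit A (\<lambda>k x. \<Sum>n<k. sin (2 * real (Suc n) * x) / (2 * (real (Suc n))\<^sup>2)) lobachevsky sequentially"
    unfolding lobachevsky_def
    by (rule Weierstrass_m_test[OF _ summable_inverse_squares]) (auto simp: divide_simps)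
  then show ?thesis
    by (rule uniform_limit_theorem[rotated])
       (auto intro!: always_eventually continuous_intros simp del: of_nat_Suc)
qed

text \<open>Real part of the power series of -ln (1 - w) at w = r exp (2 i x); in the proof
  \<open>z\<close> is -w.\<close>

lemma sum_cos_Abel:
  fixes r x :: real
  assumes "0 \<le> r" "r < 1"
  shows "(\<lambda>n. r ^ Suc n * cos (2 * real (Suc n) * x) / real (Suc n)) sums (- ln (1 - 2 * r * cos (2 * x) + r\<^sup>2) / 2)"
proof -
  define z where "z = - (of_real r * cis (2 * x))"
  have nz: "norm z < 1" using assms by (simp add: z_def norm_mult)
  have 1: "(\<lambda>n. (-1)^Suc n / of_nat n * z^n) sums ln (1 + z)"
    by (rule Ln_series[OF nz])
  have ne: "1 + z \<noteq> 0"
    using nz by (metis add_eq_0_iff2 norm_minus_cancel norm_one order_less_irrefl)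
  have 2: "Re (ln (1 + z)) = ln (1 - 2 * r * cos (2 * x) + r\<^sup>2) / 2"
  proof -
    have "(norm (1 + z))\<^sup>2 = 1 - 2 * r * cos (2 * x) + r\<^sup>2"
    proof -
      have "(r * sin (2*x))\<^sup>2 = r\<^sup>2 - (r * cos (2*x))\<^sup>2"
        by (simp add: power_mult_distrib sin_squared_eq algebra_simps)
      then show ?thesis
        by (simp add: cmod_power2 z_def) (simp add: power2_eq_square algebra_simps)
    qed
    moreover have "ln ((norm (1 + z))\<^sup>2) = 2 * ln (norm (1 + z))"
      using ne by (simp add: ln_realpow)
    ultimately show ?thesis using ne by simp
  qed
  have "(\<lambda>n. Re ((-1)^Suc n / of_nat n * z^n)) sums Re (ln (1 + z))"
    by (rule sums_Re[OF 1])
  moreover have re: "Re ((-1)^Suc n / of_nat n * z^n) = - (r ^ n * cos (2 * real n * x) / real n)" for n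
  proof -
    have *: "(-1)^Suc n / of_nat n * z^n = - (of_real (r^n / real n) * cis (2 * real n * x))"
      by (simp add: z_def power_minus' Complex.DeMoivre power_mult_distrib mult_ac)
    show ?thesis unfolding * by simp
  qed
  ultimately have "(\<lambda>n. - (r ^ n * cos (2 * real n * x) / real n)) sums (ln (1 - 2 * r * cos (2 * x) + r\<^sup>2) / 2)"
    unfolding re 2 by simp
  from sums_minus[OF this] have "(\<lambda>n. r ^ n * cos (2 * real n * x) / real n) sums (- ln (1 - 2 * r * cos (2 * x) + r\<^sup>2) / 2)"
    by simp
  then show ?thesis by (subst sums_Suc_iff) simp
qed

text \<open>The powers of r give the differentiated series a geometric majorant. At r = 1 that
  series is the sum of cos (2 n x) / n, which has no such majorant; hence the detour through r <
  1.\<close>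

lemma DERIV_lobachevsky_Abel:
  fixes r x :: real
  assumes r: "0 \<le> r" "r < 1"
  shows "((\<lambda>x. \<Sum>n. r ^ Suc n * sin (2 * real (Suc n) * x) / (2 * (real (Suc n))\<^sup>2))
    has_real_derivative (- ln (1 - 2 * r * cos (2 * x) + r\<^sup>2) / 2)) (at x)"
proof -
  have sg: "summable (\<lambda>n. r ^ Suc n)" using r by (intro summable_Suc_iff[THEN iffD2] summable_geometric) auto
  let ?f = "\<lambda>n x. r ^ Suc n * sin (2 * real (Suc n) * x) / (2 * (real (Suc n))\<^sup>2)"
  let ?f' = "\<lambda>n x. r ^ Suc n * cos (2 * real (Suc n) * x) / real (Suc n)"
  have "((\<lambda>x. \<Sum>n. ?f n x) has_real_derivative (\<Sum>n. ?f' n x)) (at x)"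
  proof (rule has_field_derivative_series'(2)[of UNIV])
    show "(?f n has_field_derivative ?f' n y) (at y within UNIV)" for n y
      by (auto intro!: derivative_eq_intros simp: power2_eq_square simp del: of_nat_Suc)
    show "uniformly_convergent_on UNIV (\<lambda>n x. \<Sum>i<n. ?f' i x)"
    proof (rule Weierstrass_m_test'[OF _ sg])
      fix n and x :: real
      have "\<bar>cos (2 * real (Suc n) * x)\<bar> / real (Suc n) \<le> 1"
        using abs_cos_le_one[of "2 * real (Suc n) * x"] by (simp add: divide_simps del: abs_cos_le_one)
      then have "r ^ Suc n * (\<bar>cos (2 * real (Suc n) * x)\<bar> / real (Suc n)) \<le> r ^ Suc n * 1"
        by (rule mult_left_mono) (use r in auto)
      then show "norm (?f' n x) \<le> r ^ Suc n"
        using r by (simp add: abs_mult)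
    qed
    show "summable (\<lambda>n. ?f n 0)" by simp
  qed auto
  moreover have "(\<Sum>n. ?f' n x) = - ln (1 - 2 * r * cos (2 * x) + r\<^sup>2) / 2"
    using sum_cos_Abel[OF r, of x] by (simp add: sums_iff)
  ultimately show ?thesis by simp
qed

lemma abs_ln_diff_le:
  fixes a b m :: real
  assumes "0 < m" "m \<le> a" "m \<le> b"
  shows "\<bar>ln a - ln b\<bar> \<le> \<bar>a - b\<bar> / m"
proof -
  have *: "ln a - ln b \<le> \<bar>a - b\<bar> / m" if "m \<le> a" "m \<le> b" for a b
  proof -
    have "ln a - ln b \<le> (a - b) / b"
      using ln_diff_le[of a b] that assms(1) by simp
    also have "\<dots> \<le> \<bar>a - b\<bar> / b" using that assms(1) by (simp add: divide_right_mono)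
    also have "\<dots> \<le> \<bar>a - b\<bar> / m" using that assms(1) by (intro divide_left_mono) auto
    finally show ?thesis .
  qed
  from *[of a b] *[of b a] assms show ?thesis by (simp add: abs_minus_commute abs_le_iff)
qed

text \<open>With v = 2 - 2 cos (2 x) the argument of the logarithm is u = r v + (1 - r)^2. Where v
  >= d, both u and v stay above d / 2 because r >= 1/2, so ln is Lipschitz there; and |u - v| <= 5
  (1 - r) because v <= 4.\<close>

lemma uniform_limit_ln_Abel:
  assumes "0 < d"
  defines "r \<equiv> \<lambda>n. 1 - 1 / real (n + 2)"
  shows "uniform_limit {x. d \<le> 2 - 2 * cos (2 * x)} (\<lambda>n x. - ln (1 - 2 * r n * cos (2 * x) + (r n)\<^sup>2) / 2)
     (\<lambda>x. - ln (2 - 2 * cos (2 * x)) / 2) sequentially"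
proof (rule uniform_limitI)
  fix e :: real assume e: "0 < e"
  have lim: "(\<lambda>n. 5 * (1 / real (n + 2)) / d) \<longlonglongrightarrow> 5 * 0 / d"
    by (intro tendsto_intros LIMSEQ_ignore_initial_segment lim_1_over_n) (use assms in auto)
  have "eventually (\<lambda>n. 5 * (1 / real (n + 2)) / d < e) sequentially"
    using order_tendstoD(2)[OF lim, of e] e by simp
  then show "\<forall>\<^sub>F n in sequentially. \<forall>x\<in>{x. d \<le> 2 - 2 * cos (2 * x)}.
      dist (- ln (1 - 2 * r n * cos (2 * x) + (r n)\<^sup>2) / 2) (- ln (2 - 2 * cos (2 * x)) / 2) < e"
  proof eventually_elim
    case (elim n)
    show ?case
    proof
      fix x assume x: "x \<in> {x. d \<le> 2 - 2 * cos (2 * x)}"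
      define v where "v = 2 - 2 * cos (2 * x)"
      define u where "u = 1 - 2 * r n * cos (2 * x) + (r n)\<^sup>2"
      have v: "d \<le> v" "v \<le> 4" using x cos_ge_minus_one[of "2*x"] by (auto simp: v_def simp del: cos_ge_minus_one)
      have rn: "1/2 \<le> r n" "r n < 1" by (auto simp: r_def field_simps)
      have u: "u = r n * v + (1 - r n)\<^sup>2" by (simp add: u_def v_def power2_eq_square algebra_simps)
      have "d / 2 \<le> r n * v"
        using mult_mono[of "1/2" "r n" d v] rn v assms by simp
      then have ud: "d / 2 \<le> u" unfolding u by (simp add: add_increasing2)
      have "\<bar>ln u - ln v\<bar> \<le> \<bar>u - v\<bar> / (d / 2)"
        by (rule abs_ln_diff_le) (use ud v assms in auto)
      also have "\<bar>u - v\<bar> \<le> 5 * (1 - r n)"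
      proof -
        have "u - v = (1 - r n) * ((1 - r n) - v)" by (simp add: u power2_eq_square algebra_simps)
        then have "\<bar>u - v\<bar> = (1 - r n) * \<bar>(1 - r n) - v\<bar>" using rn by (simp add: abs_mult)
        also have "\<dots> \<le> (1 - r n) * 5" using rn v \<open>0 < d\<close> by (intro mult_left_mono) (auto simp: abs_le_iff)
        finally show ?thesis by simp
      qed
      finally have "\<bar>ln u - ln v\<bar> \<le> 5 * (1 - r n) / (d / 2)" using assms(1) by (simp add: divide_right_mono)
      also have "\<dots> = 2 * (5 * (1 / real (n + 2)) / d)" by (simp add: r_def)
      also have "\<dots> < 2 * e" using elim by simp
      finally have "\<bar>ln u - ln v\<bar> < 2 * e" .
      then show "dist (- ln (1 - 2 * r n * cos (2 * x) + (r n)\<^sup>2) / 2) (- ln (2 - 2 * cos (2 * x)) / 2) < e"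
        by (simp add: dist_real_def u_def v_def)
    qed
  qed
qed

text \<open>The coefficients are absolutely summable, so the series in t converges uniformly on
  [0, 1] and is continuous up to t = 1.\<close>

lemma Abel_lobachevsky_tendsto:
  defines "r \<equiv> \<lambda>n. 1 - 1 / real (n + 2)"
  shows "(\<lambda>k. \<Sum>n. r k ^ Suc n * sin (2 * real (Suc n) * x) / (2 * (real (Suc n))\<^sup>2)) \<longlonglongrightarrow> lobachevsky x"
proof -
  let ?f = "\<lambda>n t. t ^ Suc n * sin (2 * real (Suc n) * x) / (2 * (real (Suc n))\<^sup>2)"
  have "uniform_limit {0..1} (\<lambda>k t. \<Sum>n<k. ?f n t) (\<lambda>t. \<Sum>n. ?f n t) sequentially"
  proof (rule Weierstrass_m_test[OF _ summable_inverse_squares])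
    fix n and t :: real assume t: "t \<in> {0..1}"
    have "\<bar>t ^ Suc n * sin (2 * real (Suc n) * x)\<bar> \<le> 1 * 1"
      unfolding abs_mult by (rule mult_mono) (use t in \<open>auto simp: power_le_one abs_le_iff simp del: power_Suc\<close>)
    then show "norm (?f n t) \<le> 1 / (2 * (real (Suc n))\<^sup>2)"
      by (simp add: divide_right_mono del: power_Suc of_nat_Suc)
  qed
  then have "continuous_on {0..1} (\<lambda>t. \<Sum>n. ?f n t)"
    by (rule uniform_limit_theorem[rotated])
       (auto intro!: always_eventually continuous_intros simp del: of_nat_Suc)
  moreover have "r \<longlonglongrightarrow> 1 - 0"
    unfolding r_def by (intro tendsto_intros LIMSEQ_ignore_initial_segment lim_1_over_n)
  moreover have "r k \<in> {0..1}" for k by (simp add: r_def)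
  ultimately have "(\<lambda>k. \<Sum>n. ?f n (r k)) \<longlonglongrightarrow> (\<Sum>n. ?f n 1)"
    by (intro continuous_on_tendsto_compose[of "{0..1}" "\<lambda>t. \<Sum>n. ?f n t"]) auto
  then show ?thesis by (simp add: lobachevsky_def)
qed

text \<open>The regularised functions converge to \<open>lobachevsky\<close> and their derivatives
  converge uniformly away from the zeros of the sine, so the limit may be differentiated. The limit
  derivative -ln (4 sin^2 x) / 2 equals -ln (2 sin x) since the sine is positive.\<close>

lemma DERIV_lobachevsky:
  assumes "0 < x" "x < pi"
  shows "(lobachevsky has_real_derivative - ln (2 * sin x)) (at x)"
proof -
  define e where "e = min x (pi - x) / 2"
  define S where "S = {e<..<pi - e}"
  have e: "0 < e" "e < pi / 2" using assms by (auto simp: e_def min_def)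
  define r where "r = (\<lambda>n. 1 - 1 / real (n + 2))"
  define f where "f = (\<lambda>k x. \<Sum>n. r k ^ Suc n * sin (2 * real (Suc n) * x) / (2 * (real (Suc n))\<^sup>2))"
  let ?f' = "\<lambda>n x. - ln (1 - 2 * r n * cos (2 * x) + (r n)\<^sup>2) / 2"
  let ?g' = "\<lambda>x. - ln (2 - 2 * cos (2 * x)) / 2"
  have g'_eq: "2 - 2 * cos (2 * y) = (2 * sin y)\<^sup>2" for y :: real
    by (simp add: cos_double_sin power2_eq_square)
  have sin_ge: "sin e \<le> sin y" if "y \<in> S" for y
  proof (cases "y \<le> pi / 2")
    case True
    then show ?thesis using that e by (intro sin_monotone_2pi_le) (auto simp: S_def)
  next
    case False
    then have "sin e \<le> sin (pi - y)" using that e by (intro sin_monotone_2pi_le) (auto simp: S_def)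
    then show ?thesis by simp
  qed
  have sin_e: "0 < sin e" using e by (intro sin_gt_zero) auto
  have "S \<subseteq> {x. (2 * sin e)\<^sup>2 \<le> 2 - 2 * cos (2 * x)}"
    unfolding g'_eq using sin_ge sin_e by (auto intro!: power_mono)
  moreover have "0 < (2 * sin e)\<^sup>2" using sin_e by simp
  ultimately have ul: "uniform_limit S ?f' ?g' sequentially"
    unfolding r_def using uniform_limit_ln_Abel uniform_limit_on_subset by blast
  have xS: "x \<in> S" using assms by (auto simp: S_def e_def min_def field_simps)
  have "\<exists>g. \<forall>x\<in>S. (\<lambda>n. f n x) \<longlonglongrightarrow> g x \<and> (g has_derivative (\<lambda>h. ?g' x * h)) (at x within S)"
  proof (rule has_derivative_sequence)
    show "convex S" by (simp add: S_def convex_real_interval)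
    show "(f n has_derivative (\<lambda>h. ?f' n x * h)) (at x within S)" for n x
      unfolding f_def
      by (rule has_field_derivative_imp_has_derivative[OF has_field_derivative_at_within[OF DERIV_lobachevsky_Abel]])
         (auto simp: r_def)
    show "\<forall>\<^sub>F n in sequentially. \<forall>x\<in>S. \<forall>h. norm (?f' n x * h - ?g' x * h) \<le> e * norm h" if "0 < e" for e
      using uniform_limitD[OF ul that]
    proof eventually_elim
      case (elim n)
      show ?case
      proof (intro ballI allI)
        fix x h assume "x \<in> S"
        then have "\<bar>?f' n x - ?g' x\<bar> \<le> e" using elim by (auto simp: dist_real_def less_imp_le)
        then have "\<bar>?f' n x - ?g' x\<bar> * \<bar>h\<bar> \<le> e * \<bar>h\<bar>" by (rule mult_right_mono) simp
        then show "norm (?f' n x * h - ?g' x * h) \<le> e * norm h"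
          unfolding real_norm_def abs_mult[symmetric] left_diff_distrib .
      qed
    qed
    show "x \<in> S" by fact
    show "(\<lambda>n. f n x) \<longlonglongrightarrow> lobachevsky x" unfolding f_def r_def by (rule Abel_lobachevsky_tendsto)
  qed
  then obtain g where g: "\<And>x. x \<in> S \<Longrightarrow> (\<lambda>n. f n x) \<longlonglongrightarrow> g x"
      "\<And>x. x \<in> S \<Longrightarrow> (g has_derivative (\<lambda>h. ?g' x * h)) (at x within S)"
    by blast
  have gl: "g y = lobachevsky y" if "y \<in> S" for y
    using LIMSEQ_unique[OF g(1)[OF that]] Abel_lobachevsky_tendsto[of y] by (simp add: f_def r_def)
  have oS: "open S" by (simp add: S_def)
  have "(g has_real_derivative ?g' x) (at x within S)"
    unfolding has_field_derivative_def by (rule g(2)[OF xS])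
  then have "(g has_real_derivative ?g' x) (at x)"
    unfolding at_within_open[OF xS oS] .
  then have "(lobachevsky has_real_derivative ?g' x) (at x)"
    by (rule has_field_derivative_transform_within_open[OF _ oS xS gl])
  moreover have "?g' x = - ln (2 * sin x)"
    unfolding g'_eq using sin_gt_zero[OF assms] ln_realpow[of "2 * sin x" 2] by (simp only:)
  ultimately show ?thesis by simp
qed

lemma lobachevsky_half_pi [simp]: "lobachevsky (pi / 2) = 0"
proof -
  have "sin (2 * real (Suc n) * (pi / 2)) = 0" for n
    using sin_npi[of "Suc n"] by (simp add: algebra_simps)
  then show ?thesis by (simp add: lobachevsky_def del: of_nat_Suc)
qed

lemma lobachevsky_pi [simp]: "lobachevsky pi = 0"
proof -
  have "sin (2 * real (Suc n) * pi) = 0" for n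
    using sin_npi[of "2 * Suc n"] by (simp add: algebra_simps)
  then show ?thesis by (simp add: lobachevsky_def del: of_nat_Suc)
qed

lemma lobachevsky_pi_minus: "lobachevsky (pi - x) = - lobachevsky x"
proof -
  have "sin (2 * real (Suc n) * (pi - x)) = - sin (2 * real (Suc n) * x)" for n
  proof -
    have "2 * real (Suc n) * (pi - x) = - (2 * real (Suc n) * x) + real (2 * Suc n) * pi"
      by (simp add: algebra_simps)
    also have "sin \<dots> = - sin (2 * real (Suc n) * x)"
      unfolding sin_add using sin_npi[of "2 * Suc n"] cos_npi[of "2 * Suc n"] by simp
    finally show ?thesis .
  qed
  then have "(\<lambda>n. - (sin (2 * real (Suc n) * x) / (2 * (real (Suc n))\<^sup>2))) sums lobachevsky (pi - x)"
    using lobachevsky_sums[of "pi - x"] by simp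
  from sums_unique2[OF this sums_minus[OF lobachevsky_sums]] show ?thesis .
qed

text \<open>The arguments differ by n times a third of a full turn, so the sum contains the n-th
  powers of the three cube roots of unity, which cancel unless 3 divides n.\<close>

lemma sum_sin_thirds:
  "sin (2 * real n * x) + sin (2 * real n * (x + pi / 3)) + sin (2 * real n * (x + 2 * pi / 3))
     = (if 3 dvd n then 3 * sin (2 * real n * x) else 0)"
proof -
  have s: "sin (y + real k * (2 * pi)) = sin y" for y k
    using sin_npi[of "2*k"] cos_npi[of "2*k"] by (simp add: sin_add mult.commute mult.left_commute)
  have sin_240: "sin (4 * pi / 3) = - sqrt 3 / 2" and cos_240: "cos (4 * pi / 3) = - 1 / 2"
    using sin_add[of pi "pi / 3"] cos_add[of pi "pi / 3"] by (simp_all add: sin_60 cos_60)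
  define m where "m = n div 3"
  consider "n = 3 * m" | "n = 3 * m + 1" | "n = 3 * m + 2"
    unfolding m_def by linarith
  then show ?thesis
  proof cases
    case 1
    have "2 * real n * (x + pi / 3) = 2 * real n * x + real m * (2 * pi)"
      "2 * real n * (x + 2 * pi / 3) = 2 * real n * x + real (2 * m) * (2 * pi)"
      by (simp_all add: 1 algebra_simps)
    then show ?thesis unfolding s using 1 by (simp only: s) simp
  next
    case 2
    have "2 * real n * (x + pi / 3) = (2 * real n * x + 2 * pi / 3) + real m * (2 * pi)"
      "2 * real n * (x + 2 * pi / 3) = (2 * real n * x + 4 * pi / 3) + real (2 * m) * (2 * pi)"
      by (simp_all add: 2 algebra_simps)
    moreover have "\<not> 3 dvd n" using 2 by presburger
    ultimately show ?thesis by (simp only: s) (simp add: sin_add sin_120 cos_120 sin_240 cos_240)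
  next
    case 3
    have "2 * real n * (x + pi / 3) = (2 * real n * x + 4 * pi / 3) + real m * (2 * pi)"
      "2 * real n * (x + 2 * pi / 3) = (2 * real n * x + 2 * pi / 3) + real (2 * m + 1) * (2 * pi)"
      by (simp_all add: 3 algebra_simps)
    moreover have "\<not> 3 dvd n" using 3 by presburger
    ultimately show ?thesis by (simp only: s) (simp add: sin_add sin_120 cos_120 sin_240 cos_240)
  qed
qed

text \<open>Only the terms with n = 3 m survive in the sum of the three series; there the factor 3
  over 3^2 leaves a third of the series at 3 x.\<close>

lemma lobachevsky_triplication:
  "lobachevsky (3 * x) = 3 * (lobachevsky x + lobachevsky (x + pi / 3) + lobachevsky (x + 2 * pi / 3))"
proof -
  let ?t = "\<lambda>x n. sin (2 * real (Suc n) * x) / (2 * (real (Suc n))\<^sup>2)"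
  let ?h = "\<lambda>n. (if 3 dvd Suc n then 3 * ?t x n else 0)"
  have "(\<lambda>n. ?t x n + ?t (x + pi / 3) n + ?t (x + 2 * pi / 3) n) sums (lobachevsky x + lobachevsky (x + pi / 3) + lobachevsky (x + 2 * pi / 3))"
    by (intro sums_add lobachevsky_sums)
  moreover have "?t x n + ?t (x + pi / 3) n + ?t (x + 2 * pi / 3) n = ?h n" for n
    using sum_sin_thirds[of "Suc n" x] unfolding add_divide_distrib[symmetric]
    by (simp del: of_nat_Suc)
  ultimately have "?h sums (lobachevsky x + lobachevsky (x + pi / 3) + lobachevsky (x + 2 * pi / 3))" by simp
  \<comment> \<open>The terms are indexed by \<open>Suc n\<close>, so the multiples of 3 sit at n =
    3 m + 2.\<close>
  moreover have "(\<lambda>m. ?h (3 * m + 2)) sums c \<longleftrightarrow> ?h sums c" for c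
  proof (rule sums_mono_reindex)
    show "strict_mono (\<lambda>m::nat. 3 * m + 2)" by (simp add: strict_mono_def)
    show "?h n = 0" if "n \<notin> range (\<lambda>m. 3 * m + 2)" for n
    proof -
      have "\<not> 3 dvd Suc n"
      proof
        assume "3 dvd Suc n"
        then obtain k where "Suc n = 3 * k" by blast
        then have "n = 3 * (k - 1) + 2" by (cases k) auto
        with that show False by blast
      qed
      then show ?thesis by simp
    qed
  qed
  ultimately have "(\<lambda>m. ?h (3 * m + 2)) sums (lobachevsky x + lobachevsky (x + pi / 3) + lobachevsky (x + 2 * pi / 3))" by simp
  moreover have "?h (3 * m + 2) = 1 / 3 * ?t (3 * x) m" for m
  proof -
    have "3 dvd Suc (3 * m + 2)" by presburger
    moreover have "real (Suc (3 * m + 2)) = 3 * real (Suc m)" by simp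
    ultimately show ?thesis by (simp add: power2_eq_square field_simps del: of_nat_Suc)
  qed
  ultimately have "(\<lambda>m. 1 / 3 * ?t (3 * x) m) sums (lobachevsky x + lobachevsky (x + pi / 3) + lobachevsky (x + 2 * pi / 3))" by simp
  from sums_unique2[OF this sums_mult[OF lobachevsky_sums, of "1/3" "3*x"]] show ?thesis by simp
qed

lemma lobachevsky_quarter_pi: "lobachevsky (pi / 4) = catalan_const / 2"
proof -
  let ?t = "\<lambda>n. sin (2 * real (Suc n) * (pi / 4)) / (2 * (real (Suc n))\<^sup>2)"
  have 1: "?t (2 * k) = (1/2) * ((-1) ^ k / (2 * real k + 1)\<^sup>2)" for k
  proof -
    have "2 * real (Suc (2 * k)) * (pi / 4) = pi / 2 + real k * pi" by (simp add: algebra_simps)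
    then have "sin (2 * real (Suc (2 * k)) * (pi / 4)) = (-1) ^ k"
      using sin_npi[of k] cos_npi[of k] by (simp only: sin_add) simp
    then show ?thesis by (simp add: add.commute)
  qed
  have 2: "?t n = 0" if "n \<notin> range (\<lambda>k. 2 * k)" for n
  proof -
    have "odd n" using that by (auto elim!: evenE)
    then obtain k where "n = 2 * k + 1" by (elim oddE)
    then have "2 * real (Suc n) * (pi / 4) = real (Suc k) * pi" by (simp add: algebra_simps)
    then have "sin (2 * real (Suc n) * (pi / 4)) = 0" by (simp only: sin_npi)
    then show ?thesis by simp
  qed
  have "(\<lambda>k. ?t (2 * k)) sums lobachevsky (pi / 4)"
    using sums_mono_reindex[of "\<lambda>k. 2 * k" ?t "lobachevsky (pi / 4)", OF _ 2] lobachevsky_sums[of "pi / 4"]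
    by (simp add: strict_mono_def)
  then have "(\<lambda>k. (1/2) * ((-1) ^ k / (2 * real k + 1)\<^sup>2)) sums lobachevsky (pi / 4)" unfolding 1 .
  then have "(\<lambda>k. 2 * ((1/2) * ((-1) ^ k / (2 * real k + 1)\<^sup>2))) sums (2 * lobachevsky (pi / 4))" by (rule sums_mult)
  then show ?thesis unfolding catalan_const_def by (simp add: sums_iff)
qed

text \<open>Triplication at pi / 4, with the values at 7 pi / 12, 11 pi / 12 and 3 pi / 4 reflected
  at pi / 2: if S is the sum in question and L the value at pi / 4, then -L = 3 (L - S), so S = 4 L
  / 3.\<close>

lemma lobachevsky_twelfth_pi: "lobachevsky (pi / 12) + lobachevsky (5 * pi / 12) = 2 * catalan_const / 3"
proof -
  have "lobachevsky (pi / 12) = - lobachevsky (pi / 4 + 2 * pi / 3)" "lobachevsky (5 * pi / 12) = - lobachevsky (pi / 4 + pi / 3)"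
    "lobachevsky (3 * (pi / 4)) = - lobachevsky (pi / 4)"
    using lobachevsky_pi_minus[of "pi / 12"] lobachevsky_pi_minus[of "5 * pi / 12"] lobachevsky_pi_minus[of "pi / 4"]
    by (simp_all add: field_simps)
  with lobachevsky_triplication[of "pi / 4"] show ?thesis by (simp add: lobachevsky_quarter_pi)
qed

text \<open>Half of the interpolated next term \<open>1 / (2 n)\<^sup>2\<close> is added to the partial sums; the corrected
  sums enclose the limit from both sides with an error of order \<open>n\<close> to the power \<open>-4\<close>.\<close>

definition catalan_approx :: "nat \<Rightarrow> real" where
  "catalan_approx n = (\<Sum>k<n. (-1) ^ k / (2 * real k + 1)\<^sup>2) + (-1) ^ n / (8 * (real n)\<^sup>2)"

lemma catalan_sums: "(\<lambda>k. (-1) ^ k / (2 * real k + 1)\<^sup>2) sums catalan_const"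
proof -
  have "summable (\<lambda>n. inverse ((real (Suc n))\<^sup>2))"
    by (rule inverse_power_summable[THEN summable_Suc_iff[THEN iffD2]]) simp
  then have "summable (\<lambda>k. (-1) ^ k / (2 * real k + 1)\<^sup>2)"
    by (rule summable_comparison_test'[of _ 0])
       (auto simp: norm_divide power_abs inverse_eq_divide intro!: divide_left_mono power_mono mult_pos_pos)
  then show ?thesis unfolding catalan_const_def by (rule summable_sums)
qed

lemma catalan_approx_limit: "catalan_approx \<longlonglongrightarrow> catalan_const"
proof -
  have "(\<lambda>n. (-1) ^ n / (8 * (real n)\<^sup>2)) \<longlonglongrightarrow> 0"
  proof (rule Lim_null_comparison)
    show "(\<lambda>n. inverse ((real n)\<^sup>2)) \<longlonglongrightarrow> 0"
      using tendsto_power[OF lim_inverse_n, of 2] by (simp add: power_inverse)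
    have "norm ((-1) ^ n / (8 * (real n)\<^sup>2)) = inverse ((real n)\<^sup>2) / 8" for n
      by (simp add: norm_divide norm_power norm_mult inverse_eq_divide)
    then show "\<forall>\<^sub>F n in sequentially. norm ((-1) ^ n / (8 * (real n)\<^sup>2)) \<le> inverse ((real n)\<^sup>2)"
      by (intro always_eventually allI) (simp only:, simp)
  qed
  moreover have "(\<lambda>n. \<Sum>k<n. (-1) ^ k / (2 * real k + 1)\<^sup>2) \<longlonglongrightarrow> catalan_const"
    using catalan_sums by (simp only: sums_def)
  ultimately have "(\<lambda>n. (\<Sum>k<n. (-1) ^ k / (2 * real k + 1)\<^sup>2) + (-1) ^ n / (8 * (real n)\<^sup>2)) \<longlonglongrightarrow> catalan_const + 0"
    by (intro tendsto_add)
  moreover have "(\<lambda>n. (\<Sum>k<n. (-1) ^ k / (2 * real k + 1)\<^sup>2) + (-1) ^ n / (8 * (real n)\<^sup>2)) = catalan_approx"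
    by (rule ext) (simp only: catalan_approx_def)
  ultimately show ?thesis by (simp only: add_0_right)
qed

text \<open>For P = n (n + 1) the left side is the defect between two successive half-term
  corrections and the term between them. On the right, in q = 4 P + 1 = (2 n + 1)^2, it is visibly
  positive and decreasing.\<close>

lemma catalan_correction_identity:
  fixes P :: real
  assumes "P > 0"
  shows "(2 * P + 1) / (8 * P\<^sup>2) - 1 / (4 * P + 1)
    = 3 / ((4 * P + 1) * (4 * P + 1 - 1)) + 2 / ((4 * P + 1) * (4 * P + 1 - 1)\<^sup>2)"
proof -
  have *: "P \<noteq> 0" "4 * P + 1 \<noteq> 0" using assms by auto
  have "(2 * P + 1) / (8 * P\<^sup>2) - 1 / (4 * P + 1) = (6 * P + 1) / (8 * P\<^sup>2 * (4 * P + 1))"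
    using * by (subst diff_frac_eq) (auto simp: power2_eq_square algebra_simps)
  also have "\<dots> = (2 * (6 * P + 1)) / (2 * (8 * P\<^sup>2 * (4 * P + 1)))"
    by (rule mult_divide_mult_cancel_left[symmetric]) simp
  also have "2 * (8 * P\<^sup>2 * (4 * P + 1)) = (4 * P + 1) * (4 * P)\<^sup>2" by (simp add: power2_eq_square)
  also have "2 * (6 * P + 1) / ((4 * P + 1) * (4 * P)\<^sup>2) = 3 / ((4 * P + 1) * (4 * P + 1 - 1)) + 2 / ((4 * P + 1) * (4 * P + 1 - 1)\<^sup>2)"
    using * by (simp add: add_divide_distrib power2_eq_square)
  finally show ?thesis .
qed

lemma catalan_approx_step:
  assumes "n > 0"
  defines "q \<equiv> (2 * real n + 1)\<^sup>2"
  shows "catalan_approx (Suc n) = catalan_approx n - (-1) ^ n * (3 / (q * (q - 1)) + 2 / (q * (q - 1)\<^sup>2))"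
proof -
  define y where "y = real n"
  have y: "y > 0" using assms by (simp add: y_def)
  define P where "P = y * (y + 1)"
  have P: "P > 0" using y by (simp add: P_def)
  have q: "q = 4 * P + 1" by (simp add: q_def y_def P_def power2_eq_square algebra_simps)
  have "1 / (8 * y\<^sup>2) + 1 / (8 * (y + 1)\<^sup>2) = ((y + 1)\<^sup>2 + y\<^sup>2) / (8 * P\<^sup>2)"
    using y by (simp add: P_def add_divide_distrib power_mult_distrib)
  also have "(y + 1)\<^sup>2 + y\<^sup>2 = 2 * P + 1" by (simp add: P_def power2_eq_square algebra_simps)
  finally have "1 / (8 * y\<^sup>2) + 1 / (8 * (y + 1)\<^sup>2) - 1 / (2 * y + 1)\<^sup>2 = (2 * P + 1) / (8 * P\<^sup>2) - 1 / (4 * P + 1)"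
    using q by (simp add: q_def y_def)
  also have "\<dots> = 3 / (q * (q - 1)) + 2 / (q * (q - 1)\<^sup>2)"
    unfolding q by (rule catalan_correction_identity[OF P])
  finally have eq: "1 / (8 * y\<^sup>2) + 1 / (8 * (y + 1)\<^sup>2) - 1 / (2 * y + 1)\<^sup>2 = 3 / (q * (q - 1)) + 2 / (q * (q - 1)\<^sup>2)" .
  have "catalan_approx (Suc n) = catalan_approx n - (-1) ^ n * (1 / (8 * y\<^sup>2) + 1 / (8 * (y + 1)\<^sup>2) - 1 / (2 * y + 1)\<^sup>2)"
    by (simp add: catalan_approx_def y_def algebra_simps)
  then show ?thesis unfolding eq .
qed

lemma catalan_approx_step_antimono:
  fixes p q :: real
  assumes "1 < p" "p \<le> q"
  shows "3 / (q * (q - 1)) + 2 / (q * (q - 1)\<^sup>2) \<le> 3 / (p * (p - 1)) + 2 / (p * (p - 1)\<^sup>2)"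
proof (rule add_mono)
  have "p * (p - 1) \<le> q * (q - 1)" by (rule mult_mono) (use assms in auto)
  then show "3 / (q * (q - 1)) \<le> 3 / (p * (p - 1))"
    by (rule divide_left_mono) (use assms in auto)
  have "p * (p - 1)\<^sup>2 \<le> q * (q - 1)\<^sup>2" by (rule mult_mono) (use assms in \<open>auto intro: power_mono\<close>)
  then show "2 / (q * (q - 1)\<^sup>2) \<le> 2 / (p * (p - 1)\<^sup>2)"
    by (rule divide_left_mono) (use assms in auto)
qed

text \<open>Successive steps alternate in sign and shrink in size, so two of them together move the
  even approximations down and the odd ones up.\<close>

lemma catalan_approx_even_odd:
  assumes "m > 0"
  shows "catalan_approx (2 * Suc m) \<le> catalan_approx (2 * m)"
    and "catalan_approx (2 * m + 1) \<le> catalan_approx (2 * Suc m + 1)"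
proof -
  have "catalan_approx (Suc (Suc n)) - catalan_approx n = (-1) ^ n * d" "d \<le> 0" if "n > 0" 
    "d = (3 / ((2 * real (Suc n) + 1)\<^sup>2 * ((2 * real (Suc n) + 1)\<^sup>2 - 1)) + 2 / ((2 * real (Suc n) + 1)\<^sup>2 * ((2 * real (Suc n) + 1)\<^sup>2 - 1)\<^sup>2))
       - (3 / ((2 * real n + 1)\<^sup>2 * ((2 * real n + 1)\<^sup>2 - 1)) + 2 / ((2 * real n + 1)\<^sup>2 * ((2 * real n + 1)\<^sup>2 - 1)\<^sup>2))"
    for n d
  proof -
    show "catalan_approx (Suc (Suc n)) - catalan_approx n = (-1) ^ n * d"
      unfolding that(2) using catalan_approx_step[of n] catalan_approx_step[of "Suc n"] that(1)
      by (simp add: algebra_simps)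
    have "1 < (2 * real n + 1)\<^sup>2" using that(1) by (intro one_less_power) auto
    moreover have "(2 * real n + 1)\<^sup>2 \<le> (2 * real (Suc n) + 1)\<^sup>2" by (intro power_mono) auto
    ultimately show "d \<le> 0" unfolding that(2)
      by (simp only: diff_le_0_iff_le) (rule catalan_approx_step_antimono)
  qed
  note * = this[OF _ refl]
  show "catalan_approx (2 * Suc m) \<le> catalan_approx (2 * m)"
    using *[of "2 * m"] assms by simp
  show "catalan_approx (2 * m + 1) \<le> catalan_approx (2 * Suc m + 1)"
    using *[of "2 * m + 1"] assms by simp
qed

lemma catalan_bounds:
  assumes "m > 0"
  shows "catalan_const \<le> catalan_approx (2 * m)" "catalan_approx (2 * m + 1) \<le> catalan_const"
proof -
  have "decseq (\<lambda>k. catalan_approx (2 * (m + k)))"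
    by (rule decseq_SucI) (use catalan_approx_even_odd(1)[of "m + _"] assms in simp)
  moreover have "(\<lambda>k. catalan_approx (2 * (m + k))) \<longlonglongrightarrow> catalan_const"
    by (rule LIMSEQ_subseq_LIMSEQ[OF catalan_approx_limit, unfolded comp_def]) (simp add: strict_mono_def)
  ultimately have "catalan_const \<le> catalan_approx (2 * (m + 0))" by (rule decseq_ge)
  then show "catalan_const \<le> catalan_approx (2 * m)" by simp
  have "incseq (\<lambda>k. catalan_approx (2 * (m + k) + 1))"
    by (rule incseq_SucI) (use catalan_approx_even_odd(2)[of "m + _"] assms in simp)
  moreover have "(\<lambda>k. catalan_approx (2 * (m + k) + 1)) \<longlonglongrightarrow> catalan_const"
    by (rule LIMSEQ_subseq_LIMSEQ[OF catalan_approx_limit, unfolded comp_def]) (simp add: strict_mono_def)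
  ultimately have "catalan_approx (2 * (m + 0) + 1) \<le> catalan_const" by (rule incseq_le)
  then show "catalan_approx (2 * m + 1) \<le> catalan_const" by simp
qed

lemma catalan_approx_30: "catalan_approx 30 \<le> 91596571 / 100000000" "- catalan_approx 30 \<le> - (91596570 / 100000000)"
  unfolding catalan_approx_def by (simp_all add: lessThan_nat_numeral lessThan_Suc)

lemma catalan_numeric: "(91596548 / 100000000) \<le> catalan_const" "catalan_const \<le> (91596571 / 100000000)"
proof -
  \<comment> \<open>3721 = 61^2 is \<open>q\<close> for n = 30. This step, about 2.2e-7, is the
    width of the enclosure of the constant apart from rounding.\<close>
  have "catalan_approx 31 = catalan_approx 30 - (3 / (3721 * 3720) + 2 / (3721 * 3720\<^sup>2))"
    using catalan_approx_step[of 30] by simp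
  with catalan_approx_30 show "(91596548 / 100000000) \<le> catalan_const" "catalan_const \<le> (91596571 / 100000000)"
    using catalan_bounds[of 15] by simp_all
qed

lemma catalan_pos: "0 < catalan_const" using catalan_numeric by linarith

lemma density_numeric: "\<bar>3 / 4 * inverse catalan_const - 0.818808\<bar> < 0.0000005"
proof -
  have *: "\<bar>x - 0.818808\<bar> < 0.0000005" if "x < 8188085 / 10000000" "8188076 / 10000000 < x" for x :: real
    unfolding abs_less_iff using that by (intro conjI) simp_all
  have "3 / 4 * inverse catalan_const = 3 / (4 * catalan_const)" by (simp add: field_simps)
  moreover have "3 / (4 * catalan_const) < 8188085 / 10000000" "8188076 / 10000000 < 3 / (4 * catalan_const)"
    using catalan_numeric by (simp_all add: divide_less_eq less_divide_eq catalan_pos)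
  ultimately show ?thesis by (intro *) simp_all
qed

section \<open>Log-sine integrals for the two triangle sizes\<close>

lemma two_sin_two_sin: "2 * sin (pi / 3 - x) * (2 * sin (pi / 3 + x)) = 4 * (cos x)\<^sup>2 - 1"
proof -
  have "sin (pi / 3 - x) * sin (pi / 3 + x) = (sin (pi / 3))\<^sup>2 * (cos x)\<^sup>2 - (cos (pi / 3))\<^sup>2 * (sin x)\<^sup>2"
    by (simp add: sin_add sin_diff power2_eq_square algebra_simps)
  also have "\<dots> = (cos x)\<^sup>2 - 1 / 4"
    by (simp add: sin_60 cos_60 power_divide sin_squared_eq field_simps)
  finally show ?thesis by simp
qed

lemma DERIV_lobachevsky_comp:
  assumes "(g has_real_derivative g') (at x within S)" "0 < g x" "g x < pi"
  shows "((\<lambda>x. lobachevsky (g x)) has_real_derivative (- ln (2 * sin (g x)) * g')) (at x within S)"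
  by (rule DERIV_chain2[OF DERIV_lobachevsky assms(1)]) (use assms in auto)

text \<open>Since 1 + tan^2 = 1 / cos^2, the argument is (4 cos^2 x - 1) / (2 cos x)^2, and its
  numerator factors into two sines. Every summand is then a derivative of \<open>lobachevsky\<close>
  at a shifted argument, up to a factor.\<close>

lemma ln_triangle_half:
  assumes "0 \<le> x" "x < pi / 3"
  shows "ln (1 - (1 + (tan x)\<^sup>2) / 4) = ln (2 * sin (pi / 3 - x)) + ln (2 * sin (pi / 3 + x)) - 2 * ln (2 * cos x)"
proof -
  have c: "0 < cos x" using assms by (intro cos_gt_zero_pi) auto
  have s: "0 < 2 * sin (pi / 3 - x)" "0 < 2 * sin (pi / 3 + x)"
    using assms by (auto intro!: sin_gt_zero)
  have t: "1 + (tan x)\<^sup>2 = 1 / (cos x)\<^sup>2" using c tan_sec[of x] by (simp add: power_divide inverse_eq_divide)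
  have "1 - (1 + (tan x)\<^sup>2) / 4 = (4 * (cos x)\<^sup>2 - 1) / (2 * cos x)\<^sup>2"
    unfolding t using c by (simp add: field_simps power2_eq_square)
  also have "\<dots> = 2 * sin (pi / 3 - x) * (2 * sin (pi / 3 + x)) / (2 * cos x)\<^sup>2"
    unfolding two_sin_two_sin ..
  finally show ?thesis using c s by (simp add: ln_div ln_mult_pos ln_realpow power2_eq_square)
qed

text \<open>Here the argument is 2 cos (2 x) / (2 cos x)^2; the cosine of 2 x is written as a
  shifted sine to match the derivative of \<open>lobachevsky\<close>.\<close>

lemma ln_triangle_inverse_sqrt2:
  assumes "0 \<le> x" "x < pi / 4"
  shows "ln (1 - (1 + (tan x)\<^sup>2) / 2) = ln (2 * sin (2 * x + pi / 2)) - 2 * ln (2 * cos x)"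
proof -
  have c: "0 < cos x" using assms by (intro cos_gt_zero_pi) auto
  have c2: "0 < cos (2 * x)" using assms by (intro cos_gt_zero_pi) auto
  have t: "1 + (tan x)\<^sup>2 = 1 / (cos x)\<^sup>2" using c tan_sec[of x] by (simp add: power_divide inverse_eq_divide)
  have "1 - (1 + (tan x)\<^sup>2) / 2 = (2 * cos (2 * x)) / (2 * cos x)\<^sup>2"
    unfolding t cos_double_cos using c by (simp add: field_simps power2_eq_square)
  moreover have "sin (2 * x + pi / 2) = cos (2 * x)" by (simp add: sin_add)
  ultimately show ?thesis using c c2 by (simp add: ln_div ln_mult_pos ln_realpow power2_eq_square)
qed

text \<open>Substitution t = tan x; \<open>c\<close> stands for the square of the leg. The
  derivative is demanded only in the open interval because for c = 1/2 the logarithm is singular at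
  t = 1.\<close>

lemma has_integral_triangle_arctan:
  assumes cont: "continuous_on {0..pi / 4} G"
    and der: "\<And>x. 0 < x \<Longrightarrow> x < pi / 4 \<Longrightarrow> (G has_real_derivative ln (1 - c * (1 + (tan x)\<^sup>2))) (at x)"
  shows "((\<lambda>t. - ln (1 - c * (1 + t\<^sup>2)) / (4 * (1 + t\<^sup>2))) has_integral (G 0 - G (pi / 4)) / 4) {0..1}"
proof -
  let ?F = "\<lambda>t. - G (arctan t) / 4"
  have "((\<lambda>t. - ln (1 - c * (1 + t\<^sup>2)) / (4 * (1 + t\<^sup>2))) has_integral (?F 1 - ?F 0)) {0..1}"
  proof (rule fundamental_theorem_of_calculus_interior)
    have "arctan t \<in> {0..pi / 4}" if "t \<in> {0..1}" for t
      using that arctan_monotone'[of t 1] by (auto simp: arctan_one)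
    then have "continuous_on {0..1} (\<lambda>t. G (arctan t))"
      by (intro continuous_on_compose2[OF cont] continuous_intros) auto
    then show "continuous_on {0..1} ?F" by (intro continuous_intros) auto
    fix t :: real assume t: "t \<in> {0<..<1}"
    have "0 < arctan t" "arctan t < pi / 4"
      using t arctan_monotone[of t 1] by (auto simp: arctan_one)
    from der[OF this] have "(G has_real_derivative ln (1 - c * (1 + t\<^sup>2))) (at (arctan t))"
      by (simp add: tan_arctan)
    from DERIV_chain2[OF this DERIV_arctan]
    have "(?F has_real_derivative (- (ln (1 - c * (1 + t\<^sup>2)) * inverse (1 + t\<^sup>2)) / 4)) (at t)"
      by (intro DERIV_cdivide DERIV_minus)
    then show "(?F has_vector_derivative - ln (1 - c * (1 + t\<^sup>2)) / (4 * (1 + t\<^sup>2))) (at t)"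
      unfolding has_real_derivative_iff_has_vector_derivative[symmetric]
      by (rule DERIV_cong) (simp add: field_simps)
  qed simp
  then show ?thesis by (simp add: arctan_one field_simps)
qed

lemma ln_two_cos_lobachevsky: 
  assumes "0 \<le> x" "x < pi / 2"
  shows "((\<lambda>x. 2 * lobachevsky (x + pi / 2)) has_real_derivative - 2 * ln (2 * cos x)) (at x)"
proof -
  have "((\<lambda>x. lobachevsky (x + pi / 2)) has_real_derivative (- ln (2 * sin (x + pi / 2)) * 1)) (at x)"
    by (rule DERIV_lobachevsky_comp) (use assms in \<open>auto intro!: derivative_eq_intros\<close>)
  then have "((\<lambda>x. lobachevsky (x + pi / 2)) has_real_derivative (- ln (2 * cos x))) (at x)"
    by (simp add: sin_add)
  from DERIV_cmult[OF this, of 2] show ?thesis by (simp add: mult.commute)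
qed

lemma lobachevsky_three_quarters_pi: "lobachevsky (3 * pi / 4) = - catalan_const / 2"
  using lobachevsky_pi_minus[of "pi / 4"] by (simp add: lobachevsky_quarter_pi)

text \<open>The primitive vanishes at 0. At pi / 4 the first two terms give the sum of the values at
  pi / 12 and 5 pi / 12, and the last gives -C, so the total is 2 C / 3 - C.\<close>

lemma has_integral_triangle_half:
  "((\<lambda>t. - ln (1 - 1/4 * (1 + t\<^sup>2)) / (4 * (1 + t\<^sup>2))) has_integral catalan_const / 12) {0..1}"
proof -
  let ?G = "\<lambda>x. lobachevsky (pi / 3 - x) - lobachevsky (pi / 3 + x) + 2 * lobachevsky (x + pi / 2)"
  have "((\<lambda>t. - ln (1 - 1/4 * (1 + t\<^sup>2)) / (4 * (1 + t\<^sup>2))) has_integral (?G 0 - ?G (pi / 4)) / 4) {0..1}"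
  proof (rule has_integral_triangle_arctan)
    show "continuous_on {0..pi / 4} ?G"
      by (intro continuous_intros continuous_on_compose2[OF continuous_on_lobachevsky[of UNIV]]) auto
    fix x :: real assume x: "0 < x" "x < pi / 4"
    have "(?G has_real_derivative (- ln (2 * sin (pi / 3 - x)) * (-1) - (- ln (2 * sin (pi / 3 + x)) * 1) + (- 2 * ln (2 * cos x)))) (at x)"
      by (intro DERIV_add DERIV_diff DERIV_lobachevsky_comp ln_two_cos_lobachevsky)
         (use x in \<open>auto intro!: derivative_eq_intros\<close>)
    then show "(?G has_real_derivative ln (1 - 1/4 * (1 + (tan x)\<^sup>2))) (at x)"
      using ln_triangle_half[of x] x by simp
  qed
  moreover have "?G (pi / 4) = 2 * catalan_const / 3 - catalan_const"
  proof -
    have *: "pi / 3 - pi / 4 = pi / 12" "pi / 3 + pi / 4 = pi - 5 * pi / 12" "pi / 4 + pi / 2 = 3 * pi / 4" by simp_all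
    show ?thesis unfolding * lobachevsky_pi_minus lobachevsky_three_quarters_pi using lobachevsky_twelfth_pi by simp
  qed
  then have "(?G 0 - ?G (pi / 4)) / 4 = catalan_const / 12" by simp
  ultimately show ?thesis by (simp only:)
qed

text \<open>The primitive vanishes at 0 and equals -C at pi / 4, where only the term at 3 pi / 4
  survives.\<close>

lemma has_integral_triangle_inverse_sqrt2:
  "((\<lambda>t. - ln (1 - 1/2 * (1 + t\<^sup>2)) / (4 * (1 + t\<^sup>2))) has_integral catalan_const / 4) {0..1}"
proof -
  let ?G = "\<lambda>x. (- 1 / 2) * lobachevsky (2 * x + pi / 2) + 2 * lobachevsky (x + pi / 2)"
  have "((\<lambda>t. - ln (1 - 1/2 * (1 + t\<^sup>2)) / (4 * (1 + t\<^sup>2))) has_integral (?G 0 - ?G (pi / 4)) / 4) {0..1}"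
  proof (rule has_integral_triangle_arctan)
    show "continuous_on {0..pi / 4} ?G"
      by (intro continuous_intros continuous_on_compose2[OF continuous_on_lobachevsky[of UNIV]]) auto
    fix x :: real assume x: "0 < x" "x < pi / 4"
    have "(?G has_real_derivative ((- 1 / 2) * (- ln (2 * sin (2 * x + pi / 2)) * 2) + (- 2 * ln (2 * cos x)))) (at x)"
      by (intro DERIV_add DERIV_cmult DERIV_lobachevsky_comp ln_two_cos_lobachevsky)
         (use x in \<open>auto intro!: derivative_eq_intros\<close>)
    then show "(?G has_real_derivative ln (1 - 1/2 * (1 + (tan x)\<^sup>2))) (at x)"
      using ln_triangle_inverse_sqrt2[of x] x by simp
  qed
  moreover have "?G (pi / 4) = - catalan_const"
  proof -
    have *: "2 * (pi / 4) + pi / 2 = pi" "pi / 4 + pi / 2 = 3 * pi / 4" by simp_all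
    show ?thesis unfolding * lobachevsky_three_quarters_pi by simp
  qed
  then have "(?G 0 - ?G (pi / 4)) / 4 = catalan_const / 4" by simp
  ultimately show ?thesis by (simp only:)
qed

text \<open>The hyperbolic volume, per unit of Euclidean area of the base, of the region above the unit
  sphere at squared distance \<open>r\<close> from the origin.\<close>

definition column_vol :: "real \<Rightarrow> ennreal" where
  "column_vol r = (if r < 1 then ennreal (1 / (2 * (1 - r))) else \<infinity>)"

lemma measurable_column_vol [measurable]: "column_vol \<in> borel_measurable borel"
  unfolding column_vol_def by measurable

text \<open>The radial integral along the ray y = t x, with a = 1 + t^2; the factor x is the
  Jacobian of y = t x.\<close>

lemma nn_integral_ray:
  assumes "0 \<le> c" "0 < a" "c\<^sup>2 * a < 1"
  shows "(\<integral>\<^sup>+x. ennreal x * column_vol (x\<^sup>2 * a) * indicator {0..c} x \<partial>lborel) = ennreal (- ln (1 - c\<^sup>2 * a) / (4 * a))"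
proof -
  have lt: "x\<^sup>2 * a < 1" if "x \<in> {0..c}" for x
  proof -
    have "x\<^sup>2 * a \<le> c\<^sup>2 * a" using that assms by (intro mult_right_mono power_mono) auto
    then show ?thesis using assms(3) by (rule le_less_trans)
  qed
  have "(\<integral>\<^sup>+x. ennreal x * column_vol (x\<^sup>2 * a) * indicator {0..c} x \<partial>lborel)
      = (\<integral>\<^sup>+x. ennreal (x / (2 * (1 - x\<^sup>2 * a))) * indicator {0..c} x \<partial>lborel)"
    using lt by (intro nn_integral_cong) (auto simp: column_vol_def ennreal_mult''[symmetric] split: split_indicator)
  also have "\<dots> = ennreal (- ln (1 - c\<^sup>2 * a) / (4 * a) - - ln (1 - 0\<^sup>2 * a) / (4 * a))"
  proof (rule nn_integral_FTC_Icc)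
    fix x assume "x \<in> {0..c}"
    then have x: "0 \<le> x" "x \<le> c" by auto
    then have "x\<^sup>2 * a < 1" using lt by simp
    then show "((\<lambda>x. - ln (1 - x\<^sup>2 * a) / (4 * a)) has_real_derivative x / (2 * (1 - x\<^sup>2 * a))) (at x)"
      using assms(2)
      by (auto intro!: derivative_eq_intros simp: field_simps)
    show "0 \<le> x / (2 * (1 - x\<^sup>2 * a))" using x \<open>x\<^sup>2 * a < 1\<close> by simp
  qed (use assms in auto)
  finally show ?thesis by simp
qed

definition triangle_vol :: "real \<Rightarrow> ennreal" where
  "triangle_vol c = (\<integral>\<^sup>+x. \<integral>\<^sup>+y. column_vol (x\<^sup>2 + y\<^sup>2) * indicator {y. 0 \<le> y \<and> y \<le> x \<and> x \<le> c} y \<partial>lborel \<partial>lborel)"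

text \<open>Replacing y by the slope t = y / x turns the triangle into a rectangle, where the
  integral along rays can be done first. The bound 2 c^2 <= 1 keeps the triangle in the closed unit
  disc.\<close>

lemma triangle_vol_eq:
  assumes c: "0 \<le> c" "2 * c\<^sup>2 \<le> 1"
    and int: "((\<lambda>t. - ln (1 - c\<^sup>2 * (1 + t\<^sup>2)) / (4 * (1 + t\<^sup>2))) has_integral I) {0..1}"
  shows "triangle_vol c = ennreal I"
proof -
  have "triangle_vol c = (\<integral>\<^sup>+x. \<integral>\<^sup>+t. ennreal x * column_vol (x\<^sup>2 * (1 + t\<^sup>2)) * indicator {0..c} x * indicator {0..1} t \<partial>lborel \<partial>lborel)"
    unfolding triangle_vol_def
  proof (rule nn_integral_cong_AE)
    show "AE x in lborel. (\<integral>\<^sup>+y. column_vol (x\<^sup>2 + y\<^sup>2) * indicator {y. 0 \<le> y \<and> y \<le> x \<and> x \<le> c} y \<partial>lborel)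
      = (\<integral>\<^sup>+t. ennreal x * column_vol (x\<^sup>2 * (1 + t\<^sup>2)) * indicator {0..c} x * indicator {0..1} t \<partial>lborel)"
      using AE_lborel_singleton[of 0]
    proof eventually_elim
      case (elim x)
      show ?case
      proof (cases "0 < x")
        case True
        have "(\<integral>\<^sup>+y. column_vol (x\<^sup>2 + y\<^sup>2) * indicator {y. 0 \<le> y \<and> y \<le> x \<and> x \<le> c} y \<partial>lborel)
          = ennreal \<bar>x\<bar> * (\<integral>\<^sup>+t. column_vol (x\<^sup>2 + (0 + x * t)\<^sup>2) * indicator {y. 0 \<le> y \<and> y \<le> x \<and> x \<le> c} (0 + x * t) \<partial>lborel)"
          using True by (intro nn_integral_real_affine) auto
        also have "\<dots> = (\<integral>\<^sup>+t. ennreal x * (column_vol (x\<^sup>2 + (0 + x * t)\<^sup>2) * indicator {y. 0 \<le> y \<and> y \<le> x \<and> x \<le> c} (0 + x * t)) \<partial>lborel)"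
          using True by (subst nn_integral_cmult) auto
        also have "\<dots> = (\<integral>\<^sup>+t. ennreal x * column_vol (x\<^sup>2 * (1 + t\<^sup>2)) * indicator {0..c} x * indicator {0..1} t \<partial>lborel)"
          using True by (intro nn_integral_cong)
             (auto simp: power_mult_distrib algebra_simps zero_le_mult_iff mult_le_cancel_left1 split: split_indicator)
        finally show ?thesis .
      next
        case False
        then have "x < 0" using elim by simp
        then show ?thesis by (auto intro!: nn_integral_cong split: split_indicator)
      qed
    qed
  qed
  also have "\<dots> = (\<integral>\<^sup>+t. \<integral>\<^sup>+x. ennreal x * column_vol (x\<^sup>2 * (1 + t\<^sup>2)) * indicator {0..c} x * indicator {0..1} t \<partial>lborel \<partial>lborel)"
    by (rule lborel_pair.Fubini') measurable
  also have "\<dots> = (\<integral>\<^sup>+t. ennreal (- ln (1 - c\<^sup>2 * (1 + t\<^sup>2)) / (4 * (1 + t\<^sup>2))) * indicator {0..1} t \<partial>lborel)"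
  proof (rule nn_integral_cong_AE)
    show "AE t in lborel. (\<integral>\<^sup>+x. ennreal x * column_vol (x\<^sup>2 * (1 + t\<^sup>2)) * indicator {0..c} x * indicator {0..1} t \<partial>lborel)
       = ennreal (- ln (1 - c\<^sup>2 * (1 + t\<^sup>2)) / (4 * (1 + t\<^sup>2))) * indicator {0..1} t"
      \<comment> \<open>The ray t = 1 may end on the unit circle, where
        \<open>nn_integral_ray\<close> does not apply.\<close>
      using AE_lborel_singleton[of 1]
    proof eventually_elim
      case (elim t)
      show ?case
      proof (cases "t \<in> {0..1}")
        case True
        then have t: "0 \<le> t" "t < 1" using elim by auto
        have p: "0 < 1 + t\<^sup>2" by (simp add: add_pos_nonneg)
        have "t\<^sup>2 < 1" using t power_strict_mono[of t 1 2] by simp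
        have "c\<^sup>2 * (1 + t\<^sup>2) < 1"
        proof (cases "c = 0")
          case False
          then have "c\<^sup>2 * (1 + t\<^sup>2) < c\<^sup>2 * 2" using \<open>t\<^sup>2 < 1\<close> by (intro mult_strict_left_mono) auto
          then show ?thesis using c by simp
        qed simp
        with True show ?thesis using nn_integral_ray[OF c(1) p] by simp
      qed simp
    qed
  qed
  also have "\<dots> = ennreal I"
  proof (rule nn_integral_has_integral_lebesgue'[OF _ int])
    fix t :: real assume t: "t \<in> {0..1}"
    have p: "0 < 1 + t\<^sup>2" by (simp add: add_pos_nonneg)
    have "t\<^sup>2 \<le> 1" using t power_mono[of t 1 2] by simp
    then have "c\<^sup>2 * (1 + t\<^sup>2) \<le> c\<^sup>2 * 2" by (intro mult_left_mono) auto
    then have "c\<^sup>2 * (1 + t\<^sup>2) \<le> 1" using c by simp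
    moreover have "0 \<le> c\<^sup>2 * (1 + t\<^sup>2)" using p by simp
    ultimately have "ln (1 - c\<^sup>2 * (1 + t\<^sup>2)) \<le> 0"
      by (cases "c\<^sup>2 * (1 + t\<^sup>2) = 1") auto
    then show "0 \<le> - ln (1 - c\<^sup>2 * (1 + t\<^sup>2)) / (4 * (1 + t\<^sup>2))" using p by (intro divide_nonneg_pos) auto
  qed
  finally show ?thesis .
qed

section \<open>Hyperbolic volume\<close>

lemma borel_measurable_linear:
  fixes T :: "'a::euclidean_space \<Rightarrow> 'b::euclidean_space"
  shows "linear T \<Longrightarrow> T \<in> borel_measurable borel"
  by (intro borel_measurable_continuous_onI linear_continuous_on linear_conv_bounded_linear[THEN iffD1])

text \<open>Such a map only relabels coordinates, so preimages of boxes are boxes with the same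
  sides. It carries Lebesgue measure between the product types and the vector types.\<close>

lemma distr_lborel_Basis:
  fixes T :: "'a::euclidean_space \<Rightarrow> 'b::euclidean_space"
  assumes "linear T" and bij: "bij_betw T Basis Basis"
  shows "distr lborel borel T = lborel"
proof (rule lborel_eqI[symmetric])
  have [measurable]: "T \<in> borel_measurable borel"
    by (rule borel_measurable_linear[OF assms(1)])
  have T_inner: "T x \<bullet> T b = x \<bullet> b" if "b \<in> Basis" for x b
  proof -
    have "T x = T (\<Sum>c\<in>Basis. (x \<bullet> c) *\<^sub>R c)" by (simp add: euclidean_representation)
    also have "\<dots> = (\<Sum>c\<in>Basis. (x \<bullet> c) *\<^sub>R T c)"
      using assms(1) by (simp add: linear_sum linear_cmul)
    finally have "T x \<bullet> T b = (\<Sum>c\<in>Basis. (x \<bullet> c) * (T c \<bullet> T b))"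
      by (simp add: inner_sum_left)
    also have "\<dots> = (\<Sum>c\<in>Basis. if c = b then x \<bullet> c else 0)"
    proof (intro sum.cong refl)
      fix c :: 'a assume "c \<in> Basis"
      then have "T c \<bullet> T b = (if c = b then 1 else 0)"
        using that bij inner_Basis[of "T c" "T b"] bij_betwE[OF bij]
        by (auto simp: bij_betw_def inj_on_eq_iff)
      then show "(x \<bullet> c) * (T c \<bullet> T b) = (if c = b then x \<bullet> c else 0)" by simp
    qed
    finally show ?thesis using that by simp
  qed
  fix l u :: 'b assume le: "\<And>b. b \<in> Basis \<Longrightarrow> l \<bullet> b \<le> u \<bullet> b"
  define pull where "pull w = (\<Sum>b\<in>Basis. (w \<bullet> T b) *\<^sub>R b)" for w
  have pull: "pull w \<bullet> b = w \<bullet> T b" if "b \<in> Basis" for w b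
    using that by (simp add: pull_def)
  have TB: "T b \<in> Basis" if "b \<in> Basis" for b using bij that by (auto simp: bij_betw_def)
  have TBasis: "(Basis :: 'b set) = T ` Basis" using bij by (simp add: bij_betw_def)
  have "T -` box l u = box (pull l) (pull u)"
  proof -
    have "x \<in> T -` box l u \<longleftrightarrow> (\<forall>b\<in>Basis. l \<bullet> T b < T x \<bullet> T b \<and> T x \<bullet> T b < u \<bullet> T b)" for x
      unfolding vimage_eq mem_box by (subst TBasis) simp
    then show ?thesis by (auto simp: mem_box pull T_inner)
  qed
  then have "emeasure (distr lborel borel T) (box l u) = (\<Prod>b\<in>Basis. (pull u - pull l) \<bullet> b)"
    by (simp add: emeasure_distr emeasure_lborel_box_eq pull le TB inner_diff_left)
  also have "(\<Prod>b\<in>Basis. (pull u - pull l) \<bullet> b) = (\<Prod>b\<in>Basis. (u - l) \<bullet> T b)"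
    by (intro prod.cong) (simp_all add: inner_diff_left pull)
  also have "\<dots> = (\<Prod>b\<in>Basis. (u - l) \<bullet> b)"
    by (rule prod.reindex_bij_betw[OF bij])
  finally show "emeasure (distr lborel borel T) (box l u) = (\<Prod>b\<in>Basis. (u - l) \<bullet> b)" .
qed simp

lemma vector_3_eq: "(vector [a, b, c] :: real^3) = a *\<^sub>R axis 1 1 + b *\<^sub>R axis 2 1 + c *\<^sub>R axis 3 1"
  by (simp add: vec_eq_iff forall_3 axis_def)

lemma linear_vector_3: "linear (\<lambda>(a, b, c). vector [a, b, c] :: real^3)"
  by (rule linearI) (auto simp: vec_eq_iff forall_3)

lemma distr_lborel_real3:
  "distr (lborel :: (real \<times> real \<times> real) measure) borel (\<lambda>(a, b, c). vector [a, b, c] :: real^3) = lborel"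
proof (rule distr_lborel_Basis)
  let ?T = "\<lambda>(a, b, c). vector [a, b, c] :: real^3"
  show "linear ?T" by (rule linear_vector_3)
  have B3: "(Basis :: (real^3) set) = {axis 1 1, axis 2 1, axis 3 1}"
    by (auto simp: Basis_vec_def UNIV_3)
  have B: "(Basis :: (real \<times> real \<times> real) set) = {(1, 0, 0), (0, 1, 0), (0, 0, 1)}"
    by (auto simp: Basis_prod_def zero_prod_def)
  have ne: "axis i (1::real) \<noteq> axis j 1" if "i \<noteq> j" for i j :: 3
    using that by (simp add: axis_eq_axis)
  have "?T ` Basis = Basis" unfolding B B3 by (simp add: vector_3_eq)
  moreover have "inj_on ?T Basis" unfolding B by (simp add: vector_3_eq ne)
  ultimately show "bij_betw ?T Basis Basis" by (simp add: bij_betw_def)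
qed

lemma measurable_vector_3 [measurable]:
  assumes [measurable]: "f \<in> borel_measurable M" "g \<in> borel_measurable M" "h \<in> borel_measurable M"
  shows "(\<lambda>x. vector [f x, g x, h x] :: real^3) \<in> borel_measurable M"
  unfolding vector_3_eq by measurable

lemma nn_integral_real3:
  fixes f :: "real^3 \<Rightarrow> ennreal"
  assumes [measurable]: "f \<in> borel_measurable borel"
  shows "(\<integral>\<^sup>+x. f x \<partial>lborel) = (\<integral>\<^sup>+a. \<integral>\<^sup>+b. \<integral>\<^sup>+c. f (vector [a, b, c]) \<partial>lborel \<partial>lborel \<partial>lborel)"
proof -
  have [measurable]: "(\<lambda>(a, b, c). vector [a, b, c] :: real^3) \<in> borel_measurable borel"
    by (rule borel_measurable_linear[OF linear_vector_3])
  have m: "(\<lambda>p. f (vector [fst p, fst (snd p), snd (snd p)])) \<in> borel_measurable (lborel \<Otimes>\<^sub>M (lborel \<Otimes>\<^sub>M lborel))"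
    by measurable
  have "(\<integral>\<^sup>+x. f x \<partial>lborel) = (\<integral>\<^sup>+(a, b, c). f (vector [a, b, c]) \<partial>lborel)"
    by (subst distr_lborel_real3[symmetric], subst nn_integral_distr) (auto simp: case_prod_beta intro!: nn_integral_cong)
  also have "\<dots> = (\<integral>\<^sup>+p. f (vector [fst p, fst (snd p), snd (snd p)]) \<partial>(lborel \<Otimes>\<^sub>M (lborel \<Otimes>\<^sub>M lborel)))"
    by (simp add: lborel_prod case_prod_unfold)
  also have "\<dots> = (\<integral>\<^sup>+a. \<integral>\<^sup>+q. f (vector [a, fst q, snd q]) \<partial>(lborel \<Otimes>\<^sub>M lborel) \<partial>lborel)"
    by (subst sigma_finite_measure.nn_integral_fst[OF _ m, symmetric])
       (simp_all add: lborel_prod lborel.sigma_finite_measure_axioms)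
  also have "\<dots> = (\<integral>\<^sup>+a. \<integral>\<^sup>+b. \<integral>\<^sup>+c. f (vector [a, b, c]) \<partial>lborel \<partial>lborel \<partial>lborel)"
    by (subst lborel.nn_integral_fst[symmetric]) simp_all
  finally show ?thesis .
qed

text \<open>The substitution rule on [-n, n] followed by monotone convergence; the two limits of
  \<open>g\<close> make the image intervals exhaust the line.\<close>

lemma nn_integral_substitution_UNIV:
  fixes f :: "real \<Rightarrow> ennreal" and g g' :: "real \<Rightarrow> real"
  assumes f: "f \<in> borel_measurable borel"
    and deriv: "\<And>x. (g has_real_derivative g' x) (at x)"
    and cont: "continuous_on UNIV g'"
    and nonneg: "\<And>x. 0 \<le> g' x"
    and lims: "filterlim g at_top at_top" "filterlim g at_bot at_bot"
  shows "(\<integral>\<^sup>+x. f x \<partial>lborel) = (\<integral>\<^sup>+x. f (g x) * g' x \<partial>lborel)"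
proof -
  note [measurable] = f
  have mono: "g x \<le> g y" if "x \<le> y" for x y
    by (rule DERIV_nonneg_imp_nondecreasing[OF that]) (use deriv nonneg in blast)
  have contg: "continuous_on UNIV g"
    using deriv by (meson DERIV_continuous_on has_field_derivative_at_within)
  have [measurable]: "g \<in> borel_measurable borel" "g' \<in> borel_measurable borel"
    using contg cont by (auto intro: borel_measurable_continuous_onI)
  have SUP_ind: "(SUP n. ennreal (indicator {a (n::nat)..b n} x)) = 1" 
    if ex_n: "\<exists>n. a n \<le> x \<and> x \<le> b n" for a b :: "nat \<Rightarrow> real" and x
  proof (rule antisym)
    show "(SUP n. ennreal (indicator {a (n::nat)..b n} x)) \<le> 1"
      by (rule SUP_least) (auto split: split_indicator)
    obtain n where "a n \<le> x \<and> x \<le> b n" using ex_n by blast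
    then show "1 \<le> (SUP n. ennreal (indicator {a (n::nat)..b n} x))"
      by (intro SUP_upper2[of n]) auto
  qed
  have ex: "\<exists>n. g (- real n) \<le> x \<and> x \<le> g (real n)" for x
  proof -
    obtain N1 where N1: "\<And>y. N1 \<le> y \<Longrightarrow> x \<le> g y"
      using lims(1) by (auto simp: filterlim_at_top eventually_at_top_linorder)
    obtain N2 where N2: "\<And>y. y \<le> N2 \<Longrightarrow> g y \<le> x"
      using lims(2) by (auto simp: filterlim_at_bot eventually_at_bot_linorder)
    obtain n :: nat where "max N1 (- N2) \<le> real n" using real_arch_simple by blast
    then show ?thesis using N1[of "real n"] N2[of "- real n"] by (intro exI[of _ n]) auto
  qed
  have ex': "\<exists>n. - real n \<le> x \<and> x \<le> real n" for x
    using real_arch_simple[of "\<bar>x\<bar>"] by (metis abs_le_iff minus_le_iff)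
  have lim: "(\<integral>\<^sup>+x. h x \<partial>lborel) = (SUP n. \<integral>\<^sup>+x. h x * ennreal (indicator {a n..b n} x) \<partial>lborel)"
    if [measurable]: "h \<in> borel_measurable borel" and "\<And>x. \<exists>n. a n \<le> x \<and> x \<le> b n" "decseq a" "incseq b"
    for h :: "real \<Rightarrow> ennreal" and a b :: "nat \<Rightarrow> real"
  proof -
    have "(\<integral>\<^sup>+x. h x \<partial>lborel) = (\<integral>\<^sup>+x. (SUP n. h x * ennreal (indicator {a n..b n} x)) \<partial>lborel)"
      using that(2) by (simp add: SUP_mult_left_ennreal[symmetric] SUP_ind)
    also have "\<dots> = (SUP n. \<integral>\<^sup>+x. h x * ennreal (indicator {a n..b n} x) \<partial>lborel)"
    proof (rule nn_integral_monotone_convergence_SUP)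
      show "incseq (\<lambda>n x. h x * ennreal (indicator {a n..b n} x))"
      proof (rule incseq_SucI, rule le_funI)
        fix n x
        have "a (Suc n) \<le> a n" "b n \<le> b (Suc n)" using that by (auto simp: decseq_Suc_iff incseq_Suc_iff)
        then show "h x * ennreal (indicator {a n..b n} x) \<le> h x * ennreal (indicator {a (Suc n)..b (Suc n)} x)"
          by (intro mult_left_mono ennreal_leI) (auto split: split_indicator)
      qed
    qed measurable
    finally show ?thesis .
  qed
  have "(\<integral>\<^sup>+x. f x \<partial>lborel) = (SUP n. \<integral>\<^sup>+x. f x * ennreal (indicator {g (- real n)..g (real n)} x) \<partial>lborel)"
    by (rule lim) (auto simp: decseq_Suc_iff incseq_Suc_iff intro: mono ex)
  also have "\<dots> = (SUP n. \<integral>\<^sup>+x. f (g x) * g' x * ennreal (indicator {- real n..real n} x) \<partial>lborel)"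
  proof (rule SUP_cong[OF refl])
    fix n :: nat
    show "(\<integral>\<^sup>+x. f x * ennreal (indicator {g (- real n)..g (real n)} x) \<partial>lborel)
      = (\<integral>\<^sup>+x. f (g x) * g' x * ennreal (indicator {- real n..real n} x) \<partial>lborel)"
    \<comment> \<open>The bounded rule is applied to a nondegenerate interval only; for n = 0 both
      sides are integrals over a point.\<close>
    proof (cases "n = 0")
      case True
      have "(\<integral>\<^sup>+x. h x * ennreal (indicator {c..c} x) \<partial>lborel) = 0" for h :: "real \<Rightarrow> ennreal" and c
      proof -
        have "AE x in lborel. h x * ennreal (indicator {c..c} x) = 0"
          using AE_lborel_singleton[of c] by eventually_elim (auto split: split_indicator)
        then show ?thesis by (subst nn_integral_cong_AE[of _ "\<lambda>_. 0"]) auto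
      qed
      then show ?thesis using True by simp
    next
      case False
      show ?thesis unfolding ennreal_indicator
        by (rule nn_integral_substitution_aux[OF f _ deriv]) 
           (use False cont nonneg in \<open>auto intro: continuous_on_subset\<close>)
    qed
  qed
  also have "\<dots> = (\<integral>\<^sup>+x. f (g x) * g' x \<partial>lborel)"
    by (rule lim[symmetric]) (use ex' in \<open>auto simp: decseq_Suc_iff incseq_Suc_iff\<close>)
  finally show ?thesis .
qed

lemma emeasure_hyp_vol:
  assumes [measurable]: "S \<in> sets borel"
  shows "emeasure hyp_vol S =
    (\<integral>\<^sup>+x. ennreal (1 / sqrt (1 + (norm x)\<^sup>2)) * indicator S (sqrt (1 + (norm x)\<^sup>2), x) \<partial>(lborel :: (real^3) measure))"
proof -
  have [measurable]: "(\<lambda>x::real^3. (sqrt (1 + (norm x)\<^sup>2), x)) \<in> borel_measurable borel"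
    by (intro borel_measurable_continuous_onI continuous_intros)
  have "(\<lambda>x::real^3. (sqrt (1 + (norm x)\<^sup>2), x)) -` S \<inter> space borel \<in> sets borel"
    by (rule measurable_sets[OF _ assms]) measurable
  then have [measurable]: "(\<lambda>x::real^3. (sqrt (1 + (norm x)\<^sup>2), x)) -` S \<in> sets borel" by simp
  have "emeasure hyp_vol S = emeasure (density lborel (\<lambda>x::real^3. ennreal (1 / sqrt (1 + (norm x)\<^sup>2)))) ((\<lambda>x. (sqrt (1 + (norm x)\<^sup>2), x)) -` S)"
    unfolding hyp_vol_def by (subst emeasure_distr) simp_all
  also have "\<dots> = (\<integral>\<^sup>+x. ennreal (1 / sqrt (1 + (norm x)\<^sup>2)) * indicator ((\<lambda>x. (sqrt (1 + (norm x)\<^sup>2), x)) -` S) x \<partial>(lborel :: (real^3) measure))"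
    by (rule emeasure_density) measurable
  finally show ?thesis by (simp add: indicator_vimage)
qed

text \<open>A horizontal coordinate is rescaled by exp (- u), which depends on the inner variable;
  hence the exchange of the integrals before and after.\<close>

lemma nn_integral_exp_scale:
  assumes [measurable]: "case_prod G \<in> borel_measurable (borel \<Otimes>\<^sub>M borel)"
  shows "(\<integral>\<^sup>+y. \<integral>\<^sup>+u. G y u \<partial>lborel \<partial>lborel) = (\<integral>\<^sup>+y. \<integral>\<^sup>+u. ennreal (exp (- u)) * G (exp (- u) * y) u \<partial>lborel \<partial>lborel)"
proof -
  have "(\<integral>\<^sup>+y. \<integral>\<^sup>+u. G y u \<partial>lborel \<partial>lborel) = (\<integral>\<^sup>+u. \<integral>\<^sup>+y. G y u \<partial>lborel \<partial>lborel)"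
    by (rule lborel_pair.Fubini') simp
  also have "\<dots> = (\<integral>\<^sup>+u. \<integral>\<^sup>+y. ennreal (exp (- u)) * G (exp (- u) * y) u \<partial>lborel \<partial>lborel)"
  proof (rule nn_integral_cong)
    fix u :: real
    have "(\<integral>\<^sup>+y. G y u \<partial>lborel) = ennreal \<bar>exp (- u)\<bar> * (\<integral>\<^sup>+y. G (0 + exp (- u) * y) u \<partial>lborel)"
      by (rule nn_integral_real_affine) simp_all
    then show "(\<integral>\<^sup>+y. G y u \<partial>lborel) = (\<integral>\<^sup>+y. ennreal (exp (- u)) * G (exp (- u) * y) u \<partial>lborel)"
      by (simp add: nn_integral_cmult)
  qed
  also have "\<dots> = (\<integral>\<^sup>+y. \<integral>\<^sup>+u. ennreal (exp (- u)) * G (exp (- u) * y) u \<partial>lborel \<partial>lborel)"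
    by (rule lborel_pair.Fubini') measurable
  finally show ?thesis .
qed

text \<open>The point \<open>(x, y, exp u)\<close> of the upper half-space model, with \<open>\<infinity>\<close> represented by the
  light-like vector \<open>(1, (0, 0, 1))\<close>.\<close>

definition horo_point :: "real \<Rightarrow> real \<Rightarrow> real \<Rightarrow> lorentz" where
  "horo_point x y u = ((exp u + (1 + x\<^sup>2 + y\<^sup>2) * exp (- u)) / 2,
     vector [exp (- u) * x, exp (- u) * y, (exp u + (x\<^sup>2 + y\<^sup>2 - 1) * exp (- u)) / 2])"

lemma measurable_horo_point [measurable]:
  assumes [measurable]: "f \<in> borel_measurable M" "g \<in> borel_measurable M" "h \<in> borel_measurable M"
  shows "(\<lambda>x. horo_point (f x) (g x) (h x)) \<in> borel_measurable M"
  unfolding horo_point_def by measurable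

lemma filterlim_exp_combination:
  assumes "1 \<le> A"
  shows "filterlim (\<lambda>u::real. (A * exp u - exp (- u)) / 2) at_top at_top"
    and "filterlim (\<lambda>u::real. (A * exp u - exp (- u)) / 2) at_bot at_bot"
proof -
  have aux: "Z \<le> (p - q) / 2" if "1 * (1 + u) \<le> p" "q \<le> 1" "2 * Z \<le> u" for p q u Z :: real
    using that by simp
  have "Z \<le> (A * exp u - exp (- u)) / 2" if "max 0 (2 * Z) \<le> u" for Z u :: real
  proof -
    have "1 * (1 + u) \<le> A * exp u" by (rule mult_mono) (use assms that exp_ge_add_one_self[of u] in auto)
    then show ?thesis by (rule aux) (use that in auto)
  qed
  then show "filterlim (\<lambda>u::real. (A * exp u - exp (- u)) / 2) at_top at_top"
    unfolding filterlim_at_top eventually_at_top_linorder by blast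
  have aux: "(p - q) / 2 \<le> Z" if "p \<le> A * 1" "1 - u \<le> q" "u \<le> 2 * Z - A + 1" for p q u Z :: real
    using that by simp
  have "(A * exp u - exp (- u)) / 2 \<le> Z" if "u \<le> min 0 (2 * Z - A + 1)" for Z u :: real
  proof -
    have "A * exp u \<le> A * 1" by (rule mult_left_mono) (use assms that in auto)
    moreover have "1 - u \<le> exp (- u)" using exp_ge_add_one_self[of "- u"] by simp
    ultimately show ?thesis by (rule aux) (use that in auto)
  qed
  then show "filterlim (\<lambda>u::real. (A * exp u - exp (- u)) / 2) at_bot at_bot"
    unfolding filterlim_at_bot eventually_at_bot_linorder by blast
qed

lemma lorentz_chart_identity:
  fixes A u :: real
  shows "A + ((A * exp u - exp (- u)) / 2)\<^sup>2 = ((A * exp u + exp (- u)) / 2)\<^sup>2"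
proof -
  have "exp u * exp (- u) = 1" by (simp add: exp_minus)
  then have "A = A * (exp u * exp (- u))" by simp
  then show ?thesis by (simp add: power2_eq_square field_simps)
qed

text \<open>This is the volume element dx dy dz / z^3 of the upper half-space with z = exp u. Taking
  u in place of the third space coordinate has the time coordinate as Jacobian, which cancels the
  density of the chart; each of the two horizontal rescalings then contributes exp (- u).\<close>

lemma emeasure_hyp_vol_horo:
  assumes [measurable]: "S \<in> sets borel"
  shows "emeasure hyp_vol S = (\<integral>\<^sup>+x. \<integral>\<^sup>+y. \<integral>\<^sup>+u. ennreal (exp (- 2 * u)) * indicator S (horo_point x y u) \<partial>lborel \<partial>lborel \<partial>lborel)"
proof -
  define t where "t a b u = ((1 + a\<^sup>2 + b\<^sup>2) * exp u + exp (- u)) / 2" for a b u :: real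
  define z where "z a b u = ((1 + a\<^sup>2 + b\<^sup>2) * exp u - exp (- u)) / 2" for a b u :: real
  define H :: "real \<Rightarrow> real \<Rightarrow> real \<Rightarrow> ennreal" where
    "H a b u = indicator S (t a b u, vector [a, b, z a b u])" for a b u
  have [measurable]: "(\<lambda>x. H (f x) (g x) (h x)) \<in> borel_measurable M" 
    if [measurable]: "f \<in> borel_measurable M" "g \<in> borel_measurable M" "h \<in> borel_measurable M" 
    for f g h and M :: "'x measure"
    unfolding H_def t_def z_def by measurable
  have n: "(norm (vector [a, b, c] :: real^3))\<^sup>2 = a\<^sup>2 + b\<^sup>2 + c\<^sup>2" for a b c
    unfolding power2_norm_eq_inner by (simp add: inner_vec_def sum_3 power2_eq_square)
  let ?F = "\<lambda>x::real^3. ennreal (1 / sqrt (1 + (norm x)\<^sup>2)) * indicator S (sqrt (1 + (norm x)\<^sup>2), x)"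
  have "emeasure hyp_vol S = (\<integral>\<^sup>+a. \<integral>\<^sup>+b. \<integral>\<^sup>+c. ?F (vector [a, b, c]) \<partial>lborel \<partial>lborel \<partial>lborel)"
    unfolding emeasure_hyp_vol[OF assms] by (rule nn_integral_real3) measurable
  also have "\<dots> = (\<integral>\<^sup>+a. \<integral>\<^sup>+b. \<integral>\<^sup>+u. H a b u \<partial>lborel \<partial>lborel \<partial>lborel)"
  proof (rule nn_integral_cong, rule nn_integral_cong)
    fix a b :: real
    define A where "A = 1 + a\<^sup>2 + b\<^sup>2"
    have A: "0 < A" by (simp add: A_def add_pos_nonneg)
    have tp: "0 < t a b u" for u using A by (simp add: t_def A_def[symmetric] add_pos_pos)
    have "(\<integral>\<^sup>+c. ?F (vector [a, b, c]) \<partial>lborel) = (\<integral>\<^sup>+u. ?F (vector [a, b, z a b u]) * ennreal (t a b u) \<partial>lborel)"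
    proof (rule nn_integral_substitution_UNIV)
      show "((z a b) has_real_derivative t a b u) (at u)" for u
        unfolding z_def[abs_def] t_def by (auto intro!: derivative_eq_intros)
      show "continuous_on UNIV (t a b)" unfolding t_def[abs_def] by (intro continuous_intros) auto
      show "0 \<le> t a b u" for u using tp[of u] by simp
      show "filterlim (z a b) at_top at_top" "filterlim (z a b) at_bot at_bot"
        unfolding z_def[abs_def] A_def[symmetric] by (rule filterlim_exp_combination; simp add: A_def)+
    qed measurable
    also have "\<dots> = (\<integral>\<^sup>+u. H a b u \<partial>lborel)"
    proof (rule nn_integral_cong)
      fix u :: real
      have "1 + (norm (vector [a, b, z a b u] :: real^3))\<^sup>2 = (t a b u)\<^sup>2"
      proof -
        have "1 + (a\<^sup>2 + b\<^sup>2 + (z a b u)\<^sup>2) = A + (z a b u)\<^sup>2" by (simp add: A_def)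
        also have "\<dots> = (t a b u)\<^sup>2"
          unfolding z_def t_def A_def[symmetric] by (rule lorentz_chart_identity)
        finally show ?thesis unfolding n .
      qed
      then have "sqrt (1 + (norm (vector [a, b, z a b u] :: real^3))\<^sup>2) = t a b u" using tp[of u] by simp
      then show "?F (vector [a, b, z a b u]) * ennreal (t a b u) = H a b u"
        using tp[of u] by (simp add: H_def ennreal_mult''[symmetric] split: split_indicator)
    qed
    finally show "(\<integral>\<^sup>+c. ?F (vector [a, b, c]) \<partial>lborel) = (\<integral>\<^sup>+u. H a b u \<partial>lborel)" .
  qed
  also have "\<dots> = (\<integral>\<^sup>+a. \<integral>\<^sup>+y. \<integral>\<^sup>+u. ennreal (exp (- u)) * H a (exp (- u) * y) u \<partial>lborel \<partial>lborel \<partial>lborel)"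
    by (rule nn_integral_cong, rule nn_integral_exp_scale) measurable
  also have "\<dots> = (\<integral>\<^sup>+y. \<integral>\<^sup>+a. \<integral>\<^sup>+u. ennreal (exp (- u)) * H a (exp (- u) * y) u \<partial>lborel \<partial>lborel \<partial>lborel)"
    by (rule lborel_pair.Fubini') measurable
  also have "\<dots> = (\<integral>\<^sup>+y. \<integral>\<^sup>+x. \<integral>\<^sup>+u. ennreal (exp (- u)) * (ennreal (exp (- u)) * H (exp (- u) * x) (exp (- u) * y) u) \<partial>lborel \<partial>lborel \<partial>lborel)"
    by (rule nn_integral_cong, rule nn_integral_exp_scale) measurable
  also have "\<dots> = (\<integral>\<^sup>+x. \<integral>\<^sup>+y. \<integral>\<^sup>+u. ennreal (exp (- u)) * (ennreal (exp (- u)) * H (exp (- u) * x) (exp (- u) * y) u) \<partial>lborel \<partial>lborel \<partial>lborel)"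
    by (rule lborel_pair.Fubini') measurable
  also have "\<dots> = (\<integral>\<^sup>+x. \<integral>\<^sup>+y. \<integral>\<^sup>+u. ennreal (exp (- 2 * u)) * indicator S (horo_point x y u) \<partial>lborel \<partial>lborel \<partial>lborel)"
  proof (intro nn_integral_cong)
    fix x y u :: real
    have e: "exp (- u) * (exp (- u) * exp u) = exp (- u)" by (simp add: exp_minus)
    have "(1 + (exp (- u) * x)\<^sup>2 + (exp (- u) * y)\<^sup>2) * exp u = exp u + (x\<^sup>2 + y\<^sup>2) * (exp (- u) * (exp (- u) * exp u))"
      by (simp add: power2_eq_square algebra_simps)
    then have "(1 + (exp (- u) * x)\<^sup>2 + (exp (- u) * y)\<^sup>2) * exp u = exp u + (x\<^sup>2 + y\<^sup>2) * exp (- u)"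
      unfolding e .
    then have "H (exp (- u) * x) (exp (- u) * y) u = indicator S (horo_point x y u)"
      by (simp add: H_def t_def z_def horo_point_def algebra_simps)
    moreover have "ennreal (exp (- u)) * (ennreal (exp (- u)) * c) = ennreal (exp (- 2 * u)) * c" for c
      by (simp add: mult.assoc[symmetric] ennreal_mult''[symmetric] exp_add[symmetric])
    ultimately show "ennreal (exp (- u)) * (ennreal (exp (- u)) * H (exp (- u) * x) (exp (- u) * y) u) =
        ennreal (exp (- 2 * u)) * indicator S (horo_point x y u)" by simp
  qed
  finally show ?thesis .
qed

section \<open>The Lorentz form and the invariance of volume under its isometries\<close>

lemma lor_sym: "lor x y = lor y x"
  by (simp add: lor_def inner_commute)

lemma lor_add_left: "lor (x + y) z = lor x z + lor y z"
  by (simp add: lor_def inner_add_left algebra_simps)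

lemma lor_add_right: "lor z (x + y) = lor z x + lor z y"
  by (simp add: lor_def inner_add_right algebra_simps)

lemma lor_diff_left: "lor (x - y) z = lor x z - lor y z"
  by (simp add: lor_def inner_diff_left algebra_simps)

lemma lor_diff_right: "lor z (x - y) = lor z x - lor z y"
  by (simp add: lor_def inner_diff_right algebra_simps)

lemma lor_scaleR_left: "lor (c *\<^sub>R x) y = c * lor x y"
  by (simp add: lor_def algebra_simps)

lemma lor_scaleR_right: "lor x (c *\<^sub>R y) = c * lor x y"
  by (simp add: lor_def algebra_simps)

lemma lor_minus_left: "lor (- x) y = - lor x y"
  using lor_scaleR_left[of "-1" x y] by simp

lemma lor_minus_right: "lor x (- y) = - lor x y"
  using lor_scaleR_right[of x "-1" y] by simp

lemma lor_zero_left [simp]: "lor 0 y = 0" and lor_zero_right [simp]: "lor y 0 = 0"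
  by (simp_all add: lor_def)

lemma lor_sum_left: "lor (sum f A) y = (\<Sum>i\<in>A. lor (f i) y)"
  by (induction A rule: infinite_finite_induct) (simp_all add: lor_add_left)

lemma lor_sum_right: "lor y (sum f A) = (\<Sum>i\<in>A. lor y (f i))"
  by (induction A rule: infinite_finite_induct) (simp_all add: lor_add_right)

lemmas lor_linear = lor_add_left lor_add_right lor_diff_left lor_diff_right
  lor_scaleR_left lor_scaleR_right lor_minus_left lor_minus_right

text \<open>Pairing with the time-reversed vector gives the Euclidean square norm.\<close>

lemma lor_nondegenerate:
  assumes "\<And>y. lor x y = 0"
  shows "x = 0"
proof -
  have "lor x (- fst x, snd x) = fst x ^ 2 + snd x \<bullet> snd x"
    by (simp add: lor_def power2_eq_square)
  then have "fst x ^ 2 + snd x \<bullet> snd x = 0" using assms by simp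
  then have "fst x = 0 \<and> snd x = 0"
    by (metis add_nonneg_eq_0_iff inner_eq_zero_iff inner_ge_zero zero_le_power2 zero_eq_power2)
  then show ?thesis by (simp add: prod_eq_iff)
qed

lemma continuous_on_lor [continuous_intros]:
  "continuous_on A f \<Longrightarrow> continuous_on A g \<Longrightarrow> continuous_on A (\<lambda>x. lor (f x) (g x))"
  unfolding lor_def by (intro continuous_intros)

lemma measurable_lor [measurable]:
  assumes [measurable]: "f \<in> borel_measurable M" "g \<in> borel_measurable M"
  shows "(\<lambda>x. lor (f x) (g x)) \<in> borel_measurable M"
proof -
  have [measurable]: "fst \<in> borel_measurable (borel :: lorentz measure)" "snd \<in> borel_measurable (borel :: lorentz measure)"
    by (auto intro!: borel_measurable_continuous_onI continuous_intros)
  show ?thesis unfolding lor_def by measurable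
qed

definition lor_isometry :: "(lorentz \<Rightarrow> lorentz) \<Rightarrow> bool" where
  "lor_isometry L \<longleftrightarrow> linear L \<and> (\<forall>x y. lor (L x) (L y) = lor x y)"

lemma lor_isometry_inverse:
  assumes "lor_isometry L"
  obtains L' where "lor_isometry L'" "\<And>x. L' (L x) = x" "\<And>x. L (L' x) = x"
proof -
  have lin: "linear L" and iso: "\<And>x y. lor (L x) (L y) = lor x y"
    using assms by (auto simp: lor_isometry_def)
  have "inj L"
  proof (rule linear_injective_0[OF lin, THEN iffD2], intro allI impI)
    fix x assume "L x = 0"
    then have "lor x y = 0" for y using iso[of x y] by simp
    then show "x = 0" by (rule lor_nondegenerate)
  qed
  then obtain L' where L': "linear L'" "\<And>x. L' (L x) = x" "\<And>x. L (L' x) = x"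
    using linear_injective_isomorphism[OF lin] by blast
  have "lor (L' x) (L' y) = lor x y" for x y
    using iso[of "L' x" "L' y"] by (simp add: L')
  with L' show ?thesis by (intro that[of L']) (auto simp: lor_isometry_def)
qed

text \<open>Coordinates in which determinants are taken; time comes first.\<close>

definition real4_of :: "lorentz \<Rightarrow> real^4" where
  "real4_of p = (\<chi> i. if i = 1 then fst p else if i = 2 then snd p $ 1 else if i = 3 then snd p $ 2 else snd p $ 3)"

definition of_real4 :: "real^4 \<Rightarrow> lorentz" where
  "of_real4 x = (x $ 1, vector [x $ 2, x $ 3, x $ 4])"

lemma of_real4_inverse [simp]: "of_real4 (real4_of p) = p"
  by (simp add: of_real4_def real4_of_def prod_eq_iff vec_eq_iff forall_3)

lemma real4_of_inverse [simp]: "real4_of (of_real4 x) = x"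
  by (simp add: of_real4_def real4_of_def vec_eq_iff forall_4)

lemma linear_of_real4: "linear of_real4"
  by (rule linearI) (auto simp: of_real4_def vec_eq_iff forall_3)

lemma linear_real4_of: "linear real4_of"
  by (rule linearI) (auto simp: real4_of_def vec_eq_iff)

lemma distr_of_real4: "distr lborel borel of_real4 = lborel"
proof (rule distr_lborel_Basis[OF linear_of_real4])
  have B3: "(Basis :: (real^3) set) = {axis 1 1, axis 2 1, axis 3 1}"
    by (auto simp: Basis_vec_def UNIV_3)
  have B4: "(Basis :: (real^4) set) = {axis 1 1, axis 2 1, axis 3 1, axis 4 1}"
    by (auto simp: Basis_vec_def UNIV_4)
  have B: "(Basis :: lorentz set) = {(1, 0), (0, axis 1 1), (0, axis 2 1), (0, axis 3 1)}"
    by (auto simp: Basis_prod_def B3)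
  have "of_real4 (axis 1 1) = (1, 0)" "of_real4 (axis 2 1) = (0, axis 1 1)"
    "of_real4 (axis 3 1) = (0, axis 2 1)" "of_real4 (axis 4 1) = (0, axis 3 1)"
    by (simp_all add: of_real4_def axis_def vec_eq_iff forall_3)
  then have "of_real4 ` Basis = Basis" unfolding B B4 by simp
  moreover have "inj_on of_real4 Basis" by (metis inj_onI real4_of_inverse)
  ultimately show "bij_betw of_real4 Basis Basis" by (simp add: bij_betw_def)
qed

text \<open>The matrix A of the map satisfies A^T J A = J with J = diag (-1, 1, 1, 1), so det A
  squares to 1.\<close>

lemma abs_det_lor_isometry:
  assumes "lor_isometry L"
  shows "\<bar>det (matrix (real4_of \<circ> L \<circ> of_real4))\<bar> = 1"
proof -
  define J :: "real^4^4" where "J = (\<chi> i j. if i = j then (if i = 1 then - 1 else 1) else 0)"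
  have Jv: "(J *v x) $ i = (if i = 1 then - 1 else 1) * x $ i" for x i
    by (simp add: J_def matrix_vector_mult_def if_distrib[of "\<lambda>a. a * _"] sum.delta cong: if_cong)
  have lorJ: "lor (of_real4 x) (of_real4 y) = x \<bullet> (J *v y)" for x y
    by (simp add: lor_def of_real4_def inner_vec_def sum_3 sum_4 Jv algebra_simps)
  define A where "A = matrix (real4_of \<circ> L \<circ> of_real4)"
  have lin: "linear (real4_of \<circ> L \<circ> of_real4)"
    using assms by (intro linear_compose linear_of_real4 linear_real4_of) (auto simp: lor_isometry_def)
  have A: "of_real4 (A *v x) = L (of_real4 x)" for x
    by (simp add: A_def matrix_works[OF lin[folded linear_matrix_vector_mul_eq]])
  have "x \<bullet> ((transpose A ** J ** A) *v y) = x \<bullet> (J *v y)" for x y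
  proof -
    have "x \<bullet> ((transpose A ** J ** A) *v y) = (A *v x) \<bullet> (J *v (A *v y))"
      unfolding matrix_vector_mul_assoc[symmetric] transpose_matrix_vector
      by (metis dot_lmul_matrix inner_commute)
    also have "\<dots> = lor (L (of_real4 x)) (L (of_real4 y))" by (simp add: lorJ[symmetric] A)
    also have "\<dots> = x \<bullet> (J *v y)" using assms unfolding lor_isometry_def by (metis lorJ)
    finally show ?thesis .
  qed
  then have "(transpose A ** J ** A) *v y = J *v y" for y
    by (metis vector_eq_rdot inner_commute)
  then have "transpose A ** J ** A = J" by (simp add: matrix_eq)
  then have "det A * det J * det A = det J"
    by (metis det_mul det_transpose)
  moreover have "det J \<noteq> 0"
  proof -
    have "J *v (J *v x) = x" for x by (simp add: vec_eq_iff Jv)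
    then have "J ** J = mat 1" by (simp add: matrix_eq matrix_vector_mul_assoc[symmetric])
    then show ?thesis by (metis det_I det_mul mult_zero_left zero_neq_one)
  qed
  ultimately have "(det A)\<^sup>2 = 1" by (simp add: power2_eq_square)
  then show ?thesis unfolding A_def by (auto simp: power2_eq_1_iff)
qed

lemma distr_lborel_linear:
  fixes M M' :: "real^4 \<Rightarrow> real^4"
  assumes lin: "linear M" "linear M'" and inv: "\<And>x. M' (M x) = x" "\<And>x. M (M' x) = x"
    and det: "\<bar>det (matrix M')\<bar> = 1"
  shows "distr lborel borel M = lborel"
proof (rule lborel_eqI[symmetric])
  have [measurable]: "M \<in> borel_measurable borel"
    by (rule borel_measurable_linear[OF lin(1)])
  fix l u :: "real^4" assume le: "\<And>b. b \<in> Basis \<Longrightarrow> l \<bullet> b \<le> u \<bullet> b"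
  have eq: "M -` box l u = M' ` box l u" by (auto simp: inv intro: image_eqI[of _ _ "M _"])
  have [measurable]: "M -` box l u \<in> sets borel" 
    using measurable_sets_borel[of M borel "box l u"] by simp
  have lm: "M' ` box l u \<in> lmeasurable" by (rule measurable_linear_image[OF lin(2)]) auto
  have "emeasure (distr lborel borel M) (box l u) = emeasure lborel (M -` box l u)"
    by (simp add: emeasure_distr)
  also have "\<dots> = emeasure lebesgue (M' ` box l u)" unfolding eq[symmetric] by simp
  also have "\<dots> = ennreal (measure lebesgue (M' ` box l u))"
    by (rule emeasure_eq_ennreal_measure[OF fmeasurableD2[OF lm]])
  also have "measure lebesgue (M' ` box l u) = measure lebesgue (box l u)"
    by (subst measure_linear_image[OF lin(2)]) (auto simp: det)
  also have "ennreal (measure lebesgue (box l u)) = ennreal (\<Prod>b\<in>Basis. (u - l) \<bullet> b)"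
    using le by (simp add: measure_lborel_box_eq)
  finally show "emeasure (distr lborel borel M) (box l u) = ennreal (\<Prod>b\<in>Basis. (u - l) \<bullet> b)" .
qed simp

lemma distr_lborel_lor_isometry:
  assumes "lor_isometry L"
  shows "distr lborel borel L = lborel"
proof -
  obtain L' where L': "lor_isometry L'" "\<And>x. L' (L x) = x" "\<And>x. L (L' x) = x"
    using lor_isometry_inverse[OF assms] by metis
  have lin: "linear (real4_of \<circ> L \<circ> of_real4)" "linear (real4_of \<circ> L' \<circ> of_real4)"
    using assms L'(1) by (auto intro!: linear_compose linear_of_real4 linear_real4_of simp: lor_isometry_def)
  have M: "distr lborel borel (real4_of \<circ> L \<circ> of_real4) = lborel"
    by (rule distr_lborel_linear[OF lin]) (auto simp: L' abs_det_lor_isometry)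
  have [measurable]: "L \<in> borel_measurable borel" "of_real4 \<in> borel_measurable borel" "real4_of \<in> borel_measurable borel"
    using assms by (auto intro!: borel_measurable_linear linear_of_real4 linear_real4_of simp: lor_isometry_def)
  have "distr lborel borel L = distr (distr lborel borel of_real4) borel L" by (simp add: distr_of_real4)
  also have "\<dots> = distr lborel borel (of_real4 \<circ> (real4_of \<circ> L \<circ> of_real4))"
    by (subst distr_distr) (auto simp: comp_def)
  also have "\<dots> = distr (distr lborel borel (real4_of \<circ> L \<circ> of_real4)) borel of_real4"
    by (subst distr_distr) (auto simp: comp_def)
  also have "\<dots> = lborel" by (simp add: M distr_of_real4)
  finally show ?thesis .
qed

text \<open>Hyperbolic volume is four times the Lebesgue measure of the cone over a set. Since Lorentz
  isometries are linear with determinant \<open>\<plusminus>1\<close>, this makes it invariant.\<close>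

definition lor_cone :: "lorentz set \<Rightarrow> lorentz set" where
  "lor_cone S = {p. 0 < fst p \<and> lor p p < 0 \<and> - 1 \<le> lor p p \<and> (1 / sqrt (- lor p p)) *\<^sub>R p \<in> S}"

lemma sets_lor_cone [measurable]:
  assumes [measurable]: "S \<in> sets borel"
  shows "lor_cone S \<in> sets borel"
proof -
  have [measurable]: "fst \<in> borel_measurable (borel :: lorentz measure)"
    by (auto intro!: borel_measurable_continuous_onI continuous_intros)
  show ?thesis unfolding lor_cone_def by measurable
qed

lemma nn_integral_lborel_scaleR:
  fixes f :: "'a::euclidean_space \<Rightarrow> ennreal"
  assumes [measurable]: "f \<in> borel_measurable borel" and "0 < t"
  shows "(\<integral>\<^sup>+y. f y \<partial>lborel) = ennreal (t ^ DIM('a)) * (\<integral>\<^sup>+x. f (t *\<^sub>R x) \<partial>lborel)"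
  using assms(2) by (subst lborel_affine[of t 0]) (simp_all add: nn_integral_density nn_integral_distr nn_integral_cmult)

text \<open>The time coordinate is replaced by the Lorentz length t = sqrt (- lor p p), so it
  becomes sqrt (t^2 + |y|^2). At y = 0 this root is not differentiable for t = 0.\<close>

lemma lor_cone_fibre:
  assumes [measurable]: "S \<in> sets borel" and "y \<noteq> 0"
  shows "(\<integral>\<^sup>+\<tau>. indicator (lor_cone S) (\<tau>, y) \<partial>lborel) =
    (\<integral>\<^sup>+t. indicator S (sqrt (t\<^sup>2 + (norm y)\<^sup>2) / t, (1 / t) *\<^sub>R y) * ennreal (t / sqrt (t\<^sup>2 + (norm y)\<^sup>2)) * indicator {0..1} t \<partial>lborel)"
proof -
  define r where "r = norm y"
  have r: "0 < r" using assms by (simp add: r_def)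
  define g where "g t = sqrt (t\<^sup>2 + r\<^sup>2)" for t
  have pos: "0 < t\<^sup>2 + r\<^sup>2" for t using r by (simp add: add_nonneg_pos)
  have nz: "sqrt (t\<^sup>2 + r\<^sup>2) \<noteq> 0" for t
    using real_sqrt_gt_zero[OF pos[of t]] by (rule less_imp_neq[THEN not_sym])
  have lor: "lor (\<tau>, y) (\<tau>, y) = r\<^sup>2 - \<tau>\<^sup>2" for \<tau>
    by (simp add: lor_def r_def dot_square_norm power2_eq_square[of \<tau>])
  have m: "(\<lambda>\<tau>. indicator (lor_cone S) (\<tau>, y) :: ennreal) \<in> borel_measurable borel"
    by measurable
  have "(\<integral>\<^sup>+\<tau>. indicator (lor_cone S) (\<tau>, y) \<partial>lborel) = (\<integral>\<^sup>+\<tau>. indicator (lor_cone S) (\<tau>, y) * indicator {g 0..g 1} \<tau> \<partial>lborel)"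
  proof (rule nn_integral_cong)
    fix \<tau> :: real
    have "\<tau> \<in> {g 0..g 1}" if "(\<tau>, y) \<in> lor_cone S"
    proof -
      have "0 < \<tau>" "r\<^sup>2 < \<tau>\<^sup>2" "\<tau>\<^sup>2 \<le> 1 + r\<^sup>2" using that by (auto simp: lor_cone_def lor)
      then have "r \<le> \<tau>" "\<tau> \<le> sqrt (1 + r\<^sup>2)"
        using power2_le_imp_le[of r \<tau>] real_le_rsqrt[of \<tau> "1 + r\<^sup>2"] by auto
      then show ?thesis using r by (simp add: g_def)
    qed
    then show "(indicator (lor_cone S) (\<tau>, y) :: ennreal) = indicator (lor_cone S) (\<tau>, y) * indicator {g 0..g 1} \<tau>"
      by (auto split: split_indicator)
  qed
  also have "\<dots> = (\<integral>\<^sup>+t. indicator (lor_cone S) (g t, y) * ennreal (t / g t) * indicator {0..1} t \<partial>lborel)"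
  proof (rule nn_integral_substitution_aux)
    show "(g has_real_derivative t / g t) (at t)" for t
    proof -
      have "((\<lambda>t. t\<^sup>2 + r\<^sup>2) has_real_derivative 2 * t) (at t)" by (auto intro!: derivative_eq_intros)
      from DERIV_chain2[OF DERIV_real_sqrt[OF pos[of t]] this] show ?thesis
        unfolding g_def[abs_def] by (rule DERIV_cong) (simp add: inverse_eq_divide)
    qed
    show "continuous_on {0..1} (\<lambda>t. t / g t)"
      unfolding g_def by (intro continuous_intros ballI nz)
    fix t :: real assume "t \<in> {0..1}"
    then have "0 \<le> t" by simp
    moreover have "0 \<le> g t" unfolding g_def by (rule real_sqrt_ge_zero[OF less_imp_le[OF pos]])
    ultimately show "0 \<le> t / g t" by (rule divide_nonneg_nonneg)
  qed (rule m, simp_all)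
  also have "\<dots> = (\<integral>\<^sup>+t. indicator S (sqrt (t\<^sup>2 + (norm y)\<^sup>2) / t, (1 / t) *\<^sub>R y) * ennreal (t / sqrt (t\<^sup>2 + (norm y)\<^sup>2)) * indicator {0..1} t \<partial>lborel)"
  proof (rule nn_integral_cong_AE)
    show "AE t in lborel. indicator (lor_cone S) (g t, y) * ennreal (t / g t) * indicator {0..1} t =
       indicator S (sqrt (t\<^sup>2 + (norm y)\<^sup>2) / t, (1 / t) *\<^sub>R y) * ennreal (t / sqrt (t\<^sup>2 + (norm y)\<^sup>2)) * indicator {0..1} t"
      using AE_lborel_singleton[of "0::real"]
    proof eventually_elim
      case (elim t)
      show ?case
      proof (cases "t \<in> {0..1}")
        case True
        then have t: "0 < t" "t \<le> 1" using elim by auto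
        have gt: "0 < g t" using pos[of t] by (simp add: g_def)
        have l: "lor (g t, y) (g t, y) = - t\<^sup>2" using pos[of t] by (simp add: lor g_def)
        have "t\<^sup>2 \<le> 1" using t power_mono[of t 1 2] by simp
        then have "(g t, y) \<in> lor_cone S \<longleftrightarrow> (g t / t, (1 / t) *\<^sub>R y) \<in> S"
          using t gt by (simp add: lor_cone_def l)
        then show ?thesis by (simp add: g_def r_def split: split_indicator)
      qed simp
    qed
  qed
  finally show ?thesis .
qed

text \<open>Scaling the space coordinates by the Lorentz length t contributes t^3 times the
  hyperbolic volume; the constant 1/4 is the integral of t^3 over [0, 1].\<close>

lemma emeasure_lor_cone:
  assumes [measurable]: "S \<in> sets borel"
  shows "emeasure lborel (lor_cone S) = ennreal (1 / 4) * emeasure hyp_vol S"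
proof -
  let ?K = "\<lambda>(y::real^3) t. indicator S (sqrt (t\<^sup>2 + (norm y)\<^sup>2) / t, (1 / t) *\<^sub>R y) * ennreal (t / sqrt (t\<^sup>2 + (norm y)\<^sup>2)) * indicator {0..1} t"
  have [measurable]: "lor_cone S \<in> sets (lborel \<Otimes>\<^sub>M lborel)"
    by (simp only: lborel_prod sets_lborel sets_lor_cone[OF assms])
  have "emeasure lborel (lor_cone S) = (\<integral>\<^sup>+p. indicator (lor_cone S) p \<partial>(lborel \<Otimes>\<^sub>M lborel))"
    by (simp add: lborel_prod sets_lor_cone[OF assms])
  also have "\<dots> = (\<integral>\<^sup>+y. \<integral>\<^sup>+\<tau>. indicator (lor_cone S) (\<tau>, y) \<partial>lborel \<partial>lborel)"
    by (rule lborel_pair.nn_integral_snd[symmetric]) measurable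
  also have "\<dots> = (\<integral>\<^sup>+y. \<integral>\<^sup>+t. ?K y t \<partial>lborel \<partial>lborel)"
  proof (rule nn_integral_cong_AE)
    show "AE y in lborel. (\<integral>\<^sup>+\<tau>. indicator (lor_cone S) (\<tau>, y) \<partial>lborel) = (\<integral>\<^sup>+t. ?K y t \<partial>lborel)"
      using AE_lborel_singleton[of "0::real^3"] by eventually_elim (rule lor_cone_fibre[OF assms])
  qed
  also have "\<dots> = (\<integral>\<^sup>+t. \<integral>\<^sup>+y. ?K y t \<partial>lborel \<partial>lborel)"
    by (rule lborel_pair.Fubini') measurable
  also have "\<dots> = (\<integral>\<^sup>+t. (ennreal (t ^ 3) * indicator {0..1} t) * emeasure hyp_vol S \<partial>lborel)"
  proof (rule nn_integral_cong_AE)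
    show "AE t in lborel. (\<integral>\<^sup>+y. ?K y t \<partial>lborel) = (ennreal (t ^ 3) * indicator {0..1} t) * emeasure hyp_vol S"
      using AE_lborel_singleton[of "0::real"]
    proof eventually_elim
      case (elim t)
      show ?case
      proof (cases "t \<in> {0..1}")
        case True
        then have t: "0 < t" "t \<le> 1" using elim by auto
        have "(\<integral>\<^sup>+y. ?K y t \<partial>lborel) = ennreal (t ^ DIM(real^3)) * (\<integral>\<^sup>+x. ?K (t *\<^sub>R x) t \<partial>lborel)"
          by (rule nn_integral_lborel_scaleR) (use t in measurable)
        also have "(\<integral>\<^sup>+x. ?K (t *\<^sub>R x) t \<partial>lborel) = emeasure hyp_vol S"
          unfolding emeasure_hyp_vol[OF assms]
        proof (rule nn_integral_cong)
          fix x :: "real^3"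
          have "t\<^sup>2 + (norm (t *\<^sub>R x))\<^sup>2 = t\<^sup>2 * (1 + (norm x)\<^sup>2)"
            by (simp add: power_mult_distrib algebra_simps)
          then have "sqrt (t\<^sup>2 + (norm (t *\<^sub>R x))\<^sup>2) = t * sqrt (1 + (norm x)\<^sup>2)"
            using t by (simp add: real_sqrt_mult)
          then show "?K (t *\<^sub>R x) t = ennreal (1 / sqrt (1 + (norm x)\<^sup>2)) * indicator S (sqrt (1 + (norm x)\<^sup>2), x)"
            using t by (simp add: mult.commute)
        qed
        finally show ?thesis using True by simp
      qed simp
    qed
  qed
  also have "\<dots> = (\<integral>\<^sup>+t. ennreal (t ^ 3) * indicator {0..1} t \<partial>lborel) * emeasure hyp_vol S"
    by (rule nn_integral_multc) measurable
  also have "(\<integral>\<^sup>+t. ennreal (t ^ 3) * indicator {0..1} t \<partial>lborel) = ennreal (1 ^ 4 / 4 - 0 ^ 4 / 4)"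
    by (rule nn_integral_FTC_Icc) (auto intro!: derivative_eq_intros)
  finally show ?thesis by simp
qed

text \<open>The condition \<open>future\<close> keeps the two sheets of the time cone apart; a
  Lorentz isometry alone might exchange them.\<close>

lemma emeasure_hyp_vol_isometry:
  assumes L: "lor_isometry L" and future: "\<And>x. lor x x < 0 \<Longrightarrow> 0 < fst (L x) \<longleftrightarrow> 0 < fst x"
    and S [measurable]: "S \<in> sets borel"
  shows "emeasure hyp_vol (L -` S) = emeasure hyp_vol S"
proof -
  have lin: "linear L" and iso: "\<And>x y. lor (L x) (L y) = lor x y" using L by (auto simp: lor_isometry_def)
  have mL [measurable]: "L \<in> borel_measurable borel"
    by (rule borel_measurable_linear[OF lin])
  have S': "L -` S \<in> sets borel" using measurable_sets[OF mL S] by simp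
  have "lor_cone (L -` S) = L -` lor_cone S"
    using future by (auto simp: lor_cone_def iso linear_cmul[OF lin])
  then have "emeasure lborel (lor_cone (L -` S)) = emeasure (distr lborel borel L) (lor_cone S)"
    by (simp add: emeasure_distr)
  then have "ennreal (1 / 4) * emeasure hyp_vol (L -` S) = ennreal (1 / 4) * emeasure hyp_vol S"
    by (simp add: distr_lborel_lor_isometry[OF L] emeasure_lor_cone[OF S] emeasure_lor_cone[OF S'])
  then show ?thesis by (simp add: ennreal_mult_cancel_left)
qed

section \<open>Planes, horoballs and simplices\<close>

lemma idealD: "ideal v \<Longrightarrow> lor v v = 0" "ideal v \<Longrightarrow> 0 < fst v"
  by (auto simp: ideal_def)

lemma lor_self: "lor x x = (norm (snd x))\<^sup>2 - (fst x)\<^sup>2"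
  by (simp add: lor_def dot_square_norm power2_eq_square[of "fst x"])

lemma timelike_norm_less:
  assumes "lor x x < 0" "0 < fst x"
  shows "norm (snd x) < fst x"
  using assms power2_less_imp_less[of "norm (snd x)" "fst x"] by (simp add: lor_self)

lemma causal_norm_le:
  assumes "lor x x \<le> 0" "0 \<le> fst x"
  shows "norm (snd x) \<le> fst x"
  using assms power2_le_imp_le[of "norm (snd x)" "fst x"] by (simp add: lor_self)

lemma causal_future_neg:
  assumes x: "lor x x < 0" "0 < fst x" and y: "lor y y \<le> 0" "0 < fst y"
  shows "lor x y < 0"
proof -
  have "snd x \<bullet> snd y \<le> norm (snd x) * norm (snd y)" by (rule norm_cauchy_schwarz)
  also have "\<dots> \<le> norm (snd x) * fst y"
    using causal_norm_le[of y] y by (intro mult_left_mono) auto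
  also have "\<dots> < fst x * fst y"
    using timelike_norm_less[OF x] y by (intro mult_strict_right_mono) auto
  finally show ?thesis by (simp add: lor_def)
qed

lemma causal_future:
  assumes x: "lor x x < 0" "0 < fst x" and y: "lor y y \<le> 0" and neg: "lor x y < 0"
  shows "0 < fst y"
proof (rule ccontr)
  assume "\<not> 0 < fst y"
  then consider "fst y = 0" | "fst y < 0" by linarith
  then show False
  proof cases
    case 1
    then have "snd y = 0" using y by (simp add: lor_self)
    with 1 show False using neg by (simp add: lor_def)
  next
    case 2
    have "lor x (- y) < 0" by (rule causal_future_neg[OF x]) (use 2 y in \<open>auto simp: lor_linear\<close>)
    with neg show False by (simp add: lor_linear)
  qed
qed

lemma hyp3I:
  assumes "x \<in> hyp3" "lor y y = -1" "lor x y < 0"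
  shows "y \<in> hyp3"
  using assms causal_future[of x y] by (auto simp: hyp3_def)

lemma lor_hyp3_ideal: "x \<in> hyp3 \<Longrightarrow> ideal v \<Longrightarrow> lor x v < 0"
  by (rule causal_future_neg) (auto simp: hyp3_def ideal_def)

lemma hyp3I_ideal:
  assumes "ideal v" "lor y y = -1" "lor y v < 0"
  shows "y \<in> hyp3"
proof (rule ccontr)
  assume "y \<notin> hyp3"
  then have n: "\<not> 0 < fst y" using assms by (simp add: hyp3_def)
  have "fst y \<noteq> 0"
  proof
    assume "fst y = 0"
    then have "(norm (snd y))\<^sup>2 = -1" using assms by (simp add: lor_self)
    then show False by (metis neg_0_le_iff_le not_one_le_zero zero_le_power2)
  qed
  then have "lor (- y) v < 0"
    by (intro causal_future_neg[of "- y" v]) (use n assms in \<open>auto simp: lor_linear ideal_def\<close>)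
  with assms show False by (simp add: lor_linear)
qed

lemma lor_ideal_ideal_le: "ideal v \<Longrightarrow> ideal w \<Longrightarrow> lor v w \<le> 0"
  using norm_cauchy_schwarz[of "snd v" "snd w"] mult_mono[of "norm (snd v)" "fst v" "norm (snd w)" "fst w"]
    causal_norm_le[of v] causal_norm_le[of w]
  by (simp add: ideal_def lor_def)

lemma ideal_parallel:
  assumes v: "ideal v" and w: "ideal w" and 0: "lor v w = 0"
  obtains c where "0 < c" "w = c *\<^sub>R v"
proof -
  have nv: "norm (snd v) = fst v" "norm (snd w) = fst w"
    using v w by (auto simp: ideal_def lor_self intro: power2_eq_imp_eq)
  then have "snd v \<bullet> snd w = norm (snd v) * norm (snd w)" using 0 by (simp add: lor_def)
  then have "norm (snd v) *\<^sub>R snd w = norm (snd w) *\<^sub>R snd v"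
    by (simp only: norm_cauchy_schwarz_eq)
  then have "fst v *\<^sub>R snd w = fst w *\<^sub>R snd v" unfolding nv .
  then have "snd w = (fst w / fst v) *\<^sub>R snd v"
    using v by (metis (no_types, lifting) divide_inverse_commute idealD(2) less_irrefl scaleR_scaleR
      left_inverse scaleR_one)
  then have "w = (fst w / fst v) *\<^sub>R v" using v by (simp add: prod_eq_iff ideal_def)
  moreover have "0 < fst w / fst v" using v w by (simp add: ideal_def)
  ultimately show ?thesis by (rule that[rotated])
qed

lemma ideal_scaleR: "ideal v \<Longrightarrow> 0 < c \<Longrightarrow> ideal (c *\<^sub>R v)"
  by (simp add: ideal_def lor_linear)

lemma lor_perp_nonneg:
  assumes x: "x \<in> hyp3" and "lor x y = 0"
  shows "0 \<le> lor y y"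
proof (rule ccontr)
  assume n: "\<not> 0 \<le> lor y y"
  have "fst y \<noteq> 0" using n by (auto simp: lor_self)
  then consider "0 < fst y" | "0 < fst (- y)" by fastforce
  then show False
  proof cases
    case 1
    with causal_future_neg[of x y] n x assms show False by (auto simp: hyp3_def)
  next
    case 2
    with causal_future_neg[of x "- y"] n x assms show False by (auto simp: hyp3_def lor_linear)
  qed
qed

text \<open>The vectors orthogonal to a point of the hyperboloid form its tangent space, on which
  the form is nonnegative. The estimates for horoballs apply this to tangential components of
  light-like vectors and normals.\<close>

lemma lor_perp_Cauchy_Schwarz:
  assumes x: "x \<in> hyp3" and y: "lor x y = 0" and z: "lor x z = 0"
  shows "(lor y z)\<^sup>2 \<le> lor y y * lor z z"
proof (cases "lor z z = 0")
  case True
  have "0 \<le> lor (y + t *\<^sub>R z) (y + t *\<^sub>R z)" for t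
    using y z by (intro lor_perp_nonneg[OF x]) (simp add: lor_linear)
  then have *: "0 \<le> lor y y + 2 * t * lor y z" for t
    using True by (simp add: lor_linear lor_sym[of z y] algebra_simps)
  have "lor y z = 0"
  proof (rule ccontr)
    assume n: "lor y z \<noteq> 0"
    \<comment> \<open>This t would make the affine function of t equal to -1.\<close>
    have "2 * (- (lor y y + 1) / (2 * lor y z)) * lor y z = - (lor y y + 1)" using n by simp
    with *[of "- (lor y y + 1) / (2 * lor y z)"] show False by linarith
  qed
  then show ?thesis using True by simp
next
  case False
  then have p: "0 < lor z z" using lor_perp_nonneg[OF x z] by simp
  have "0 \<le> lor (lor z z *\<^sub>R y - lor y z *\<^sub>R z) (lor z z *\<^sub>R y - lor y z *\<^sub>R z)"
    using y z by (intro lor_perp_nonneg[OF x]) (simp add: lor_linear)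
  also have "\<dots> = lor z z * (lor y y * lor z z - (lor y z)\<^sup>2)"
    by (simp add: lor_linear lor_sym[of z y] power2_eq_square algebra_simps)
  finally show ?thesis using p by (simp add: zero_le_mult_iff)
qed

text \<open>Cauchy-Schwarz for the tangential components of \<open>v\<close> and \<open>w\<close> at
  \<open>x\<close>, whose lengths are - lor x v and - lor x w. In particular, if the product of two
  light-like vectors is at most -2, no point has height below 1 over both, which separates the
  lattice horoballs.\<close>

lemma lor_ideal_ideal_bound:
  assumes x: "x \<in> hyp3" and v: "ideal v" and w: "ideal w"
  shows "- lor v w \<le> 2 * (lor x v * lor x w)"
proof -
  define a b where "a = lor x v" and "b = lor x w"
  have xx: "lor x x = -1" using x by (simp add: hyp3_def)
  have ab: "a < 0" "b < 0" using lor_hyp3_ideal x v w by (auto simp: a_def b_def)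
  have "(lor (v + a *\<^sub>R x) (w + b *\<^sub>R x))\<^sup>2 \<le> lor (v + a *\<^sub>R x) (v + a *\<^sub>R x) * lor (w + b *\<^sub>R x) (w + b *\<^sub>R x)"
    by (rule lor_perp_Cauchy_Schwarz[OF x]) (simp_all add: lor_linear xx a_def b_def)
  also have "lor (v + a *\<^sub>R x) (w + b *\<^sub>R x) = lor v w + a * b"
    by (simp add: lor_linear xx a_def b_def lor_sym[of v x] lor_sym[of w x])
  also have "lor (v + a *\<^sub>R x) (v + a *\<^sub>R x) = a\<^sup>2"
    using v by (simp add: lor_linear xx a_def lor_sym[of v x] ideal_def power2_eq_square)
  also have "lor (w + b *\<^sub>R x) (w + b *\<^sub>R x) = b\<^sup>2"
    using w by (simp add: lor_linear xx b_def lor_sym[of w x] ideal_def power2_eq_square)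
  finally have "(lor v w + a * b)\<^sup>2 \<le> (a * b)\<^sup>2" by (simp add: power_mult_distrib)
  then have "\<bar>lor v w + a * b\<bar> \<le> \<bar>a * b\<bar>" by (simp add: abs_le_square_iff)
  moreover have "0 < a * b" using ab by (rule mult_neg_neg)
  ultimately show ?thesis unfolding a_def[symmetric] b_def[symmetric] by linarith
qed

text \<open>The tangential components of \<open>e\<close> and \<open>v\<close> at x have square
  norms 1 + t^2 and q^2. If t > 0, Cauchy-Schwarz for them contradicts q <= p, because (q + t q)^2
  exceeds (1 + t^2) q^2.\<close>

lemma horoball_subset_halfspace:
  assumes v: "ideal v" and e: "lor e e = 1" and s: "s \<le> - lor v e"
  shows "{x \<in> hyp3. - lor x v \<le> s} \<subseteq> halfspace e"
proof
  fix x assume "x \<in> {x \<in> hyp3. - lor x v \<le> s}"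
  then have x: "x \<in> hyp3" and sx: "- lor x v \<le> s" by auto
  define q t p where "q = - lor x v" and "t = lor x e" and "p = - lor v e"
  have xx: "lor x x = -1" using x by (simp add: hyp3_def)
  have q: "0 < q" using lor_hyp3_ideal[OF x v] by (simp add: q_def)
  have pq: "q \<le> p" using s sx by (simp add: p_def q_def)
  have "t \<le> 0"
  proof (rule ccontr)
    assume "\<not> t \<le> 0"
    then have t: "0 < t" by simp
    have "(lor (e + t *\<^sub>R x) (v - q *\<^sub>R x))\<^sup>2 \<le> lor (e + t *\<^sub>R x) (e + t *\<^sub>R x) * lor (v - q *\<^sub>R x) (v - q *\<^sub>R x)"
      by (rule lor_perp_Cauchy_Schwarz[OF x]) (simp_all add: lor_linear xx t_def q_def)
    also have "lor (e + t *\<^sub>R x) (v - q *\<^sub>R x) = - (p + t * q)"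
      by (simp add: lor_linear xx t_def q_def p_def lor_sym[of e x] lor_sym[of e v] algebra_simps)
    also have "lor (e + t *\<^sub>R x) (e + t *\<^sub>R x) = 1 + t\<^sup>2"
      by (simp add: lor_linear xx t_def lor_sym[of e x] e power2_eq_square)
    also have "lor (v - q *\<^sub>R x) (v - q *\<^sub>R x) = q\<^sup>2"
      using v by (simp add: lor_linear xx q_def lor_sym[of v x] ideal_def power2_eq_square)
    finally have "(p + t * q)\<^sup>2 \<le> (1 + t\<^sup>2) * q\<^sup>2" unfolding power2_minus .
    moreover have "(q + t * q)\<^sup>2 \<le> (p + t * q)\<^sup>2" using pq q t by (intro power_mono) auto
    moreover have "(q + t * q)\<^sup>2 = (1 + t\<^sup>2) * q\<^sup>2 + 2 * t * q\<^sup>2" by (simp add: power2_eq_square algebra_simps)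
    ultimately have "2 * t * q\<^sup>2 \<le> 0" by linarith
    then show False using t q by (simp add: mult_le_0_iff)
  qed
  then show "x \<in> halfspace e" using x by (simp add: halfspace_def t_def)
qed

text \<open>A violating point is found on the geodesic from the ideal point perpendicular to the
  plane, that is, in the span of \<open>v\<close> and \<open>e\<close>.\<close>

lemma horoball_subset_halfspace_conv:
  assumes v: "ideal v" and e: "lor e e = 1" and p: "lor v e < 0" and "0 < s"
    and sub: "{x \<in> hyp3. - lor x v \<le> s} \<subseteq> halfspace e"
  shows "s \<le> - lor v e"
proof (rule ccontr)
  assume n: "\<not> s \<le> - lor v e"
  define p where "p = - lor v e"
  have p: "0 < p" "p < s" using p n by (auto simp: p_def)
  \<comment> \<open>\<open>b\<close> gives the point height exactly \<open>s\<close> over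
    \<open>v\<close>, and \<open>a\<close> puts it on the hyperboloid. Its product with
    \<open>e\<close> is (b^2 - 1) / (2 b), positive since b > 1.\<close>
  define b a where "b = s / p" and "a = (b\<^sup>2 + 1) / (2 * b * p)"
  have b: "1 < b" using p by (simp add: b_def)
  define x where "x = a *\<^sub>R v + b *\<^sub>R e"
  have ab: "2 * (a * b * p) = b\<^sup>2 + 1" using b p by (simp add: a_def)
  have "lor x x = - 2 * (a * b * p) + b\<^sup>2"
    using v e by (simp add: x_def lor_linear ideal_def p_def lor_sym[of e v] power2_eq_square algebra_simps)
  then have xx: "lor x x = -1" unfolding mult_minus_left ab by simp
  have xv: "lor x v = - s" using v p b by (simp add: x_def lor_linear ideal_def lor_sym[of e v] p_def b_def)
  then have "x \<in> hyp3" using hyp3I_ideal[OF v xx] \<open>0 < s\<close> by simp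
  then have "lor x e \<le> 0" using sub xv by (auto simp: halfspace_def)
  moreover have "lor x e = b - a * p" using e by (simp add: x_def lor_linear p_def)
  ultimately have "b \<le> a * p" by simp
  then have "2 * (b * b) \<le> 2 * (b * (a * p))" using b by simp
  also have "\<dots> = b\<^sup>2 + 1" using ab by (simp add: ac_simps)
  finally have "b\<^sup>2 \<le> 1" by (simp add: power2_eq_square)
  moreover have "1 < b\<^sup>2" using b by (rule one_less_power) simp
  ultimately show False by linarith
qed

text \<open>On the geodesic joining the two ideal points \<open>lor_ideal_ideal_bound\<close> is an
  equality, so the bound is sharp and larger horoballs do meet.\<close>

lemma horoballs_overlap:
  assumes v: "ideal v" and w: "ideal w" and st: "0 < s" "0 < t" "- lor v w < 2 * (s * t)" and n: "lor v w < 0"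
  obtains x where "x \<in> hyp3" "- lor x v < s" "- lor x w < t"
proof -
  define l where "l = - lor v w"
  define r where "r = sqrt (l / (2 * (s * t)))"
  have l: "0 < l" using n by (simp add: l_def)
  have "l / (2 * (s * t)) < 1" using st by (subst divide_less_eq_1_pos) (simp_all add: l_def)
  then have r: "0 < r" "r < 1" using l st by (simp_all add: r_def)
  have r2: "r * r = l / (2 * (s * t))" using l st by (simp add: r_def)
  \<comment> \<open>The point of that geodesic whose heights over \<open>v\<close> and
    \<open>w\<close> are \<open>s\<close> and \<open>t\<close>, both shrunk by r < 1.\<close>
  define x where "x = (t * r / l) *\<^sub>R v + (s * r / l) *\<^sub>R w"
  have xv: "lor x v = - (s * r)" and xw: "lor x w = - (t * r)"
    using v w l by (simp_all add: x_def lor_linear ideal_def lor_sym[of w v]) (simp_all add: l_def)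
  have "lor x x = (t * r / l) * lor x v + (s * r / l) * lor x w"
    unfolding x_def lor_add_left lor_add_right lor_scaleR_left lor_scaleR_right
    by (simp add: lor_sym[of w v] algebra_simps)
  also have "\<dots> = - (2 * (s * t)) * (r * r) / l" by (simp add: xv xw algebra_simps)
  also have "\<dots> = -1" unfolding r2 using l st by simp
  finally have xx: "lor x x = -1" .
  have "x \<in> hyp3" using hyp3I_ideal[OF v xx] xv st r by simp
  moreover have "s * r < s * 1" "t * r < t * 1" using st r by (intro mult_strict_left_mono; simp)+
  ultimately show ?thesis using that[of x] xv xw by simp
qed

text \<open>A packing asks disjointness only of different members, so horoballs at different ideal
  points must be known to differ as sets. Far out towards \<open>v\<close>, the geodesic between the
  centres has left the horoball at \<open>w\<close>.\<close>

lemma horoball_neq: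
  assumes v: "ideal v" and w: "ideal w" and n: "lor v w < 0" and s: "0 < s" "0 < t"
  shows "{x \<in> hyp3. - lor x v \<le> s} \<noteq> {x \<in> hyp3. - lor x w \<le> t}"
proof -
  define l where "l = - lor v w"
  have l: "0 < l" using n by (simp add: l_def)
  \<comment> \<open>The first bound puts the point into the horoball at \<open>v\<close>; the second
    makes its height over \<open>w\<close>, which is 1 / (2 b), at least 2 t.\<close>
  define b where "b = min (s / l) (1 / (4 * t))"
  have b: "0 < b" "b \<le> s / l" "b \<le> 1 / (4 * t)" using s l by (auto simp: b_def)
  define a where "a = 1 / (2 * b * l)"
  define x where "x = a *\<^sub>R v + b *\<^sub>R w"
  have xv: "lor x v = - (b * l)" and xw: "lor x w = - (a * l)"
    using v w by (simp_all add: x_def lor_linear ideal_def lor_sym[of w v] l_def)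
  have "lor x x = a * lor x v + b * lor x w"
    unfolding x_def lor_add_left lor_add_right lor_scaleR_left lor_scaleR_right
    by (simp add: lor_sym[of w v] algebra_simps)
  also have "\<dots> = - (2 * b * l) * a" by (simp add: xv xw algebra_simps)
  also have "\<dots> = -1" using b l by (simp add: a_def)
  finally have xx: "lor x x = -1" .
  have x: "x \<in> hyp3" using hyp3I_ideal[OF v xx] xv b l by simp
  have "b * l \<le> s" using b l by (simp add: pos_le_divide_eq)
  then have "x \<in> {x \<in> hyp3. - lor x v \<le> s}" using x xv by simp
  moreover have "t < a * l"
  proof -
    have "b * (4 * t) \<le> 1" using b s by (simp add: pos_le_divide_eq)
    then have "2 * b * t < 1" by simp
    then have "t < 1 / (2 * b)" using b by (simp add: pos_less_divide_eq mult.commute)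
    then show ?thesis using l by (simp add: a_def)
  qed
  then have "x \<notin> {x \<in> hyp3. - lor x w \<le> t}" using xw by simp
  ultimately show ?thesis by blast
qed

lemma open_lor_less: "openin (top_of_set hyp3) {x \<in> hyp3. lor x v < c}"
proof -
  have "open {x. lor x v < c}" by (intro open_Collect_less continuous_intros)
  then show ?thesis by (auto simp: openin_open)
qed

text \<open>The factor \<open>c\<close> brings x + t d back to the hyperboloid; with c near 1 and t
  near 0 such points enter every neighbourhood of x.\<close>

lemma not_interior_lor:
  assumes x: "x \<in> hyp3" and d: "\<And>r. 0 < r \<Longrightarrow> \<exists>c>0. \<exists>t. 0 < t \<and> t < r \<and> c *\<^sub>R (x + t *\<^sub>R d) \<in> hyp3 - S \<and> \<bar>c - 1\<bar> < r"
  shows "x \<notin> hyp_interior S"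
proof
  assume "x \<in> hyp_interior S"
  then obtain U where U: "open U" "x \<in> U" "hyp3 \<inter> U \<subseteq> S"
    by (auto simp: interior_of_def openin_open)
  have "isCont (\<lambda>p. fst p *\<^sub>R (x + snd p *\<^sub>R d)) (1, 0::real)" by (intro continuous_intros)
  then have "((\<lambda>p. fst p *\<^sub>R (x + snd p *\<^sub>R d)) \<longlongrightarrow> x) (at (1, 0::real))"
    by (simp add: isCont_def)
  then obtain r where r: "0 < r" "\<And>p. p \<noteq> (1, 0) \<Longrightarrow> dist p (1, 0) < r \<Longrightarrow> fst p *\<^sub>R (x + snd p *\<^sub>R d) \<in> U"
    using U by (auto simp: tendsto_def eventually_at)
  obtain c t where ct: "0 < t" "t < r / 2" "c *\<^sub>R (x + t *\<^sub>R d) \<in> hyp3 - S" "\<bar>c - 1\<bar> < r / 2"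
    using d[of "r / 2"] r by auto
  have "dist (c, t) (1, 0) \<le> \<bar>c - 1\<bar> + \<bar>t\<bar>"
    by (simp add: dist_prod_def dist_real_def sqrt_sum_squares_le_sum_abs)
  then have "dist (c, t) (1, 0) < r" using ct by linarith
  then have "c *\<^sub>R (x + t *\<^sub>R d) \<in> U" using r(2)[of "(c, t)"] ct by simp
  then show False using U ct by blast
qed

section \<open>Simplices with equal Gram matrices are congruent\<close>

text \<open>Biorthogonality makes the four vectors independent, hence a basis. It is applied with
  the vertices as \<open>p\<close> and the normals as \<open>q\<close>, and also the other way
  round.\<close>

lemma lor_dual_expansion:
  fixes p q :: "nat \<Rightarrow> lorentz"
  assumes perp: "\<And>i j. i < 4 \<Longrightarrow> j < 4 \<Longrightarrow> i \<noteq> j \<Longrightarrow> lor (p i) (q j) = 0"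
    and diag: "\<And>i. i < 4 \<Longrightarrow> lor (p i) (q i) \<noteq> 0"
  shows "x = (\<Sum>k<4. (lor x (q k) / lor (p k) (q k)) *\<^sub>R p k)"
proof -
  have coeff: "lor (\<Sum>k<4. u k *\<^sub>R p k) (q j) = u j * lor (p j) (q j)" if "j < 4" for u j
  proof -
    have "lor (\<Sum>k<4. u k *\<^sub>R p k) (q j) = (\<Sum>k<4. if k = j then u j * lor (p j) (q j) else 0)"
      unfolding lor_sum_left using that perp by (intro sum.cong) (auto simp: lor_linear)
    then show ?thesis using that by simp
  qed
  have inj: "inj_on p {..<4}"
    using perp diag by (intro inj_onI) (metis lessThan_iff)
  have "independent (p ` {..<4})"
  proof (rule independent_if_scalars_zero)
    fix f b assume 0: "(\<Sum>x\<in>p ` {..<4}. f x *\<^sub>R x) = 0" and "b \<in> p ` {..<4}"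
    then obtain j where j: "j < 4" "b = p j" by auto
    have "(\<Sum>k<4. f (p k) *\<^sub>R p k) = 0" using 0 by (simp add: sum.reindex[OF inj])
    with coeff[OF j(1), of "f \<circ> p"] show "f b = 0" using diag[OF j(1)] j(2) by simp
  qed simp
  then have "UNIV \<subseteq> span (p ` {..<4})"
    using inj by (intro card_ge_dim_independent) (auto simp: card_image)
  then have "x \<in> span (p ` {..<4})" by blast
  then obtain f where "x = (\<Sum>y\<in>p ` {..<4}. f y *\<^sub>R y)"
    by (auto simp: span_finite)
  then have x: "x = (\<Sum>k<4. f (p k) *\<^sub>R p k)" by (simp add: sum.reindex[OF inj])
  have "f (p k) = lor x (q k) / lor (p k) (q k)" if "k < 4" for k
    using coeff[OF that, of "f \<circ> p"] diag[OF that] x by simp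
  then have "(\<Sum>k<4. f (p k) *\<^sub>R p k) = (\<Sum>k<4. (lor x (q k) / lor (p k) (q k)) *\<^sub>R p k)"
    by (intro sum.cong) auto
  with x show ?thesis by simp
qed

lemma hyp_simplexD:
  assumes "hyp_simplex v e" "i < 4"
  shows "v i \<in> hyp3 \<or> ideal (v i)" "lor (e i) (e i) = 1" "lor (v i) (e i) < 0"
    "j < 4 \<Longrightarrow> i \<noteq> j \<Longrightarrow> lor (v i) (e j) = 0"
  using assms by (auto simp: hyp_simplex_def)

lemma hyp_simplex_vertex_causal:
  assumes "hyp_simplex v e" "i < 4"
  shows "lor (v i) (v i) \<le> 0" "0 < fst (v i)"
  using hyp_simplexD(1)[OF assms] by (auto simp: hyp3_def ideal_def)

lemma timelike_future_iff:
  assumes "lor y y < 0" "lor u u \<le> 0" "0 < fst u"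
  shows "0 < fst y \<longleftrightarrow> lor y u < 0"
proof
  show "lor y u < 0" if "0 < fst y" by (rule causal_future_neg[OF assms(1) that assms(2,3)])
  show "0 < fst y" if "lor y u < 0"
  proof (rule ccontr)
    assume "\<not> 0 < fst y"
    moreover have "fst y \<noteq> 0" using assms(1) by (auto simp: lor_self)
    ultimately have "lor (- y) u < 0"
      by (intro causal_future_neg[of "- y" u]) (use assms in \<open>auto simp: lor_linear\<close>)
    with that show False by (simp add: lor_linear)
  qed
qed

text \<open>The normals form a basis, so matching the two families of normals defines
  \<open>L\<close>, and equal Gram matrices make it an isometry. The vertices are the dual basis up
  to positive factors and are carried along. As a vertex stays in the closure of the future cone,
  \<open>L\<close> does not reverse time.\<close>

lemma hyp_simplex_congruence:
  assumes s0: "hyp_simplex v0 e0" and s: "hyp_simplex v e"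
    and gram: "\<And>i j. i < 4 \<Longrightarrow> j < 4 \<Longrightarrow> lor (e i) (e j) = lor (e0 i) (e0 j)"
  obtains L where "lor_isometry L" "\<And>i. i < 4 \<Longrightarrow> L (e0 i) = e i"
    "\<And>i. i < 4 \<Longrightarrow> \<exists>r>0. v i = r *\<^sub>R L (v0 i)"
    "\<And>x. lor x x < 0 \<Longrightarrow> 0 < fst (L x) \<longleftrightarrow> 0 < fst x"
proof -
  define a where "a x k = lor x (v0 k) / lor (e0 k) (v0 k)" for x k
  define L where "L x = (\<Sum>k<4. a x k *\<^sub>R e k)" for x
  note D0 = hyp_simplexD[OF s0] and D = hyp_simplexD[OF s]
  have expand: "x = (\<Sum>k<4. a x k *\<^sub>R e0 k)" for x
    unfolding a_def using D0 by (intro lor_dual_expansion) (auto simp: lor_sym[of "e0 _" "v0 _"] less_imp_neq)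
  have lin: "linear L"
    by (rule linearI) (simp_all add: L_def a_def lor_linear add_divide_distrib scaleR_add_left sum.distrib scaleR_sum_right)
  have iso: "lor (L x) (L y) = lor x y" for x y
  proof -
    have bilinear: "lor (\<Sum>k<4. a x k *\<^sub>R f k) (\<Sum>j<4. a y j *\<^sub>R f j)
        = (\<Sum>k<4. \<Sum>j<4. a x k * (a y j * lor (f k) (f j)))" for f
      unfolding lor_sum_left by (simp only: lor_sum_right lor_scaleR_left lor_scaleR_right sum_distrib_left mult.left_commute)
    have "lor (L x) (L y) = (\<Sum>k<4. \<Sum>j<4. a x k * (a y j * lor (e k) (e j)))"
      unfolding L_def by (rule bilinear)
    also have "\<dots> = (\<Sum>k<4. \<Sum>j<4. a x k * (a y j * lor (e0 k) (e0 j)))"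
      by (intro sum.cong) (auto simp: gram)
    also have "\<dots> = lor (\<Sum>k<4. a x k *\<^sub>R e0 k) (\<Sum>k<4. a y k *\<^sub>R e0 k)"
      by (rule bilinear[symmetric])
    also have "\<dots> = lor x y" using expand[of x] expand[of y] by simp
    finally show ?thesis .
  qed
  have Le: "L (e0 i) = e i" if "i < 4" for i
  proof -
    have "a (e0 i) k = (if k = i then 1 else 0)" if "k < 4" for k
      using that \<open>i < 4\<close> D0(3)[of i] D0(4)[of k i] by (auto simp: a_def lor_sym[of "e0 _" "v0 _"])
    then have "L (e0 i) = (\<Sum>k<4. if k = i then e i else 0)"
      unfolding L_def by (intro sum.cong) auto
    then show ?thesis using that by simp
  qed
  have Lve: "lor (L (v0 i)) (e j) = lor (v0 i) (e0 j)" if "j < 4" for i j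
    using iso[of "v0 i" "e0 j"] by (simp add: Le[OF that])
  have Lv: "\<exists>r>0. v i = r *\<^sub>R L (v0 i)" if i: "i < 4" for i
  proof -
    have "v i = (\<Sum>k<4. (lor (v i) (e k) / lor (L (v0 k)) (e k)) *\<^sub>R L (v0 k))"
      using D0 by (intro lor_dual_expansion) (auto simp: Lve less_imp_neq)
    also have "\<dots> = (\<Sum>k<4. if k = i then (lor (v i) (e i) / lor (v0 i) (e0 i)) *\<^sub>R L (v0 i) else 0)"
      using D(4)[OF i] by (intro sum.cong) (auto simp: Lve)
    also have "\<dots> = (lor (v i) (e i) / lor (v0 i) (e0 i)) *\<^sub>R L (v0 i)" using i by simp
    finally show ?thesis using D(3)[OF i] D0(3)[OF i] by (intro exI[of _ "lor (v i) (e i) / lor (v0 i) (e0 i)"]) (auto simp: zero_less_divide_iff)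
  qed
  have "0 < fst (L x) \<longleftrightarrow> 0 < fst x" if x: "lor x x < 0" for x
  proof -
    obtain r where r: "0 < r" "v 0 = r *\<^sub>R L (v0 0)" using Lv[of 0] by auto
    have "0 < fst (L (v0 0))"
      using hyp_simplex_vertex_causal(2)[OF s, of 0] r by (simp add: zero_less_mult_iff)
    then have "0 < fst (L x) \<longleftrightarrow> lor (L x) (L (v0 0)) < 0"
      using x hyp_simplex_vertex_causal(1)[OF s0, of 0] by (intro timelike_future_iff) (auto simp: iso)
    also have "\<dots> \<longleftrightarrow> 0 < fst x"
      using x hyp_simplex_vertex_causal[OF s0, of 0] by (simp add: iso timelike_future_iff[of x "v0 0"])
    finally show ?thesis .
  qed
  with lin iso Le Lv show ?thesis by (intro that[of L]) (auto simp: lor_isometry_def)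
qed

lemma future_isometry_hyp3:
  assumes L: "lor_isometry L" and future: "\<And>x. lor x x < 0 \<Longrightarrow> 0 < fst (L x) \<longleftrightarrow> 0 < fst x"
  shows "L x \<in> hyp3 \<longleftrightarrow> x \<in> hyp3"
proof -
  have "lor (L x) (L x) = lor x x" using L unfolding lor_isometry_def by blast
  then show ?thesis using future[of x] by (auto simp: hyp3_def)
qed

lemma simplex_body_vimage:
  assumes L: "lor_isometry L" and future: "\<And>x. lor x x < 0 \<Longrightarrow> 0 < fst (L x) \<longleftrightarrow> 0 < fst x"
    and e: "\<And>i. i < 4 \<Longrightarrow> L (e0 i) = e i"
  shows "L -` simplex_body e = simplex_body e0"
proof -
  have "lor (L x) (e i) = lor x (e0 i)" if "i < 4" for x i
    using L e[OF that] by (metis lor_isometry_def)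
  then have "x \<in> L -` simplex_body e \<longleftrightarrow> x \<in> simplex_body e0" for x
    by (simp add: simplex_body_def halfspace_def future_isometry_hyp3[OF L future])
  then show ?thesis by blast
qed

lemma hyp3_eq: "hyp3 = {x. lor x x = -1} \<inter> {x. 0 < fst x}"
  by (auto simp: hyp3_def)

lemma sets_hyp3 [measurable]: "hyp3 \<in> sets borel"
proof -
  have "closed {x. lor x x = -1}" by (intro closed_Collect_eq continuous_intros)
  moreover have "open {x :: lorentz. 0 < fst x}" by (intro open_Collect_less continuous_intros)
  ultimately show ?thesis unfolding hyp3_eq by auto
qed

lemma sets_halfspace [measurable]: "halfspace e \<in> sets borel"
  unfolding halfspace_def by measurable

lemma sets_simplex_body [measurable]: "simplex_body e \<in> sets borel"
  unfolding simplex_body_def by (intro sets.finite_INT sets_halfspace) (auto simp: lessThan_empty_iff)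

lemma sets_horoball [measurable]: "{x \<in> hyp3. - lor x v \<le> s} \<in> sets borel"
  by measurable

section \<open>Simplices over a right isosceles triangle\<close>

text \<open>The vertical plane over the line a x + b y = c, with normal pointing to the side a x + b
  y > c; it is a unit vector when a^2 + b^2 = 1.\<close>

definition plane :: "real \<Rightarrow> real \<Rightarrow> real \<Rightarrow> lorentz" where
  "plane a b c = (c, vector [a, b, c])"

text \<open>Normal of the unit hemisphere around the origin; its half-space is the outside of the
  sphere.\<close>

definition unit_sphere :: lorentz where
  "unit_sphere = (0, vector [0, 0, -1])"

text \<open>The point at infinity, scaled so that a point at Euclidean height z has - lor x cusp = 1
  / z. The horoball with s = 1 touches the unit sphere.\<close>

definition cusp :: lorentz where
  "cusp = (1, vector [0, 0, 1])"

lemma lor_vector: "lor (t, vector [a, b, c]) (t', vector [a', b', c']) = a * a' + b * b' + c * c' - t * t'"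
  by (simp add: lor_def inner_vec_def sum_3)

lemma lor_horo_point_plane: "lor (horo_point x y u) (plane a b c) = exp (- u) * (a * x + b * y - c)"
  by (simp add: horo_point_def plane_def lor_vector) (simp add: field_simps)

lemma lor_horo_point_unit_sphere: "lor (horo_point x y u) unit_sphere = exp (- u) * (1 - x\<^sup>2 - y\<^sup>2 - exp (2 * u)) / 2"
proof -
  have "exp u = exp (- u) * exp (2 * u)" by (simp add: exp_add[symmetric])
  then show ?thesis
    by (simp add: horo_point_def unit_sphere_def lor_vector) (simp add: field_simps)
qed

lemma lor_horo_point_cusp: "lor (horo_point x y u) cusp = - exp (- u)"
  by (simp add: horo_point_def cusp_def lor_vector) (simp add: field_simps)

lemma horo_point_hyp3: "horo_point x y u \<in> hyp3"
proof -
  have e: "exp u * exp (- u) = 1" by (simp add: exp_minus)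
  have "lor (horo_point x y u) (horo_point x y u) = (x\<^sup>2 + y\<^sup>2) * (exp (- u))\<^sup>2 - (exp u * exp (- u) + (x\<^sup>2 + y\<^sup>2) * (exp (- u))\<^sup>2)"
    by (simp add: horo_point_def lor_vector) (simp add: power2_eq_square field_simps)
  then have "lor (horo_point x y u) (horo_point x y u) = -1" unfolding e by simp
  moreover have "0 < fst (horo_point x y u)" by (simp add: horo_point_def add_pos_nonneg)
  ultimately show ?thesis by (simp add: hyp3_def)
qed

lemma horo_point_halfspace_plane: "horo_point x y u \<in> halfspace (plane a b c) \<longleftrightarrow> a * x + b * y \<le> c"
  by (simp add: halfspace_def horo_point_hyp3 lor_horo_point_plane mult_le_0_iff)

lemma horo_point_halfspace_unit_sphere: "horo_point x y u \<in> halfspace unit_sphere \<longleftrightarrow> 1 - (x\<^sup>2 + y\<^sup>2) \<le> exp (2 * u)"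
proof -
  have "exp (- u) * (1 - x\<^sup>2 - y\<^sup>2 - exp (2 * u)) / 2 \<le> 0 \<longleftrightarrow> 1 - x\<^sup>2 - y\<^sup>2 - exp (2 * u) \<le> 0"
    by (simp only: times_divide_eq_right[symmetric] mult_le_0_iff) (simp add: not_le)
  then show ?thesis by (auto simp: halfspace_def horo_point_hyp3 lor_horo_point_unit_sphere)
qed

lemma nn_integral_exp_atLeast: "(\<integral>\<^sup>+u. ennreal (exp (- 2 * u)) * indicator {a..} u \<partial>lborel) = ennreal (exp (- 2 * a) / 2)"
proof -
  have "(\<integral>\<^sup>+u. ennreal (exp (- 2 * u)) * indicator {a..} u \<partial>lborel) = ennreal (0 - - exp (- 2 * a) / 2)"
  proof (rule nn_integral_FTC_atLeast)
    show "((\<lambda>u. - exp (- 2 * u) / 2) has_real_derivative exp (- 2 * x)) (at x)" for x :: real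
      by (auto intro!: derivative_eq_intros)
    have "LIM x at_top. - 2 * x :> (at_bot :: real filter)"
      using filterlim_tendsto_neg_mult_at_bot[OF tendsto_const[of "-2::real"] _ filterlim_ident] by simp
    then have "((\<lambda>x::real. exp (- 2 * x)) \<longlongrightarrow> 0) at_top"
      by (rule filterlim_compose[OF exp_at_bot])
    from tendsto_divide[OF tendsto_minus[OF this] tendsto_const[of 2]]
    show "((\<lambda>u::real. - exp (- 2 * u) / 2) \<longlongrightarrow> 0) at_top" by simp
  qed auto
  then show ?thesis by simp
qed

text \<open>The column starts on the unit sphere when r < 1. For r >= 1 it has no lower end, and
  comparison with the half-lines from -n upwards shows that its volume is infinite.\<close>

lemma nn_integral_column:
  "(\<integral>\<^sup>+u. ennreal (exp (- 2 * u)) * indicator {u. 1 - r \<le> exp (2 * u)} u \<partial>lborel) = column_vol r"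
proof (cases "r < 1")
  case True
  have "1 - r \<le> exp (2 * u) \<longleftrightarrow> ln (1 - r) / 2 \<le> u" for u
  proof -
    have "1 - r \<le> exp (2 * u) \<longleftrightarrow> ln (1 - r) \<le> 2 * u"
      using ln_le_cancel_iff[of "1 - r" "exp (2 * u)"] True by simp
    then show ?thesis by auto
  qed
  then have set: "{u. 1 - r \<le> exp (2 * u)} = {ln (1 - r) / 2..}" by blast
  have "exp (- 2 * (ln (1 - r) / 2)) = inverse (exp (ln (1 - r)))" by (simp flip: exp_minus)
  also have "\<dots> = 1 / (1 - r)" using True by (simp add: inverse_eq_divide)
  finally have val: "exp (- 2 * (ln (1 - r) / 2)) / 2 = 1 / (2 * (1 - r))" by simp
  show ?thesis unfolding set nn_integral_exp_atLeast val column_vol_def using True by simp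
next
  case False
  have "{u. 1 - r \<le> exp (2 * u)} = UNIV" using False by (auto intro: order_trans[OF _ exp_ge_zero])
  moreover have "(\<integral>\<^sup>+u. ennreal (exp (- 2 * u)) * indicator UNIV u \<partial>lborel) = top" (is "?I = top")
  proof (rule ccontr)
    assume "?I \<noteq> top"
    then obtain n :: nat where n: "?I < of_nat n" using ennreal_Ex_less_of_nat by (auto simp: top.not_eq_extremum)
    have e: "exp (- 2 * - real n) = exp (2 * real n)" by simp
    have "real n \<le> exp (2 * real n) / 2" using exp_ge_add_one_self[of "2 * real n"] by linarith
    then have "ennreal (real n) \<le> ennreal (exp (2 * real n) / 2)" by (rule ennreal_leI)
    also have "\<dots> = (\<integral>\<^sup>+u. ennreal (exp (- 2 * u)) * indicator {- real n..} u \<partial>lborel)"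
      unfolding nn_integral_exp_atLeast e ..
    also have "\<dots> \<le> ?I" by (intro nn_integral_mono) (auto split: split_indicator)
    finally show False using n by (simp add: ennreal_of_nat_eq_real_of_nat)
  qed
  ultimately show ?thesis using False by (simp add: column_vol_def)
qed

datatype shape = One_Leg | Hypotenuse | Two_Legs

text \<open>In the upper half-space, a Coxeter simplex with an ideal vertex at \<open>\<infinity>\<close> lies over a right
  isosceles triangle and outside the unit sphere (facet 0); facets 1 and 3 are over the legs and
  facet 2 is over the hypotenuse. The shape tells which sides meet the sphere at a
  non-right angle.\<close>

primrec base_triangle :: "shape \<Rightarrow> real \<Rightarrow> (real \<times> real) set" where
  "base_triangle One_Leg c = {(x, y). 0 \<le> y \<and> y \<le> x \<and> x \<le> c}"
| "base_triangle Hypotenuse c = {(x, y). y \<le> x \<and> - y \<le> x \<and> x \<le> c}"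
| "base_triangle Two_Legs c = {(x, y). x \<le> c \<and> y \<le> c \<and> 0 \<le> x + y}"

primrec piece_count :: "shape \<Rightarrow> nat" where
  "piece_count One_Leg = 1" | "piece_count Hypotenuse = 2" | "piece_count Two_Legs = 4"

primrec model_normals :: "shape \<Rightarrow> real \<Rightarrow> lorentz list" where
  "model_normals One_Leg c =
    [unit_sphere, plane 1 0 c, plane (- sqrt 2 / 2) (sqrt 2 / 2) 0, plane 0 (- 1) 0]"
| "model_normals Hypotenuse c =
    [unit_sphere, plane (- sqrt 2 / 2) (sqrt 2 / 2) 0, plane 1 0 c, plane (- sqrt 2 / 2) (- sqrt 2 / 2) 0]"
| "model_normals Two_Legs c =
    [unit_sphere, plane 1 0 c, plane (- sqrt 2 / 2) (- sqrt 2 / 2) 0, plane 0 1 c]"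

definition model_normal :: "shape \<Rightarrow> real \<Rightarrow> nat \<Rightarrow> lorentz" where
  "model_normal sh c i = model_normals sh c ! i"

text \<open>The integrand depends on x^2 + y^2 alone, so the reflections y to -y and x, y to y, x
  preserve it and carry the small triangle to the pieces \<open>F2\<close>, \<open>F3\<close> and
  \<open>F4\<close>. Pieces overlap only in lines, which the almost-everywhere statements
  discard.\<close>

lemma nn_integral_base_triangle:
  fixes Q :: "real \<Rightarrow> ennreal"
  assumes [measurable]: "Q \<in> borel_measurable borel"
  shows "(\<integral>\<^sup>+x. \<integral>\<^sup>+y. Q (x\<^sup>2 + y\<^sup>2) * indicator (base_triangle sh c) (x, y) \<partial>lborel \<partial>lborel) =
    of_nat (piece_count sh) * (\<integral>\<^sup>+x. \<integral>\<^sup>+y. Q (x\<^sup>2 + y\<^sup>2) * indicator {y. 0 \<le> y \<and> y \<le> x \<and> x \<le> c} y \<partial>lborel \<partial>lborel)"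
proof -
  define F1 where "F1 x y = Q (x\<^sup>2 + y\<^sup>2) * indicator {y. 0 \<le> y \<and> y \<le> x \<and> x \<le> c} y" for x y
  define F2 where "F2 x y = Q (x\<^sup>2 + y\<^sup>2) * indicator {y. y \<le> 0 \<and> - y \<le> x \<and> x \<le> c} y" for x y
  define F3 where "F3 x y = Q (x\<^sup>2 + y\<^sup>2) * indicator {y. 0 \<le> x \<and> x \<le> y \<and> y \<le> c} y" for x y
  define F4 where "F4 x y = Q (x\<^sup>2 + y\<^sup>2) * indicator {y. x \<le> 0 \<and> - x \<le> y \<and> y \<le> c} y" for x y
  have [measurable]: "case_prod F1 \<in> borel_measurable (borel \<Otimes>\<^sub>M borel)" "case_prod F2 \<in> borel_measurable (borel \<Otimes>\<^sub>M borel)"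
    "case_prod F3 \<in> borel_measurable (borel \<Otimes>\<^sub>M borel)" "case_prod F4 \<in> borel_measurable (borel \<Otimes>\<^sub>M borel)"
    unfolding F1_def F2_def F3_def F4_def by measurable
  let ?I = "\<lambda>F. \<integral>\<^sup>+x. \<integral>\<^sup>+y. F x y \<partial>lborel \<partial>(lborel :: real measure) :: ennreal"
  have I2: "?I F2 = ?I F1"
  proof (rule nn_integral_cong)
    fix x :: real
    have "(\<integral>\<^sup>+y. F2 x y \<partial>lborel) = ennreal \<bar>- 1\<bar> * (\<integral>\<^sup>+y. F2 x (0 + (- 1) * y) \<partial>lborel)"
      by (rule nn_integral_real_affine) simp_all
    also have "(\<integral>\<^sup>+y. F2 x (0 + (- 1) * y) \<partial>lborel) = (\<integral>\<^sup>+y. F1 x y \<partial>lborel)"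
      by (intro nn_integral_cong) (auto simp: F1_def F2_def split: split_indicator)
    finally show "(\<integral>\<^sup>+y. F2 x y \<partial>lborel) = (\<integral>\<^sup>+y. F1 x y \<partial>lborel)" by simp
  qed
  have I3: "?I F3 = ?I F1"
  proof -
    have "?I F3 = (\<integral>\<^sup>+y. \<integral>\<^sup>+x. F3 x y \<partial>lborel \<partial>lborel)" by (rule lborel_pair.Fubini') simp
    also have "\<dots> = ?I F1"
      by (intro nn_integral_cong) (auto simp: F1_def F3_def add.commute split: split_indicator)
    finally show ?thesis .
  qed
  have I4: "?I F4 = ?I F2"
  proof -
    have "?I F4 = (\<integral>\<^sup>+y. \<integral>\<^sup>+x. F4 x y \<partial>lborel \<partial>lborel)" by (rule lborel_pair.Fubini') simp
    also have "\<dots> = ?I F2"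
      by (intro nn_integral_cong) (auto simp: F2_def F4_def add.commute split: split_indicator)
    finally show ?thesis .
  qed
  have "?I (\<lambda>x y. Q (x\<^sup>2 + y\<^sup>2) * indicator (base_triangle sh c) (x, y)) = of_nat (piece_count sh) * ?I F1"
  proof (cases sh)
    case One_Leg
    then show ?thesis by (auto simp: F1_def indicator_def intro!: nn_integral_cong)
  next
    case Hypotenuse
    have "?I (\<lambda>x y. Q (x\<^sup>2 + y\<^sup>2) * indicator (base_triangle sh c) (x, y)) = ?I (\<lambda>x y. F1 x y + F2 x y)"
    proof (rule nn_integral_cong, rule nn_integral_cong_AE)
      show "AE y in lborel. Q (x\<^sup>2 + y\<^sup>2) * indicator (base_triangle sh c) (x, y) = F1 x y + F2 x y" for x
        using AE_lborel_singleton[of "0::real"]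
        by eventually_elim (auto simp: F1_def F2_def Hypotenuse split: split_indicator)
    qed
    also have "\<dots> = ?I F1 + ?I F2" by (simp add: nn_integral_add)
    finally show ?thesis by (simp add: I2 Hypotenuse mult_2)
  next
    case Two_Legs
    have "?I (\<lambda>x y. Q (x\<^sup>2 + y\<^sup>2) * indicator (base_triangle sh c) (x, y)) = ?I (\<lambda>x y. (F1 x y + F2 x y) + (F3 x y + F4 x y))"
    proof (rule nn_integral_cong_AE)
      show "AE x in lborel. (\<integral>\<^sup>+y. Q (x\<^sup>2 + y\<^sup>2) * indicator (base_triangle sh c) (x, y) \<partial>lborel) 
          = (\<integral>\<^sup>+y. (F1 x y + F2 x y) + (F3 x y + F4 x y) \<partial>lborel)"
        using AE_lborel_singleton[of "0::real"]
      proof eventually_elim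
        case (elim x)
        show ?case
        proof (rule nn_integral_cong_AE)
          show "AE y in lborel. Q (x\<^sup>2 + y\<^sup>2) * indicator (base_triangle sh c) (x, y) = (F1 x y + F2 x y) + (F3 x y + F4 x y)"
            using AE_lborel_singleton[of "0::real"] AE_lborel_singleton[of x]
            by eventually_elim (use elim in \<open>auto simp: F1_def F2_def F3_def F4_def Two_Legs split: split_indicator\<close>)
        qed
      qed
    qed
    also have "\<dots> = (?I F1 + ?I F2) + (?I F3 + ?I F4)" by (simp add: nn_integral_add)
    finally show ?thesis by (simp add: I2 I3 I4 Two_Legs mult_2[symmetric] mult.assoc[symmetric])
  qed
  then show ?thesis unfolding F1_def .
qed

lemma lessThan_4: "{..<4::nat} = {0, 1, 2, 3}"
  by auto

lemma horo_point_model_body: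
  "horo_point x y u \<in> simplex_body (model_normal sh c) \<longleftrightarrow> (x, y) \<in> base_triangle sh c \<and> 1 - (x\<^sup>2 + y\<^sup>2) \<le> exp (2 * u)"
proof -
  have s: "- (sqrt 2 / 2 * x) + sqrt 2 / 2 * y \<le> 0 \<longleftrightarrow> y \<le> x" "- (sqrt 2 / 2 * x) - sqrt 2 / 2 * y \<le> 0 \<longleftrightarrow> 0 \<le> x + y"
    "- (sqrt 2 * x) \<le> sqrt 2 * y \<longleftrightarrow> 0 \<le> x + y"
  proof -
    have "- (sqrt 2 / 2 * x) + sqrt 2 / 2 * y = sqrt 2 / 2 * (y - x)" "- (sqrt 2 / 2 * x) - sqrt 2 / 2 * y = - (sqrt 2 / 2 * (x + y))"
      "sqrt 2 * y - - (sqrt 2 * x) = sqrt 2 * (x + y)"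
      by (simp_all add: algebra_simps)
    then have "- (sqrt 2 / 2 * x) + sqrt 2 / 2 * y \<le> 0 \<longleftrightarrow> sqrt 2 / 2 * (y - x) \<le> 0"
      "- (sqrt 2 / 2 * x) - sqrt 2 / 2 * y \<le> 0 \<longleftrightarrow> - (sqrt 2 / 2 * (x + y)) \<le> 0"
      "- (sqrt 2 * x) \<le> sqrt 2 * y \<longleftrightarrow> 0 \<le> sqrt 2 * (x + y)"
      by (simp_all only:) (auto simp: algebra_simps)
    then show "- (sqrt 2 / 2 * x) + sqrt 2 / 2 * y \<le> 0 \<longleftrightarrow> y \<le> x" "- (sqrt 2 / 2 * x) - sqrt 2 / 2 * y \<le> 0 \<longleftrightarrow> 0 \<le> x + y"
       "- (sqrt 2 * x) \<le> sqrt 2 * y \<longleftrightarrow> 0 \<le> x + y"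
      by (simp_all only: mult_le_0_iff zero_le_mult_iff neg_le_0_iff_le) simp_all
  qed
  show ?thesis
    by (cases sh)
       (auto simp: simplex_body_def lessThan_4 model_normal_def horo_point_halfspace_plane horo_point_halfspace_unit_sphere s)
qed

lemma emeasure_model_body:
  "emeasure hyp_vol (simplex_body (model_normal sh c)) = of_nat (piece_count sh) * triangle_vol c"
proof -
  have body: "simplex_body (model_normal sh c) \<in> sets borel"
    by measurable
  have "emeasure hyp_vol (simplex_body (model_normal sh c)) =
    (\<integral>\<^sup>+x. \<integral>\<^sup>+y. column_vol (x\<^sup>2 + y\<^sup>2) * indicator (base_triangle sh c) (x, y) \<partial>lborel \<partial>lborel)"
    unfolding emeasure_hyp_vol_horo[OF body]
  proof (rule nn_integral_cong, rule nn_integral_cong)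
    fix x y :: real
    have "(\<integral>\<^sup>+u. ennreal (exp (- 2 * u)) * indicator (simplex_body (model_normal sh c)) (horo_point x y u) \<partial>lborel)
      = (\<integral>\<^sup>+u. (ennreal (exp (- 2 * u)) * indicator {u. 1 - (x\<^sup>2 + y\<^sup>2) \<le> exp (2 * u)} u) * indicator (base_triangle sh c) (x, y) \<partial>lborel)"
      by (intro nn_integral_cong) (auto simp: horo_point_model_body split: split_indicator)
    also have "\<dots> = column_vol (x\<^sup>2 + y\<^sup>2) * indicator (base_triangle sh c) (x, y)"
      unfolding nn_integral_column[symmetric] by (rule nn_integral_multc) measurable
    finally show "(\<integral>\<^sup>+u. ennreal (exp (- 2 * u)) * indicator (simplex_body (model_normal sh c)) (horo_point x y u) \<partial>lborel) =
        column_vol (x\<^sup>2 + y\<^sup>2) * indicator (base_triangle sh c) (x, y)" .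
  qed
  also have "\<dots> = of_nat (piece_count sh) * triangle_vol c"
    unfolding triangle_vol_def by (rule nn_integral_base_triangle) simp
  finally show ?thesis .
qed

lemma emeasure_right_triangle:
  assumes "0 \<le> c" "0 \<le> k"
  shows "(\<integral>\<^sup>+x. \<integral>\<^sup>+y. ennreal k * indicator {y. 0 \<le> y \<and> y \<le> x \<and> x \<le> c} y \<partial>lborel \<partial>(lborel :: real measure)) = ennreal (k * c\<^sup>2 / 2)"
proof -
  have "(\<integral>\<^sup>+x. \<integral>\<^sup>+y. ennreal k * indicator {y. 0 \<le> y \<and> y \<le> x \<and> x \<le> c} y \<partial>lborel \<partial>(lborel :: real measure))
    = (\<integral>\<^sup>+x. ennreal (k * x) * indicator {0..c} x \<partial>lborel)"
  proof (rule nn_integral_cong)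
    fix x :: real
    have "{y. 0 \<le> y \<and> y \<le> x \<and> x \<le> c} = (if x \<in> {0..c} then {0..x} else {})" by auto
    then show "(\<integral>\<^sup>+y. ennreal k * indicator {y. 0 \<le> y \<and> y \<le> x \<and> x \<le> c} y \<partial>(lborel :: real measure)) = ennreal (k * x) * indicator {0..c} x"
      using assms by (simp add: nn_integral_cmult ennreal_mult'')
  qed
  also have "\<dots> = ennreal (k * c\<^sup>2 / 2 - k * 0\<^sup>2 / 2)"
    by (rule nn_integral_FTC_Icc) (use assms in \<open>auto intro!: derivative_eq_intros\<close>)
  finally show ?thesis by simp
qed

text \<open>For s <= 1 the horoball lies above height 1, so the sphere does not cut it and the
  intersection is a prism over the base. Each copy of the triangle has area c^2 / 2 and every column
  has volume s^2 / 2.\<close>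

lemma emeasure_model_horoball:
  assumes c: "0 \<le> c" and s: "0 < s" "s \<le> 1"
  shows "emeasure hyp_vol ({x \<in> hyp3. - lor x cusp \<le> s} \<inter> simplex_body (model_normal sh c)) =
    ennreal (real (piece_count sh) * (s\<^sup>2 * c\<^sup>2 / 4))"
proof -
  let ?S = "{x \<in> hyp3. - lor x cusp \<le> s} \<inter> simplex_body (model_normal sh c)"
  have body: "?S \<in> sets borel"
    by measurable
  have "emeasure hyp_vol ?S =
    (\<integral>\<^sup>+x. \<integral>\<^sup>+y. (\<lambda>_. ennreal (s\<^sup>2 / 2)) (x\<^sup>2 + y\<^sup>2) * indicator (base_triangle sh c) (x, y) \<partial>lborel \<partial>lborel)"
    unfolding emeasure_hyp_vol_horo[OF body]
  proof (rule nn_integral_cong, rule nn_integral_cong)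
    fix x y :: real
    have mem: "horo_point x y u \<in> ?S \<longleftrightarrow> (x, y) \<in> base_triangle sh c \<and> - ln s \<le> u" for u
    proof -
      have "exp (- u) \<le> s \<longleftrightarrow> - ln s \<le> u"
        using ln_le_cancel_iff[of "exp (- u)" s] s by auto
      moreover have "1 - (x\<^sup>2 + y\<^sup>2) \<le> exp (2 * u)" if "- ln s \<le> u"
      proof -
        have "0 \<le> u" using that s by (intro order_trans[OF _ that]) (simp add: ln_le_zero_iff)
        then have "1 \<le> exp (2 * u)" by simp
        moreover have "0 \<le> x\<^sup>2 + y\<^sup>2" by simp
        ultimately show ?thesis by linarith
      qed
      ultimately show ?thesis by (auto simp: horo_point_model_body horo_point_hyp3 lor_horo_point_cusp)
    qed
    have "(\<integral>\<^sup>+u. ennreal (exp (- 2 * u)) * indicator ?S (horo_point x y u) \<partial>lborel)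
      = (\<integral>\<^sup>+u. (ennreal (exp (- 2 * u)) * indicator {- ln s..} u) * indicator (base_triangle sh c) (x, y) \<partial>lborel)"
      unfolding indicator_def mem by (intro nn_integral_cong) auto
    also have "\<dots> = ennreal (exp (- 2 * - ln s) / 2) * indicator (base_triangle sh c) (x, y)"
      unfolding nn_integral_exp_atLeast[symmetric] by (rule nn_integral_multc) measurable
    also have "exp (- 2 * - ln s) = s\<^sup>2" 
    proof -
      have "- 2 * - ln s = ln s + ln s" by simp
      then show ?thesis using s by (simp only: exp_add exp_ln power2_eq_square)
    qed
    finally show "(\<integral>\<^sup>+u. ennreal (exp (- 2 * u)) * indicator ?S (horo_point x y u) \<partial>lborel) =
        ennreal (s\<^sup>2 / 2) * indicator (base_triangle sh c) (x, y)" .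
  qed
  also have "\<dots> = of_nat (piece_count sh) * (\<integral>\<^sup>+x. \<integral>\<^sup>+y. ennreal (s\<^sup>2 / 2) * indicator {y. 0 \<le> y \<and> y \<le> x \<and> x \<le> c} y \<partial>lborel \<partial>(lborel :: real measure))"
    by (rule nn_integral_base_triangle) simp
  also have "\<dots> = of_nat (piece_count sh) * ennreal (s\<^sup>2 / 2 * c\<^sup>2 / 2)"
    by (subst emeasure_right_triangle) (use c in auto)
  also have "\<dots> = ennreal (real (piece_count sh) * (s\<^sup>2 * c\<^sup>2 / 4))"
    by (simp add: ennreal_of_nat_eq_real_of_nat ennreal_mult''[symmetric])
  finally show ?thesis .
qed

text \<open>The corners of the base triangle, in the order of the facets opposite to them; entry k -
  1 belongs to facet k.\<close>

primrec model_points :: "shape \<Rightarrow> real \<Rightarrow> (real \<times> real) list" where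
  "model_points One_Leg c = [(0, 0), (c, 0), (c, c)]"
| "model_points Hypotenuse c = [(c, - c), (0, 0), (c, c)]"
| "model_points Two_Legs c = [(- c, c), (c, c), (c, - c)]"

text \<open>Spans the ray of the point of the unit hemisphere over p; it is light-like exactly when
  p is on the unit circle.\<close>

definition base_point :: "real \<times> real \<Rightarrow> lorentz" where
  "base_point p = (1, vector [fst p, snd p, 0])"

text \<open>A finite vertex is normalised to the hyperboloid; an ideal one cannot be and keeps the
  factor 1.\<close>

definition vertex_over :: "real \<times> real \<Rightarrow> lorentz" where
  "vertex_over p = (if (fst p)\<^sup>2 + (snd p)\<^sup>2 = 1 then 1 else 1 / sqrt (1 - (fst p)\<^sup>2 - (snd p)\<^sup>2)) *\<^sub>R base_point p"

definition model_vertex :: "shape \<Rightarrow> real \<Rightarrow> nat \<Rightarrow> lorentz" where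
  "model_vertex sh c i = (cusp # map vertex_over (model_points sh c)) ! i"

lemma lor_base_point: 
  "lor (base_point p) (plane a b c) = a * fst p + b * snd p - c"
  "lor (base_point p) unit_sphere = 0"
  "lor (base_point p) (base_point p) = (fst p)\<^sup>2 + (snd p)\<^sup>2 - 1"
  "lor cusp (base_point p) = - 1"
  by (simp_all add: base_point_def plane_def unit_sphere_def cusp_def lor_vector power2_eq_square)

lemma lor_cusp: "lor cusp (plane a b c) = 0" "lor cusp unit_sphere = - 1" "ideal cusp"
  by (simp_all add: plane_def unit_sphere_def cusp_def lor_vector ideal_def)

lemma lor_plane: "lor (plane a b c) (plane a' b' c') = a * a' + b * b'" "lor unit_sphere (plane a b c) = - c"
  "lor (plane a b c) unit_sphere = - c" "lor unit_sphere unit_sphere = 1"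
  by (simp_all add: plane_def unit_sphere_def lor_vector)

lemma vertex_over_causal:
  assumes "(fst p)\<^sup>2 + (snd p)\<^sup>2 \<le> 1"
  obtains r where "0 < r" "vertex_over p = r *\<^sub>R base_point p" "vertex_over p \<in> hyp3 \<or> ideal (vertex_over p)"
    "ideal (vertex_over p) \<longleftrightarrow> (fst p)\<^sup>2 + (snd p)\<^sup>2 = 1"
proof (cases "(fst p)\<^sup>2 + (snd p)\<^sup>2 = 1")
  case True
  then have "ideal (vertex_over p)" by (simp add: vertex_over_def ideal_def lor_base_point) (simp add: base_point_def)
  then show ?thesis using True by (intro that[of 1]) (auto simp: vertex_over_def)
next
  case False
  define q where "q = 1 - (fst p)\<^sup>2 - (snd p)\<^sup>2"
  have q: "0 < q" using False assms by (simp add: q_def)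
  have eq: "vertex_over p = (1 / sqrt q) *\<^sub>R base_point p" using False by (simp add: vertex_over_def q_def)
  have "lor (vertex_over p) (vertex_over p) = (1 / sqrt q) * (1 / sqrt q) * (- q)"
    unfolding eq lor_scaleR_left lor_scaleR_right lor_base_point by (simp add: q_def)
  also have "\<dots> = -1" using q by simp
  finally have l: "lor (vertex_over p) (vertex_over p) = -1" .
  moreover have "0 < fst (vertex_over p)" unfolding eq using q by (simp add: base_point_def)
  ultimately show ?thesis using q eq False
    by (intro that[of "1 / sqrt q"]) (auto simp: hyp3_def ideal_def)
qed

lemma lor_isometryD: "lor_isometry L \<Longrightarrow> lor (L x) (L y) = lor x y"
  unfolding lor_isometry_def by blast

lemma all_less_4: "(\<forall>i<4::nat. P i) \<longleftrightarrow> P 0 \<and> P 1 \<and> P 2 \<and> P 3"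
proof -
  have "(\<forall>i<4::nat. P i) \<longleftrightarrow> (\<forall>i\<in>{..<4}. P i)" by auto
  then show ?thesis by (simp add: lessThan_4)
qed

definition vertex_scale :: "real \<times> real \<Rightarrow> real" where
  "vertex_scale p = (if (fst p)\<^sup>2 + (snd p)\<^sup>2 = 1 then 1 else 1 / sqrt (1 - (fst p)\<^sup>2 - (snd p)\<^sup>2))"

lemma lor_vertex_over: "lor (vertex_over p) x = vertex_scale p * lor (base_point p) x"
  "lor x (vertex_over p) = vertex_scale p * lor x (base_point p)"
  by (simp_all add: vertex_over_def vertex_scale_def lor_scaleR_left lor_scaleR_right)

lemma vertex_scale_pos: "(fst p)\<^sup>2 + (snd p)\<^sup>2 \<le> 1 \<Longrightarrow> 0 < vertex_scale p"
  by (auto simp: vertex_scale_def)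

lemma model_point_norm:
  assumes "2 * c\<^sup>2 \<le> 1" "p \<in> set (model_points sh c)"
  shows "(fst p)\<^sup>2 + (snd p)\<^sup>2 \<le> 1"
proof -
  have "0 \<le> c\<^sup>2" by simp
  with assms show ?thesis by (cases sh) auto
qed

lemma model_simplex:
  assumes c: "0 < c" "2 * c\<^sup>2 \<le> 1"
  shows "hyp_simplex (model_vertex sh c) (model_normal sh c)"
proof -
  have pos: "0 < vertex_scale p" and causal: "vertex_over p \<in> hyp3 \<or> ideal (vertex_over p)"
    if "p \<in> set (model_points sh c)" for p
    using vertex_scale_pos[of p] vertex_over_causal[of p] model_point_norm[OF c(2) that] by blast+
  have cc: "0 < sqrt 2 * c" using c by simp
  show ?thesis
    using pos causal c cc unfolding hyp_simplex_def all_less_4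
    by (cases sh)
       (auto simp: model_vertex_def model_normal_def lor_cusp lor_base_point lor_plane lor_vertex_over
          mult_less_0_iff power_divide algebra_simps)
qed

text \<open>\<open>\<sigma>\<close> numbers the facets in such a way that vertex \<open>\<sigma> 0\<close> goes to \<open>\<infinity>\<close>.\<close>

definition model_frame :: "shape \<Rightarrow> real \<Rightarrow> (nat \<Rightarrow> nat) \<Rightarrow> (nat \<Rightarrow> lorentz) \<Rightarrow> bool" where
  "model_frame sh c \<sigma> e \<longleftrightarrow> bij_betw \<sigma> {..<4} {..<4} \<and>
     (\<forall>i<4. \<forall>j<4. lor (e (\<sigma> i)) (e (\<sigma> j)) = lor (model_normal sh c i) (model_normal sh c j))"

lemma hyp_simplex_permute:
  assumes "hyp_simplex v e" and \<sigma>: "bij_betw \<sigma> {..<4} {..<4}"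
  shows "hyp_simplex (v \<circ> \<sigma>) (e \<circ> \<sigma>)"
proof -
  have "\<sigma> i < 4" if "i < 4" for i using bij_betwE[OF \<sigma>] that by auto
  moreover have "\<sigma> i \<noteq> \<sigma> j" if "i < 4" "j < 4" "i \<noteq> j" for i j
    using \<sigma> that by (auto simp: bij_betw_def inj_on_eq_iff)
  ultimately show ?thesis using assms(1) by (auto simp: hyp_simplex_def)
qed

lemma simplex_body_permute:
  assumes "bij_betw \<sigma> {..<4} {..<4}"
  shows "simplex_body (e \<circ> \<sigma>) = simplex_body e"
proof -
  have "simplex_body (e \<circ> \<sigma>) = (\<Inter>i\<in>\<sigma> ` {..<4}. halfspace (e i))"
    unfolding simplex_body_def image_image comp_def ..
  then show ?thesis using assms by (simp only: bij_betw_def simplex_body_def)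
qed

lemma model_frame_isometry:
  assumes s: "hyp_simplex v e" and f: "model_frame sh c \<sigma> e" and c: "0 < c" "2 * c\<^sup>2 \<le> 1"
  obtains L where "lor_isometry L" "\<And>x. lor x x < 0 \<Longrightarrow> 0 < fst (L x) \<longleftrightarrow> 0 < fst x"
    "\<And>i. i < 4 \<Longrightarrow> L (model_normal sh c i) = e (\<sigma> i)"
    "\<And>i. i < 4 \<Longrightarrow> \<exists>r>0. v (\<sigma> i) = r *\<^sub>R L (model_vertex sh c i)"
    "L -` simplex_body e = simplex_body (model_normal sh c)"
proof -
  have \<sigma>: "bij_betw \<sigma> {..<4} {..<4}"
    and g: "\<And>i j. i < 4 \<Longrightarrow> j < 4 \<Longrightarrow> lor ((e \<circ> \<sigma>) i) ((e \<circ> \<sigma>) j) = lor (model_normal sh c i) (model_normal sh c j)"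
    using f by (auto simp: model_frame_def)
  show ?thesis
  proof (rule hyp_simplex_congruence[OF model_simplex[OF c] hyp_simplex_permute[OF s \<sigma>] g])
    fix L
    assume L: "lor_isometry L" "\<And>i. i < 4 \<Longrightarrow> L (model_normal sh c i) = (e \<circ> \<sigma>) i"
      "\<And>i. i < 4 \<Longrightarrow> \<exists>r>0. (v \<circ> \<sigma>) i = r *\<^sub>R L (model_vertex sh c i)"
      "\<And>x. lor x x < 0 \<Longrightarrow> 0 < fst (L x) \<longleftrightarrow> 0 < fst x"
    have "L -` simplex_body (e \<circ> \<sigma>) = simplex_body (model_normal sh c)"
      by (rule simplex_body_vimage[OF L(1,4,2)])
    then show thesis using L by (intro that[of L]) (auto simp: simplex_body_permute[OF \<sigma>])
  qed
qed

lemma emeasure_frame_body: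
  assumes "hyp_simplex v e" "model_frame sh c \<sigma> e" "0 < c" "2 * c\<^sup>2 \<le> 1"
  shows "emeasure hyp_vol (simplex_body e) = of_nat (piece_count sh) * triangle_vol c"
proof -
  obtain L where L: "lor_isometry L" "\<And>x. lor x x < 0 \<Longrightarrow> 0 < fst (L x) \<longleftrightarrow> 0 < fst x"
    "L -` simplex_body e = simplex_body (model_normal sh c)"
    using model_frame_isometry[OF assms] by metis
  have "emeasure hyp_vol (simplex_body e) = emeasure hyp_vol (L -` simplex_body e)"
    by (rule emeasure_hyp_vol_isometry[symmetric, OF L(1,2)]) measurable
  then show ?thesis by (simp add: L(3) emeasure_model_body)
qed

lemma model_0: "model_vertex sh c 0 = cusp" "model_normal sh c 0 = unit_sphere"
  by (cases sh; simp add: model_vertex_def model_normal_def)+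

text \<open>The vertex is \<open>p\<close> times the image of \<open>cusp\<close>, because
  \<open>cusp\<close> has product -1 with the unit sphere. So \<open>s\<close> is the radius
  relative to the horoball touching the opposite facet, however the vertex is scaled.\<close>

lemma emeasure_frame_horoball:
  assumes A: "hyp_simplex v e" "model_frame sh c \<sigma> e" "0 < c" "2 * c\<^sup>2 \<le> 1" and s: "0 < s" "s \<le> 1"
  defines "p \<equiv> - lor (v (\<sigma> 0)) (e (\<sigma> 0))"
  shows "emeasure hyp_vol ({x \<in> hyp3. - lor x (v (\<sigma> 0)) \<le> s * p} \<inter> simplex_body e) =
    ennreal (real (piece_count sh) * (s\<^sup>2 * c\<^sup>2 / 4))"
proof -
  obtain L where L: "lor_isometry L" "\<And>x. lor x x < 0 \<Longrightarrow> 0 < fst (L x) \<longleftrightarrow> 0 < fst x"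
    "\<And>i. i < 4 \<Longrightarrow> L (model_normal sh c i) = e (\<sigma> i)"
    "\<And>i. i < 4 \<Longrightarrow> \<exists>r>0. v (\<sigma> i) = r *\<^sub>R L (model_vertex sh c i)"
    "L -` simplex_body e = simplex_body (model_normal sh c)"
    using model_frame_isometry[OF A] by blast
  have iso: "lor (L x) (L y) = lor x y" for x y by (rule lor_isometryD[OF L(1)])
  obtain r where r: "0 < r" "v (\<sigma> 0) = r *\<^sub>R L cusp" using L(4)[of 0] by (auto simp: model_0)
  have p: "p = r"
    using iso[of cusp unit_sphere] L(3)[of 0] by (simp add: p_def r lor_scaleR_left lor_cusp model_0)
  have "x \<in> L -` {x \<in> hyp3. - lor x (v (\<sigma> 0)) \<le> s * p} \<longleftrightarrow> x \<in> {x \<in> hyp3. - lor x cusp \<le> s}" for x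
  proof -
    have "- lor (L x) (v (\<sigma> 0)) \<le> s * p \<longleftrightarrow> r * - lor x cusp \<le> r * s"
      by (simp add: r p lor_scaleR_right iso mult.commute)
    also have "\<dots> \<longleftrightarrow> - lor x cusp \<le> s" using r by (simp only: mult_le_cancel_left_pos)
    finally show ?thesis using future_isometry_hyp3[OF L(1,2)] by auto
  qed
  then have v: "L -` ({x \<in> hyp3. - lor x (v (\<sigma> 0)) \<le> s * p} \<inter> simplex_body e) =
      {x \<in> hyp3. - lor x cusp \<le> s} \<inter> simplex_body (model_normal sh c)"
    using L(5) by blast
  have "emeasure hyp_vol ({x \<in> hyp3. - lor x (v (\<sigma> 0)) \<le> s * p} \<inter> simplex_body e) =
     emeasure hyp_vol (L -` ({x \<in> hyp3. - lor x (v (\<sigma> 0)) \<le> s * p} \<inter> simplex_body e))"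
    by (rule emeasure_hyp_vol_isometry[symmetric, OF L(1,2)]) measurable
  also have "\<dots> = ennreal (real (piece_count sh) * (s\<^sup>2 * c\<^sup>2 / 4))"
    unfolding v by (rule emeasure_model_horoball) (use A s in auto)
  finally show ?thesis .
qed

text \<open>The Euclidean distance in the base plane from corner k of the triangle to side k, for k
  = 1, 2, 3.\<close>

definition facet_distance :: "shape \<Rightarrow> real \<Rightarrow> nat \<Rightarrow> real" where
  "facet_distance sh c k = - lor (base_point (model_points sh c ! (k - 1))) (model_normal sh c k)"

lemma facet_distance_simps [simp]:
  "facet_distance One_Leg c (Suc 0) = c" "facet_distance One_Leg c 2 = c * sqrt 2 / 2" "facet_distance One_Leg c 3 = c"
  "facet_distance Hypotenuse c (Suc 0) = c * sqrt 2" "facet_distance Hypotenuse c 2 = c" "facet_distance Hypotenuse c 3 = c * sqrt 2"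
  "facet_distance Two_Legs c (Suc 0) = 2 * c" "facet_distance Two_Legs c 2 = c * sqrt 2" "facet_distance Two_Legs c 3 = 2 * c"
  by (simp_all add: facet_distance_def model_normal_def lor_base_point)

text \<open>Both sides of the product formula scale alike in each vertex, so it can be read off in
  the model, where \<open>cusp\<close> has product -1 both with the unit sphere and with every
  \<open>base_point\<close>. It turns disjointness of two horoballs into a condition on the
  normalised radii and one Euclidean length.\<close>

lemma frame_vertex_product:
  assumes A: "hyp_simplex v e" "model_frame sh c \<sigma> e" "0 < c" "2 * c\<^sup>2 \<le> 1" and k: "0 < k" "k < 4"
  shows "lor (v (\<sigma> 0)) (v (\<sigma> k)) * facet_distance sh c k = - (lor (v (\<sigma> 0)) (e (\<sigma> 0)) * lor (v (\<sigma> k)) (e (\<sigma> k)))"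
    and "ideal (v (\<sigma> k)) \<longleftrightarrow> (fst (model_points sh c ! (k - 1)))\<^sup>2 + (snd (model_points sh c ! (k - 1)))\<^sup>2 = 1"
    and "ideal (v (\<sigma> 0))"
proof -
  obtain L where L: "lor_isometry L"
    "\<And>i. i < 4 \<Longrightarrow> L (model_normal sh c i) = e (\<sigma> i)"
    "\<And>i. i < 4 \<Longrightarrow> \<exists>r>0. v (\<sigma> i) = r *\<^sub>R L (model_vertex sh c i)"
    using model_frame_isometry[OF A] by metis
  have iso: "lor (L x) (L y) = lor x y" for x y by (rule lor_isometryD[OF L(1)])
  obtain r where r: "0 < r" "v (\<sigma> 0) = r *\<^sub>R L cusp" using L(3)[of 0] by (auto simp: model_0)
  obtain t where t: "0 < t" "v (\<sigma> k) = t *\<^sub>R L (model_vertex sh c k)" using L(3)[OF k(2)] by auto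
  let ?p = "model_points sh c ! (k - 1)"
  have len: "length (model_points sh c) = 3" by (cases sh) auto
  have vk: "model_vertex sh c k = vertex_over ?p" using k len by (simp add: model_vertex_def nth_Cons')
  have "lor (v (\<sigma> 0)) (v (\<sigma> k)) = - (r * t * vertex_scale ?p)"
    by (simp add: r t lor_scaleR_left lor_scaleR_right iso vk lor_vertex_over lor_base_point)
  moreover have "lor (v (\<sigma> 0)) (e (\<sigma> 0)) = - r"
    using iso[of cusp unit_sphere] L(2)[of 0] by (simp add: r lor_scaleR_left lor_cusp model_0)
  moreover have "lor (v (\<sigma> k)) (e (\<sigma> k)) = - (t * vertex_scale ?p * facet_distance sh c k)"
    using iso[of "vertex_over ?p" "model_normal sh c k"] L(2)[OF k(2)]
    by (simp add: t lor_scaleR_left vk lor_vertex_over facet_distance_def)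
  ultimately show "lor (v (\<sigma> 0)) (v (\<sigma> k)) * facet_distance sh c k = - (lor (v (\<sigma> 0)) (e (\<sigma> 0)) * lor (v (\<sigma> k)) (e (\<sigma> k)))"
    by simp
  have \<sigma>4: "\<sigma> i < 4" if "i < 4" for i using A(2) that by (auto simp: model_frame_def dest: bij_betwE)
  have id_iff: "ideal (v i) \<longleftrightarrow> lor (v i) (v i) = 0" if "i < 4" for i
    using hyp_simplexD(1)[OF A(1) that] by (auto simp: hyp3_def ideal_def)
  show "ideal (v (\<sigma> 0))" using id_iff[OF \<sigma>4[of 0]] lor_cusp(3) by (simp add: r lor_scaleR_left lor_scaleR_right iso ideal_def)
  have "?p \<in> set (model_points sh c)" using k len by (intro nth_mem) auto
  then have sc: "0 < vertex_scale ?p" using vertex_scale_pos model_point_norm[OF A(4)] by blast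
  have "ideal (v (\<sigma> k)) \<longleftrightarrow> lor (vertex_over ?p) (vertex_over ?p) = 0"
    using id_iff[OF \<sigma>4[OF k(2)]] t by (simp add: t lor_scaleR_left lor_scaleR_right iso vk)
  also have "\<dots> \<longleftrightarrow> (fst ?p)\<^sup>2 + (snd ?p)\<^sup>2 = 1"
    using sc by (simp add: lor_vertex_over lor_base_point)
  finally show "ideal (v (\<sigma> k)) \<longleftrightarrow> (fst ?p)\<^sup>2 + (snd ?p)\<^sup>2 = 1" .
qed

lemma ideal_vertices_neg:
  assumes s: "hyp_simplex v e" and "i \<in> ideal_vertices v" "j \<in> ideal_vertices v" "i \<noteq> j"
  shows "lor (v i) (v j) < 0"
proof -
  have ij: "i < 4" "j < 4" "ideal (v i)" "ideal (v j)" using assms by (auto simp: ideal_vertices_def)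
  have "lor (v i) (v j) \<noteq> 0"
  proof
    assume "lor (v i) (v j) = 0"
    then obtain c where "v j = c *\<^sub>R v i" using ideal_parallel ij by metis
    then have "lor (v j) (e j) = 0" using hyp_simplexD(4)[OF s ij(1,2)] assms(4) by (simp add: lor_scaleR_left)
    then show False using hyp_simplexD(3)[OF s ij(2)] by simp
  qed
  then show ?thesis using lor_ideal_ideal_le[OF ij(3,4)] by simp
qed

lemma subset_hyp_interior:
  assumes "x \<in> hyp3" "- lor x v < s"
  shows "x \<in> hyp_interior {x \<in> hyp3. - lor x v \<le> s}"
proof -
  have "{x \<in> hyp3. lor x (- v) < s} \<subseteq> hyp_interior {x \<in> hyp3. - lor x v \<le> s}"
    by (rule interior_of_maximal[OF _ open_lor_less]) (auto simp: lor_minus_right)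
  then show ?thesis using assms by (auto simp: lor_minus_right)
qed

text \<open>Everything the upper bound takes from a packing: tangency to the opposite facet is the
  limit for a single radius, and \<open>horoballs_overlap\<close> limits the products in
  pairs.\<close>

lemma packing_radii:
  assumes s: "hyp_simplex v e" and pack: "horoball_packing v e B b"
  obtains s where "\<And>i. i \<in> ideal_vertices v \<Longrightarrow> 0 < s i \<and> s i \<le> 1"
    "\<And>i. i \<in> ideal_vertices v \<Longrightarrow> b i = {x \<in> hyp3. - lor x (v i) \<le> s i * - lor (v i) (e i)}"
    "\<And>i j. i \<in> ideal_vertices v \<Longrightarrow> j \<in> ideal_vertices v \<Longrightarrow> i \<noteq> j \<Longrightarrow>
       2 * (s i * - lor (v i) (e i)) * (s j * - lor (v j) (e j)) \<le> - lor (v i) (v j)"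
proof -
  have ex: "\<exists>r. 0 < r \<and> b i = {x \<in> hyp3. - lor x (v i) \<le> r}" if "i \<in> ideal_vertices v" for i
  proof -
    have "horoball_at (v i) (b i)" using pack that unfolding horoball_packing_def by blast
    then show ?thesis unfolding horoball_at_def by blast
  qed
  define t where "t i = (SOME r. 0 < r \<and> b i = {x \<in> hyp3. - lor x (v i) \<le> r})" for i
  have t: "0 < t i" "b i = {x \<in> hyp3. - lor x (v i) \<le> t i}" if "i \<in> ideal_vertices v" for i
    using someI_ex[OF ex[OF that]] unfolding t_def by simp_all
  have i: "i < 4" "ideal (v i)" if "i \<in> ideal_vertices v" for i using that by (auto simp: ideal_vertices_def)
  have p: "0 < - lor (v i) (e i)" if "i \<in> ideal_vertices v" for i using hyp_simplexD(3)[OF s i(1)[OF that]] by simp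
  have tp: "t i \<le> - lor (v i) (e i)" if "i \<in> ideal_vertices v" for i
  proof -
    have "b i \<subseteq> halfspace (e i)" using pack that unfolding horoball_packing_def by blast
    then show ?thesis unfolding t(2)[OF that]
      by (rule horoball_subset_halfspace_conv[OF i(2)[OF that] hyp_simplexD(2,3)[OF s i(1)[OF that]] t(1)[OF that]])
  qed
  define s where "s i = t i / - lor (v i) (e i)" for i
  have st: "s i * - lor (v i) (e i) = t i" if "i \<in> ideal_vertices v" for i
    using p[OF that] by (simp add: s_def)
  have disj: "2 * t i * t j \<le> - lor (v i) (v j)" if ij: "i \<in> ideal_vertices v" "j \<in> ideal_vertices v" "i \<noteq> j" for i j
  proof (rule ccontr)
    assume "\<not> 2 * t i * t j \<le> - lor (v i) (v j)"
    then have "- lor (v i) (v j) < 2 * (t i * t j)" by simp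
    then obtain x where x: "x \<in> hyp3" "- lor x (v i) < t i" "- lor x (v j) < t j"
      using horoballs_overlap[OF i(2)[OF ij(1)] i(2)[OF ij(2)] t(1)[OF ij(1)] t(1)[OF ij(2)] _ ideal_vertices_neg[OF s ij]]
      by blast
    then have "x \<in> hyp_interior (b i) \<inter> hyp_interior (b j)"
      unfolding t(2)[OF ij(1)] t(2)[OF ij(2)] using subset_hyp_interior by blast
    moreover have "b i \<noteq> b j"
      unfolding t(2)[OF ij(1)] t(2)[OF ij(2)]
      by (rule horoball_neq[OF i(2)[OF ij(1)] i(2)[OF ij(2)] ideal_vertices_neg[OF s ij] t(1)[OF ij(1)] t(1)[OF ij(2)]])
    moreover have "b i \<in> B" "b j \<in> B" using pack ij unfolding horoball_packing_def by blast+
    ultimately show False using pack unfolding horoball_packing_def pairwise_def by blast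
  qed
  show ?thesis
  proof (rule that[of s])
    show "0 < s i \<and> s i \<le> 1" if "i \<in> ideal_vertices v" for i
      using t(1)[OF that] p[OF that] tp[OF that] by (simp only: s_def divide_pos_pos divide_le_eq_1_pos)
    show "b i = {x \<in> hyp3. - lor x (v i) \<le> s i * - lor (v i) (e i)}" if "i \<in> ideal_vertices v" for i
      unfolding st[OF that] by (rule t(2)[OF that])
    show "2 * (s i * - lor (v i) (e i)) * (s j * - lor (v j) (e j)) \<le> - lor (v i) (v j)"
      if "i \<in> ideal_vertices v" "j \<in> ideal_vertices v" "i \<noteq> j" for i j
      unfolding st[OF that(1)] st[OF that(2)] by (rule disj[OF that])
  qed
qed

section \<open>Packings from lattice vectors\<close>

lemma lor_reflection:
  assumes "lor e e = 1"
  shows "lor (reflection e x) (reflection e y) = lor x y"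
  using assms by (simp add: reflection_def lor_linear lor_sym[of e y])

lemma reflection_reflection:
  assumes "lor e e = 1"
  shows "reflection e (reflection e x) = x"
  using assms by (simp add: reflection_def lor_linear algebra_simps)

lemma reflection_hyp3:
  assumes e: "lor e e = 1" and x: "x \<in> hyp3"
  shows "reflection e x \<in> hyp3"
proof (rule hyp3I[OF x])
  show "lor (reflection e x) (reflection e x) = -1" using x by (simp add: lor_reflection[OF e] hyp3_def)
  have "lor x (reflection e x) = - 1 - 2 * (lor x e)\<^sup>2"
    using x by (simp add: reflection_def lor_linear hyp3_def power2_eq_square)
  moreover have "0 \<le> (lor x e)\<^sup>2" by simp
  ultimately show "lor x (reflection e x) < 0" by linarith
qed

lemma reflection_ideal:
  assumes e: "lor e e = 1" and w: "ideal w"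
  shows "ideal (reflection e w)"
proof -
  define o' :: lorentz where "o' = (1, 0)"
  have o': "o' \<in> hyp3" by (simp add: o'_def hyp3_def lor_def)
  have "lor (reflection e o') (reflection e w) < 0"
    using lor_hyp3_ideal[OF o' w] by (simp add: lor_reflection[OF e])
  moreover have "lor (reflection e w) (reflection e w) = 0" using w by (simp add: lor_reflection[OF e] ideal_def)
  ultimately show ?thesis
    using causal_future[of "reflection e o'" "reflection e w"] reflection_hyp3[OF e o']
    by (simp add: ideal_def hyp3_def)
qed

definition unit_horoball :: "lorentz \<Rightarrow> lorentz set" where
  "unit_horoball w = {x \<in> hyp3. - lor x w \<le> 1}"

lemma reflection_unit_horoball:
  assumes e: "lor e e = 1"
  shows "reflection e ` unit_horoball w = unit_horoball (reflection e w)"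
proof -
  have "reflection e ` unit_horoball w \<subseteq> unit_horoball (reflection e w)" for w
    by (auto simp: unit_horoball_def reflection_hyp3[OF e] lor_reflection[OF e])
  note sub = this
  have "unit_horoball (reflection e w) \<subseteq> reflection e ` unit_horoball w"
  proof
    fix x assume "x \<in> unit_horoball (reflection e w)"
    then have "reflection e x \<in> unit_horoball w" using sub[of "reflection e w"] reflection_reflection[OF e] by auto
    then show "x \<in> reflection e ` unit_horoball w" using reflection_reflection[OF e] by (metis imageI)
  qed
  with sub show ?thesis by blast
qed

lemma hyp_interior_subset: "hyp_interior S \<subseteq> S \<inter> hyp3"
  using interior_of_subset[of "top_of_set hyp3" S] interior_of_subset_topspace[of "top_of_set hyp3" S] by auto

text \<open>A point with height exactly 1 leaves the horoball when moved along -w: x - t w has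
  unchanged product with w, and normalising it by c > 1 raises the height.\<close>

lemma interior_unit_horoball_less:
  assumes w: "ideal w" and x: "x \<in> hyp_interior (unit_horoball w)"
  shows "- lor x w < 1"
proof (rule ccontr)
  have h: "x \<in> hyp3" and "- lor x w \<le> 1" using x hyp_interior_subset by (auto simp: unit_horoball_def)
  moreover assume "\<not> - lor x w < 1"
  ultimately have xw: "lor x w = - 1" by simp
  have "x \<notin> hyp_interior (unit_horoball w)"
  proof (rule not_interior_lor[OF h, of "- w"])
    fix r :: real assume r: "0 < r"
    have "((\<lambda>t. 1 / sqrt (1 - 2 * t)) \<longlongrightarrow> 1 / sqrt (1 - 2 * 0)) (at_right (0::real))"
      by (intro tendsto_intros) auto
    then have "\<forall>\<^sub>F t in at_right (0::real). dist (1 / sqrt (1 - 2 * t)) 1 < r" using tendstoD r by fastforce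
    moreover have "\<forall>\<^sub>F t in at_right (0::real). t \<in> {0<..<min r (1/2)}"
      by (rule eventually_at_right_real) (use r in auto)
    ultimately have "\<forall>\<^sub>F t in at_right (0::real). dist (1 / sqrt (1 - 2 * t)) 1 < r \<and> t \<in> {0<..<min r (1/2)}"
      by (rule eventually_conj)
    then obtain t :: real where t: "dist (1 / sqrt (1 - 2 * t)) 1 < r" "0 < t" "t < r" "t < 1/2"
      using eventually_happens[of _ "at_right (0::real)"] by fastforce
    define c where "c = 1 / sqrt (1 - 2 * t)"
    have q: "0 < 1 - 2 * t" "1 - 2 * t < 1" using t by auto
    have c: "0 < c" "1 < c" using q by (auto simp: c_def)
    have c2: "c * c * (1 - 2 * t) = 1" using q by (simp add: c_def)
    define y where "y = c *\<^sub>R (x + t *\<^sub>R - w)"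
    have "lor y y = - (c * c * (1 - 2 * t))"
      using h w by (simp add: y_def lor_linear xw lor_sym[of w x] hyp3_def ideal_def algebra_simps)
    then have yy: "lor y y = -1" using c2 by simp
    have yw: "lor y w = - c" using w by (simp add: y_def lor_linear xw ideal_def)
    have "y \<in> hyp3" using hyp3I_ideal[OF w yy] yw c by simp
    moreover have "y \<notin> unit_horoball w" using yw c by (simp add: unit_horoball_def)
    ultimately show "\<exists>c>0. \<exists>t. 0 < t \<and> t < r \<and> c *\<^sub>R (x + t *\<^sub>R - w) \<in> hyp3 - unit_horoball w \<and> \<bar>c - 1\<bar> < r"
      using t c unfolding y_def by (intro exI[of _ c] exI[of _ t] conjI) (auto simp: c_def dist_real_def)
  qed
  then show False using x by simp
qed

text \<open>From a point on facet j an arbitrarily small move along the outward normal leaves the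
  simplex.\<close>

lemma interior_simplex_less:
  assumes e: "lor (e j) (e j) = 1" and j: "j < 4" and x: "x \<in> hyp_interior (simplex_body e)"
  shows "lor x (e j) < 0"
proof (rule ccontr)
  have h: "x \<in> hyp3" "x \<in> simplex_body e" using x hyp_interior_subset by auto
  then have "lor x (e j) \<le> 0" using j by (auto simp: simplex_body_def halfspace_def)
  moreover assume "\<not> lor x (e j) < 0"
  ultimately have xe: "lor x (e j) = 0" by simp
  have "x \<notin> hyp_interior (simplex_body e)"
  proof (rule not_interior_lor[OF h(1), of "e j"])
    fix r :: real assume r: "0 < r"
    have "((\<lambda>t. 1 / sqrt (1 - t\<^sup>2)) \<longlongrightarrow> 1 / sqrt (1 - 0\<^sup>2)) (at_right (0::real))"
      by (intro tendsto_intros) auto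
    then have "\<forall>\<^sub>F t in at_right (0::real). dist (1 / sqrt (1 - t\<^sup>2)) 1 < r" using tendstoD r by fastforce
    moreover have "\<forall>\<^sub>F t in at_right (0::real). t \<in> {0<..<min r 1}"
      by (rule eventually_at_right_real) (use r in auto)
    ultimately have "\<forall>\<^sub>F t in at_right (0::real). dist (1 / sqrt (1 - t\<^sup>2)) 1 < r \<and> t \<in> {0<..<min r 1}"
      by (rule eventually_conj)
    then obtain t :: real where t: "dist (1 / sqrt (1 - t\<^sup>2)) 1 < r" "0 < t" "t < r" "t < 1"
      using eventually_happens[of _ "at_right (0::real)"] by fastforce
    define c where "c = 1 / sqrt (1 - t\<^sup>2)"
    have q: "0 < 1 - t\<^sup>2" using t by (simp add: power_less_one_iff)
    have c: "0 < c" using q by (simp add: c_def)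
    have c2: "c * c * (1 - t\<^sup>2) = 1" using q by (simp add: c_def)
    define y where "y = c *\<^sub>R (x + t *\<^sub>R e j)"
    have "lor y y = - (c * c * (1 - t\<^sup>2))"
      using h e by (simp add: y_def lor_linear xe lor_sym[of "e j" x] hyp3_def power2_eq_square algebra_simps)
    then have yy: "lor y y = -1" using c2 by simp
    have "lor x y = - c" using h by (simp add: y_def lor_linear xe hyp3_def)
    then have "y \<in> hyp3" using hyp3I[OF h(1) yy] c by simp
    moreover have "lor y (e j) = c * t" using e by (simp add: y_def lor_linear xe)
    then have "y \<notin> simplex_body e" using c t j by (auto simp: simplex_body_def halfspace_def not_le intro!: bexI[of _ j])
    ultimately show "\<exists>c>0. \<exists>t. 0 < t \<and> t < r \<and> c *\<^sub>R (x + t *\<^sub>R e j) \<in> hyp3 - simplex_body e \<and> \<bar>c - 1\<bar> < r"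
      using t c unfolding y_def by (intro exI[of _ c] exI[of _ t] conjI) (auto simp: c_def dist_real_def)
  qed
  then show False using x by simp
qed

lemma open_simplex_interior:
  assumes x: "x \<in> hyp3" and neg: "\<And>j. j < 4 \<Longrightarrow> lor x (e j) < 0"
  shows "x \<in> hyp_interior (simplex_body e)"
proof -
  let ?U = "\<Inter>j\<in>{..<4}. {x \<in> hyp3. lor x (e j) < 0}"
  have "openin (top_of_set hyp3) ?U"
    by (rule openin_INT2) (auto simp: open_lor_less lessThan_empty_iff)
  moreover have "?U \<subseteq> simplex_body e" by (force simp: simplex_body_def halfspace_def)
  ultimately have "?U \<subseteq> hyp_interior (simplex_body e)" by (rule interior_of_maximal[rotated])
  moreover have "x \<in> ?U" using x neg by simp
  ultimately show ?thesis by blast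
qed

text \<open>Expanded in the vertices, w has nonnegative coefficients. Then 0 = lor w w is a sum of
  nonpositive terms, so all vanish; a vertex with nonzero coefficient is orthogonal to w, hence
  ideal and parallel to it.\<close>

lemma dominant_ideal_vertex:
  assumes s: "hyp_simplex v e" and w: "ideal w" and dom: "\<And>j. j < 4 \<Longrightarrow> lor w (e j) \<le> 0"
  obtains i c where "i \<in> ideal_vertices v" "0 < c" "w = c *\<^sub>R v i"
proof -
  note D = hyp_simplexD[OF s]
  define a where "a k = lor w (e k) / lor (v k) (e k)" for k
  have w_eq: "w = (\<Sum>k<4. a k *\<^sub>R v k)"
    unfolding a_def using D by (intro lor_dual_expansion) (auto simp: less_imp_neq)
  have a: "0 \<le> a k" if "k < 4" for k
    using dom[OF that] D(3)[OF that] by (auto simp: a_def intro: divide_nonpos_neg)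
  have causal: "lor w (v k) \<le> 0 \<and> (lor w (v k) = 0 \<longrightarrow> k \<in> ideal_vertices v)" if "k < 4" for k
  proof -
    have "v k \<in> hyp3 \<or> ideal (v k)" using D(1)[OF that] .
    then show ?thesis
      using lor_hyp3_ideal[OF _ w, of "v k"] lor_ideal_ideal_le[OF w, of "v k"] that
      by (auto simp: lor_sym[of w "v k"] ideal_vertices_def)
  qed
  have "0 = (\<Sum>k<4. a k * lor w (v k))"
    using w unfolding ideal_def by (subst (asm) (2) w_eq) (simp add: lor_sum_right lor_scaleR_right)
  then have "(\<Sum>k<4. - (a k * lor w (v k))) = 0" by (simp add: sum_negf)
  moreover have nn: "0 \<le> - (a k * lor w (v k))" if "k \<in> {..<4}" for k
    using a causal that by (auto intro: mult_nonneg_nonpos)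
  ultimately have z: "a k * lor w (v k) = 0" if "k < 4" for k
    using sum_nonneg_eq_0_iff[of "{..<4}" "\<lambda>k. - (a k * lor w (v k))"] that by auto
  have "\<exists>i<4. a i \<noteq> 0"
  proof (rule ccontr)
    assume "\<not> (\<exists>i<4. a i \<noteq> 0)"
    then have "w = 0" by (subst w_eq) simp
    with w show False by (simp add: ideal_def)
  qed
  then obtain i where i: "i < 4" "a i \<noteq> 0" by blast
  then have wi: "lor w (v i) = 0" using z by auto
  then have iv: "i \<in> ideal_vertices v" using causal[OF i(1)] by blast
  then have vi: "ideal (v i)" by (simp add: ideal_vertices_def)
  obtain c where "0 < c" "w = c *\<^sub>R v i"
    using ideal_parallel[OF vi w] wi by (metis lor_sym)
  with iv show ?thesis by (rule that)
qed

text \<open>The sum q of the vertices has negative product with every normal, and adding a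
  nonnegative multiple of the ideal vector keeps this. A small share of q therefore gives an inner
  point close to the vertex.\<close>

lemma simplex_point_near_vertex:
  assumes s: "hyp_simplex v e" and i: "i < 4" and u: "ideal u" and vi: "v i = t *\<^sub>R u" and t: "0 < t"
  obtains x where "x \<in> unit_horoball u" "x \<in> hyp_interior (simplex_body e)"
proof -
  note D = hyp_simplexD[OF s]
  define q where "q = (\<Sum>k<4. v k)"
  have qe: "lor q (e j) = lor (v j) (e j)" if "j < 4" for j
  proof -
    have "lor q (e j) = (\<Sum>k<4. if k = j then lor (v j) (e j) else 0)"
      unfolding q_def lor_sum_left using D that by (intro sum.cong) auto
    then show ?thesis using that by simp
  qed
  have ue: "lor u (e j) \<le> 0" if "j < 4" for j
  proof -
    have "lor (v i) (e j) \<le> 0" using D i that by (cases "i = j") (auto simp: less_imp_le)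
    then show ?thesis using t by (simp add: vi lor_scaleR_left mult_le_0_iff)
  qed
  obtain k where k: "k < 4" "k \<noteq> i" by (metis zero_less_numeral one_less_numeral_iff semiring_norm(76) zero_neq_one)
  have uv: "lor u (v l) \<le> 0" if "l < 4" for l
    using D(1)[OF that] lor_hyp3_ideal[OF _ u, of "v l"] lor_ideal_ideal_le[OF u, of "v l"] by (auto simp: lor_sym[of u])
  have "lor u (v k) \<noteq> 0"
  proof
    assume 0: "lor u (v k) = 0"
    then have "ideal (v k)" using D(1)[OF k(1)] lor_hyp3_ideal[OF _ u, of "v k"] by (auto simp: lor_sym[of u])
    then obtain c where "v k = c *\<^sub>R u" using ideal_parallel[OF u _ 0] by metis
    then have "t * lor (v k) (e k) = c * lor (v i) (e k)" by (simp add: vi lor_scaleR_left)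
    then show False using D(3)[OF k(1)] D(4)[OF i k(1)] k t by simp
  qed
  then have "lor u q < 0"
  proof -
    have "(\<Sum>l<4. lor u (v l)) = lor u (v k) + (\<Sum>l\<in>{..<4} - {k}. lor u (v l))"
      using k by (intro sum.remove) auto
    moreover have "(\<Sum>l\<in>{..<4} - {k}. lor u (v l)) \<le> 0" using uv by (intro sum_nonpos) auto
    moreover have "lor u (v k) < 0" using uv[OF k(1)] \<open>lor u (v k) \<noteq> 0\<close> by simp
    ultimately show ?thesis unfolding q_def lor_sum_right by linarith
  qed
  then obtain l where l: "lor u q = - l" "0 < l" by (metis add.inverse_inverse neg_less_0_iff_less)
  \<comment> \<open>The first bound keeps the height over \<open>u\<close> at most 1. The second
    keeps b^2 |lor q q| at most 1, so that the coefficient \<open>a\<close> which puts the point on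
    the hyperboloid is nonnegative.\<close>
  define b where "b = min (1 / l) (1 / (1 + \<bar>lor q q\<bar>))"
  have b: "0 < b" "b \<le> 1 / l" "b \<le> 1 / (1 + \<bar>lor q q\<bar>)" using l by (auto simp: b_def)
  have b1: "b \<le> 1"
    using b(3) by (rule order_trans) simp
  have "b * (1 + \<bar>lor q q\<bar>) \<le> 1" using b(3) by (simp add: pos_le_divide_eq)
  then have "b * \<bar>lor q q\<bar> < 1" using b by (simp add: distrib_left)
  then have "b * (b * \<bar>lor q q\<bar>) \<le> 1 * 1" using b b1 by (intro mult_mono) auto
  then have "\<bar>b * b * lor q q\<bar> \<le> 1" using b by (simp add: abs_mult mult.assoc)
  then have bq: "- 1 \<le> b * b * lor q q" by linarith
  define a where "a = (1 + b * b * lor q q) / (2 * b * l)"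
  have a: "0 \<le> a" using bq b l by (simp add: a_def)
  define x where "x = a *\<^sub>R u + b *\<^sub>R q"
  have "lor x x = - (2 * b * l) * a + b * b * lor q q"
    using u by (simp add: x_def lor_linear lor_sym[of q u] l ideal_def algebra_simps)
  also have "\<dots> = -1" using b l by (simp add: a_def)
  finally have xx: "lor x x = -1" .
  have xu: "lor x u = - (b * l)" using u by (simp add: x_def lor_linear lor_sym[of q u] l ideal_def)
  have x: "x \<in> hyp3" using hyp3I_ideal[OF u xx] xu b l by simp
  have "b * l \<le> 1" using b l by (simp add: pos_le_divide_eq)
  then have "x \<in> unit_horoball u" using x xu by (simp add: unit_horoball_def)
  moreover have "lor x (e j) < 0" if "j < 4" for j
    using ue[OF that] a b D(3)[OF that] qe[OF that]
    by (simp add: x_def lor_linear add_nonpos_neg mult_nonneg_nonpos mult_pos_neg)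
  then have "x \<in> hyp_interior (simplex_body e)" by (rule open_simplex_interior[OF x])
  ultimately show ?thesis by (rule that)
qed

text \<open>If the horoball of \<open>w\<close> met the interior of the simplex while \<open>w\<close> were on the wrong side of
  facet \<open>j\<close>, then the horoball of the vector reflected in that facet would overlap it.\<close>

lemma horoball_packing_of_vectors:
  assumes s: "hyp_simplex v e"
    and ideal: "\<And>w. w \<in> X \<Longrightarrow> ideal w"
    and sep: "\<And>w w'. w \<in> X \<Longrightarrow> w' \<in> X \<Longrightarrow> w \<noteq> w' \<Longrightarrow> lor w w' \<le> - 2"
    and inv: "\<And>w i. w \<in> X \<Longrightarrow> i < 4 \<Longrightarrow> reflection (e i) w \<in> X"
    and u: "\<And>i. i \<in> ideal_vertices v \<Longrightarrow> u i \<in> X"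
    and vu: "\<And>i. i \<in> ideal_vertices v \<Longrightarrow> \<exists>t>0. v i = t *\<^sub>R u i"
    and half: "\<And>i. i \<in> ideal_vertices v \<Longrightarrow> lor (u i) (e i) \<le> - 1"
  shows "horoball_packing v e (unit_horoball ` X) (\<lambda>i. unit_horoball (u i))"
proof -
  note D = hyp_simplexD[OF s]
  let ?B = "unit_horoball ` X"
  have e1: "lor (e i) (e i) = 1" if "i < 4" for i using D(2)[OF that] .
  have 1: "\<exists>w. horoball_at w S" if S: "S \<in> ?B" for S
  proof -
    obtain w where w: "w \<in> X" "S = unit_horoball w" using S by blast
    have "horoball_at w S"
      unfolding horoball_at_def w(2) unit_horoball_def by (intro conjI ideal[OF w(1)] exI[of _ 1]) simp_all
    then show ?thesis ..
  qed
  have 2: "g ` S \<in> ?B" if "g \<in> reflection_group e" "S \<in> ?B" for g S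
    using that
  proof (induction rule: reflection_group.induct)
    case id
    then show ?case by simp
  next
    case (step g i)
    then obtain w where w: "w \<in> X" "g ` S = unit_horoball w" by blast
    have "(reflection (e i) \<circ> g) ` S = reflection (e i) ` (g ` S)" by (rule image_comp[symmetric])
    also have "\<dots> = unit_horoball (reflection (e i) w)"
      unfolding w(2) by (rule reflection_unit_horoball[OF e1[OF step(2)]])
    finally show ?case using inv[OF w(1) step(2)] by blast
  qed
  have near: "\<exists>i\<in>ideal_vertices v. w = u i"
    if w: "w \<in> X" and x: "x \<in> unit_horoball w" "x \<in> hyp_interior (simplex_body e)" for w x
  proof -
    have h: "x \<in> hyp3" "- lor x w \<le> 1" using x(1) by (auto simp: unit_horoball_def)
    have neg: "lor x (e j) < 0" if "j < 4" for j
      using interior_simplex_less[OF e1[OF that] that x(2)] .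
    have dom: "lor w (e j) \<le> 0" if j: "j < 4" for j
    proof (rule ccontr)
      assume "\<not> lor w (e j) \<le> 0"
      then have p: "0 < lor w (e j)" by simp
      let ?w = "reflection (e j) w"
      have xw: "lor x ?w = lor x w - 2 * lor w (e j) * lor x (e j)"
        by (simp add: reflection_def lor_linear)
      have "0 < 2 * lor w (e j) * - lor x (e j)" using p neg[OF j] by (intro mult_pos_pos) auto
      then have lt: "- lor x ?w < - lor x w" by (simp add: xw)
      have pos: "0 < - lor x ?w" using lor_hyp3_ideal[OF h(1) ideal[OF inv[OF w j]]] by simp
      have "?w \<noteq> w" using lt by auto
      then have "2 \<le> - lor w ?w" using sep[OF w inv[OF w j]] by fastforce
      also have "- lor w ?w \<le> 2 * ((- lor x w) * (- lor x ?w))"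
        using lor_ideal_ideal_bound[OF h(1) ideal[OF w] ideal[OF inv[OF w j]]] by simp
      also have "\<dots> < 2 * (1 * 1)"
      proof -
        have "(- lor x w) * (- lor x ?w) \<le> 1 * (- lor x ?w)" using h(2) pos by (intro mult_right_mono) auto
        also have "\<dots> < 1 * 1" using lt h(2) by simp
        finally show ?thesis by simp
      qed
      finally show False by simp
    qed
    obtain i c where i: "i \<in> ideal_vertices v" "0 < c" "w = c *\<^sub>R v i"
      using dominant_ideal_vertex[OF s ideal[OF w] dom] by blast
    obtain t where t: "v i = t *\<^sub>R u i" using vu[OF i(1)] by blast
    \<comment> \<open>Proportional light-like vectors have product 0, while different vectors of
      \<open>X\<close> have product at most -2; so w and \<open>u i\<close> coincide.\<close>
    have "lor w (u i) = c * t * lor (u i) (u i)" by (simp add: i t lor_scaleR_left)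
    then have "lor w (u i) = 0" using ideal[OF u[OF i(1)]] by (simp add: ideal_def)
    then have "w = u i" using sep[OF w u[OF i(1)]] by fastforce
    with i(1) show ?thesis by blast
  qed
  have 3: "{S \<in> ?B. S \<inter> hyp_interior (simplex_body e) \<noteq> {}} = (\<lambda>i. unit_horoball (u i)) ` ideal_vertices v"
  proof
    show "{S \<in> ?B. S \<inter> hyp_interior (simplex_body e) \<noteq> {}} \<subseteq> (\<lambda>i. unit_horoball (u i)) ` ideal_vertices v"
      using near by blast
    show "(\<lambda>i. unit_horoball (u i)) ` ideal_vertices v \<subseteq> {S \<in> ?B. S \<inter> hyp_interior (simplex_body e) \<noteq> {}}"
    proof
      fix S assume "S \<in> (\<lambda>i. unit_horoball (u i)) ` ideal_vertices v"
      then obtain i where i: "i \<in> ideal_vertices v" "S = unit_horoball (u i)" by blast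
      obtain t where t: "0 < t" "v i = t *\<^sub>R u i" using vu[OF i(1)] by blast
      have "i < 4" using i by (simp add: ideal_vertices_def)
      then obtain x where "x \<in> unit_horoball (u i)" "x \<in> hyp_interior (simplex_body e)"
        using simplex_point_near_vertex[OF s _ ideal[OF u[OF i(1)]] t(2,1)] by blast
      then show "S \<in> {S \<in> ?B. S \<inter> hyp_interior (simplex_body e) \<noteq> {}}" using i u by blast
    qed
  qed
  have 4: "horoball_at (v i) (unit_horoball (u i))" if iv: "i \<in> ideal_vertices v" for i
  proof -
    obtain t where t: "0 < t" "v i = t *\<^sub>R u i" using vu[OF iv] by blast
    have "unit_horoball (u i) = {x \<in> hyp3. - lor x (v i) \<le> t}"
    proof -
      have "- lor x (v i) \<le> t \<longleftrightarrow> - lor x (u i) \<le> 1" for x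
        using mult_le_cancel_left_pos[OF t(1), of "- lor x (u i)" 1] by (simp add: t lor_scaleR_right)
      then show ?thesis by (simp add: unit_horoball_def)
    qed
    moreover have "ideal (v i)" using iv by (simp add: ideal_vertices_def)
    ultimately show ?thesis unfolding horoball_at_def using t(1) by (intro conjI exI[of _ t]) simp_all
  qed
  have 5: "pairwise (\<lambda>S T. hyp_interior S \<inter> hyp_interior T = {}) ?B"
  proof (rule pairwiseI)
    fix S T assume "S \<in> ?B" "T \<in> ?B" "S \<noteq> T"
    then obtain w w' where w: "w \<in> X" "w' \<in> X" "S = unit_horoball w" "T = unit_horoball w'" "w \<noteq> w'" by blast
    show "hyp_interior S \<inter> hyp_interior T = {}"
    proof (rule ccontr)
      assume "hyp_interior S \<inter> hyp_interior T \<noteq> {}"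
      then obtain x where x: "x \<in> hyp_interior S" "x \<in> hyp_interior T" by blast
      have h: "x \<in> hyp3" using x hyp_interior_subset by blast
      have lt: "- lor x w < 1" "- lor x w' < 1"
        using interior_unit_horoball_less ideal x w by blast+
      have pos: "0 < - lor x w" "0 < - lor x w'" using lor_hyp3_ideal[OF h] ideal w by simp_all
      have "(- lor x w) * (- lor x w') < 1 * 1" using lt pos by (intro mult_strict_mono) auto
      moreover have "- lor w w' \<le> 2 * ((- lor x w) * (- lor x w'))"
        using lor_ideal_ideal_bound[OF h ideal[OF w(1)] ideal[OF w(2)]] by simp
      moreover have "2 \<le> - lor w w'" using sep[OF w(1,2,5)] by simp
      ultimately show False by linarith
    qed
  qed
  have 6: "unit_horoball (u i) \<subseteq> halfspace (e i)" if "i \<in> ideal_vertices v" for i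
    unfolding unit_horoball_def
    by (rule horoball_subset_halfspace[OF ideal[OF u[OF that]] e1])
       (use that half[OF that] in \<open>auto simp: ideal_vertices_def\<close>)
  show ?thesis
    unfolding horoball_packing_def
    by (intro conjI ballI) (erule 1, erule (1) 2, rule 3, erule 4, rule 5, erule 6)
qed

text \<open>Twice the Hermitian matrices with diagonal entries \<open>a\<close>, \<open>d\<close> and a Gaussian integer off the
  diagonal, rotated about the axis over the origin.\<close>

definition lat :: "real \<Rightarrow> real \<Rightarrow> real \<Rightarrow> real \<Rightarrow> real \<Rightarrow> real \<Rightarrow> lorentz" where
  "lat p q a m n d = (a + d, vector [2 * (p * m + q * n), 2 * (q * m - p * n), d - a])"

text \<open>Primitivity in Bezout form: an integral reflection transforms the coefficients directly,
  without divisibility arguments.\<close>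

definition unimodular :: "int \<Rightarrow> int \<Rightarrow> int \<Rightarrow> int \<Rightarrow> bool" where
  "unimodular a m n d \<longleftrightarrow> (\<exists>k1 k2 k3 k4. k1 * a + k2 * m + k3 * n + k4 * d = 1)"

definition primitive_cusps :: "real \<Rightarrow> real \<Rightarrow> lorentz set" where
  "primitive_cusps p q = {w. ideal w \<and> (\<exists>a m n d.
     w = lat p q (of_int a) (of_int m) (of_int n) (of_int d) \<and> unimodular a m n d)}"

lemma lor_lat:
  assumes "p\<^sup>2 + q\<^sup>2 = 1"
  shows "lor (lat p q a m n d) (lat p q a' m' n' d') = 4 * (m * m' + n * n') - 2 * (a * d' + a' * d)"
proof -
  have "lor (lat p q a m n d) (lat p q a' m' n' d') = 4 * (p\<^sup>2 + q\<^sup>2) * (m * m' + n * n') - 2 * (a * d' + a' * d)"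
    unfolding lat_def lor_vector by (simp add: power2_eq_square algebra_simps)
  then show ?thesis using assms by simp
qed

lemma lat_eq_iff:
  assumes pq: "p\<^sup>2 + q\<^sup>2 = 1"
  shows "lat p q a m n d = lat p q a' m' n' d' \<longleftrightarrow> a = a' \<and> m = m' \<and> n = n' \<and> d = d'"
proof
  assume eq: "lat p q a m n d = lat p q a' m' n' d'"
  then have 1: "a + d = a' + d'" "p * m + q * n = p * m' + q * n'" "q * m - p * n = q * m' - p * n'" "d - a = d' - a'"
    by (auto simp: lat_def vec_eq_iff forall_3)
  have m: "m = p * (p * m + q * n) + q * (q * m - p * n)" and n: "n = q * (p * m + q * n) - p * (q * m - p * n)" for m n
  proof -
    have "p * (p * m + q * n) + q * (q * m - p * n) = (p\<^sup>2 + q\<^sup>2) * m" "q * (p * m + q * n) - p * (q * m - p * n) = (p\<^sup>2 + q\<^sup>2) * n"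
      by (simp_all add: power2_eq_square algebra_simps)
    then show "m = p * (p * m + q * n) + q * (q * m - p * n)" "n = q * (p * m + q * n) - p * (q * m - p * n)"
      using pq by simp_all
  qed
  have "m = m'" using m[of m n] m[of m' n'] 1 by metis
  moreover have "n = n'" using n[of n m] n[of n' m'] 1 by metis
  ultimately show "a = a' \<and> m = m' \<and> n = n' \<and> d = d'" using 1(1,4) by simp
qed simp

lemma lat_scaleR: "c *\<^sub>R lat p q a m n d = lat p q (c * a) (c * m) (c * n) (c * d)"
  by (simp add: lat_def vec_eq_iff forall_3 algebra_simps)

text \<open>The product is an even integer and not positive, so only the value 0 must be excluded;
  it would make two primitive vectors proportional, hence equal.\<close>

lemma primitive_cusps_separated:
  assumes pq: "p\<^sup>2 + q\<^sup>2 = 1" and w: "w \<in> primitive_cusps p q" "w' \<in> primitive_cusps p q" "w \<noteq> w'"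
  shows "lor w w' \<le> - 2"
proof -
  obtain a m n d k1 k2 k3 k4 :: int where 1: "ideal w" "w = lat p q a m n d" "k1 * a + k2 * m + k3 * n + k4 * d = 1"
    using w(1) unfolding primitive_cusps_def unimodular_def by blast
  obtain a' m' n' d' l1 l2 l3 l4 :: int where 2: "ideal w'" "w' = lat p q a' m' n' d'" "l1 * a' + l2 * m' + l3 * n' + l4 * d' = 1"
    using w(2) unfolding primitive_cusps_def unimodular_def by blast
  define N where "N = 2 * (m * m' + n * n') - (a * d' + a' * d)"
  have N: "lor w w' = 2 * of_int N"
    unfolding 1(2) 2(2) lor_lat[OF pq] N_def by simp
  have "lor w w' \<noteq> 0"
  proof
    assume "lor w w' = 0"
    then obtain c where c: "0 < c" "w' = c *\<^sub>R w" using ideal_parallel[OF 1(1) 2(1)] by metis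
    then have eq: "real_of_int a' = c * a" "real_of_int m' = c * m" "real_of_int n' = c * n" "real_of_int d' = c * d"
      unfolding 1(2) 2(2) lat_scaleR lat_eq_iff[OF pq] by auto
    \<comment> \<open>Applying either Bezout combination to the other vector shows that the ratio
      \<open>c\<close> and its inverse are both integers.\<close>
    define K where "K = k1 * a' + k2 * m' + k3 * n' + k4 * d'"
    define K' where "K' = l1 * a + l2 * m + l3 * n + l4 * d"
    have "real_of_int K = c * real_of_int (k1 * a + k2 * m + k3 * n + k4 * d)"
      by (simp add: K_def eq algebra_simps)
    then have K: "real_of_int K = c" unfolding 1(3) by simp
    have "c * real_of_int K' = real_of_int (l1 * a' + l2 * m' + l3 * n' + l4 * d')"
      by (simp add: K'_def eq algebra_simps)
    then have "c * real_of_int K' = 1" unfolding 2(3) by simp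
    then have "real_of_int (K * K') = 1" by (simp add: K)
    then have "K * K' = 1" by linarith
    moreover have "0 < K" using K c by simp
    ultimately have "K = 1" by (metis pos_zmult_eq_1_iff)
    then show False using K c w(3) by simp
  qed
  moreover have "lor w w' \<le> 0" using lor_ideal_ideal_le 1 2 by blast
  ultimately have "N < 0" using N by simp
  then have "N \<le> - 1" by simp
  then have "real_of_int N \<le> - 1" by linarith
  then show ?thesis using N by simp
qed

text \<open>In lattice coordinates a reflection has the form \<open>w - \<kappa>(w) r\<close> with \<open>\<kappa>(r) = 2\<close>.\<close>

lemma primitive_cusps_reflection:
  fixes r1 r2 r3 r4 c1 c2 c3 c4 :: int
  assumes w: "w \<in> primitive_cusps p q" and e: "lor e e = 1"
    and refl: "\<And>a m n d :: int. reflection e (lat p q a m n d) =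
      lat p q (of_int (a - (c1 * a + c2 * m + c3 * n + c4 * d) * r1)) (of_int (m - (c1 * a + c2 * m + c3 * n + c4 * d) * r2))
        (of_int (n - (c1 * a + c2 * m + c3 * n + c4 * d) * r3)) (of_int (d - (c1 * a + c2 * m + c3 * n + c4 * d) * r4))"
    and cr: "c1 * r1 + c2 * r2 + c3 * r3 + c4 * r4 = 2"
  shows "reflection e w \<in> primitive_cusps p q"
proof -
  obtain a m n d k1 k2 k3 k4 :: int where 1: "ideal w" "w = lat p q a m n d" "k1 * a + k2 * m + k3 * n + k4 * d = 1"
    using w unfolding primitive_cusps_def unimodular_def by blast
  define K where "K = c1 * a + c2 * m + c3 * n + c4 * d"
  define R where "R = k1 * r1 + k2 * r2 + k3 * r3 + k4 * r4"
  \<comment> \<open>The new Bezout coefficients come from the transposed reflection, which subtracts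
    R times the functional \<kappa>, where R is the value of the old combination at r. The terms in
    R K cancel because \<kappa>(r) = 2.\<close>
  have "(k1 - R * c1) * (a - K * r1) + (k2 - R * c2) * (m - K * r2) + (k3 - R * c3) * (n - K * r3) + (k4 - R * c4) * (d - K * r4)
     = (k1 * a + k2 * m + k3 * n + k4 * d) - K * R - R * K + R * K * (c1 * r1 + c2 * r2 + c3 * r3 + c4 * r4)"
    by (simp add: R_def K_def algebra_simps)
  also have "\<dots> = 1" unfolding 1(3) cr by simp
  finally have "unimodular (a - K * r1) (m - K * r2) (n - K * r3) (d - K * r4)"
    unfolding unimodular_def by blast
  moreover have "reflection e w = lat p q (of_int (a - K * r1)) (of_int (m - K * r2)) (of_int (n - K * r3)) (of_int (d - K * r4))"
    unfolding 1(2) K_def by (rule refl)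
  moreover have "ideal (reflection e w)" by (rule reflection_ideal[OF e 1(1)])
  ultimately show ?thesis unfolding primitive_cusps_def by blast
qed

text \<open>\<open>A\<close> and \<open>B\<close> are the components of the plane's direction along
  the rotated lattice axes, and \<open>t\<close> is half the product of the lattice vector with the
  plane.\<close>

lemma reflection_plane_lat:
  fixes p q \<alpha> \<beta> \<gamma> :: real
  assumes pq: "p\<^sup>2 + q\<^sup>2 = 1"
  defines "A \<equiv> p * \<alpha> + q * \<beta>" and "B \<equiv> q * \<alpha> - p * \<beta>"
  defines "t \<equiv> \<lambda>a m n. A * m + B * n - \<gamma> * a"
  shows "reflection (plane \<alpha> \<beta> \<gamma>) (lat p q a m n d) =
    lat p q a (m - 2 * t a m n * A) (n - 2 * t a m n * B) (d - 4 * t a m n * \<gamma>)"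
proof -
  have l: "lor (lat p q a m n d) (plane \<alpha> \<beta> \<gamma>) = 2 * t a m n"
    by (simp add: lat_def plane_def lor_vector t_def A_def B_def algebra_simps)
  have "p * A + q * B = (p\<^sup>2 + q\<^sup>2) * \<alpha>" "q * A - p * B = (p\<^sup>2 + q\<^sup>2) * \<beta>"
    by (simp_all add: A_def B_def power2_eq_square algebra_simps)
  then have AB: "p * A + q * B = \<alpha>" "q * A - p * B = \<beta>" using pq by simp_all
  have 1: "p * (m - 2 * s * A) + q * (n - 2 * s * B) = (p * m + q * n) - 2 * s * (p * A + q * B)"
    "q * (m - 2 * s * A) - p * (n - 2 * s * B) = (q * m - p * n) - 2 * s * (q * A - p * B)" for s
    by (simp_all add: algebra_simps)
  have "reflection (plane \<alpha> \<beta> \<gamma>) (lat p q a m n d) = lat p q a m n d - (2 * (2 * t a m n)) *\<^sub>R plane \<alpha> \<beta> \<gamma>"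
    unfolding reflection_def l ..
  also have "\<dots> = lat p q a (m - 2 * t a m n * A) (n - 2 * t a m n * B) (d - 4 * t a m n * \<gamma>)"
    unfolding lat_def 1 AB by (simp add: plane_def vec_eq_iff forall_3 algebra_simps)
  finally show ?thesis .
qed

lemma reflection_unit_sphere_lat: "reflection unit_sphere (lat p q a m n d) = lat p q d m n a"
  by (simp add: reflection_def lat_def unit_sphere_def lor_vector vec_eq_iff forall_3)

lemma primitive_cusps_unit_sphere:
  assumes "w \<in> primitive_cusps p q"
  shows "reflection unit_sphere w \<in> primitive_cusps p q"
  by (rule primitive_cusps_reflection[where ?c1.0 = 1 and ?c2.0 = 0 and ?c3.0 = 0 and ?c4.0 = "-1" and ?r1.0 = 1 and ?r2.0 = 0 and ?r3.0 = 0 and ?r4.0 = "-1", OF assms])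
     (simp_all add: lor_plane reflection_unit_sphere_lat)

text \<open>The subtracted term \<kappa>(w) r does not change when \<kappa> is multiplied and r
  divided by the same number. The factor \<open>l\<close> uses this freedom to make both integral at
  once, although the normal itself may contain square roots.\<close>

lemma primitive_cusps_plane:
  fixes c1 c2 c3 r2 r3 r4 :: int
  assumes w: "w \<in> primitive_cusps p q" and pq: "p\<^sup>2 + q\<^sup>2 = 1" and unit: "\<alpha> * \<alpha> + \<beta> * \<beta> = 1" and l: "l \<noteq> 0"
    and c: "of_int c1 = - l * \<gamma>" "of_int c2 = l * (p * \<alpha> + q * \<beta>)" "of_int c3 = l * (q * \<alpha> - p * \<beta>)"
    and r: "l * of_int r2 = 2 * (p * \<alpha> + q * \<beta>)" "l * of_int r3 = 2 * (q * \<alpha> - p * \<beta>)" "l * of_int r4 = 4 * \<gamma>"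
  shows "reflection (plane \<alpha> \<beta> \<gamma>) w \<in> primitive_cusps p q"
proof (rule primitive_cusps_reflection[where ?c1.0 = c1 and ?c2.0 = c2 and ?c3.0 = c3 and ?c4.0 = 0 and ?r1.0 = 0 and ?r2.0 = r2 and ?r3.0 = r3 and ?r4.0 = r4, OF w])
  show "lor (plane \<alpha> \<beta> \<gamma>) (plane \<alpha> \<beta> \<gamma>) = 1" using unit by (simp add: lor_plane)
  let ?A = "p * \<alpha> + q * \<beta>" and ?B = "q * \<alpha> - p * \<beta>"
  show "reflection (plane \<alpha> \<beta> \<gamma>) (lat p q a m n d) =
      lat p q (of_int (a - (c1 * a + c2 * m + c3 * n + 0 * d) * 0)) (of_int (m - (c1 * a + c2 * m + c3 * n + 0 * d) * r2))
        (of_int (n - (c1 * a + c2 * m + c3 * n + 0 * d) * r3)) (of_int (d - (c1 * a + c2 * m + c3 * n + 0 * d) * r4))"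
    for a m n d :: int
  proof -
    define t where "t = ?A * m + ?B * n - \<gamma> * a"
    have K: "real_of_int (c1 * a + c2 * m + c3 * n + 0 * d) = l * t"
      by (simp add: c t_def algebra_simps)
    have "(l * t) * of_int r2 = t * (l * of_int r2)" "(l * t) * of_int r3 = t * (l * of_int r3)" "(l * t) * of_int r4 = t * (l * of_int r4)"
      by simp_all
    then have lt: "(l * t) * of_int r2 = 2 * t * ?A" "(l * t) * of_int r3 = 2 * t * ?B" "(l * t) * of_int r4 = 4 * t * \<gamma>"
      unfolding r by simp_all
    show ?thesis
      unfolding reflection_plane_lat[OF pq] of_int_diff of_int_mult[of "c1 * a + c2 * m + c3 * n + 0 * d"] K t_def[symmetric]
      by (simp only: lt of_int_0 mult_zero_right diff_zero)
  qed
  have "l * real_of_int (c2 * r2 + c3 * r3) = of_int c2 * (l * of_int r2) + of_int c3 * (l * of_int r3)"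
    by (simp add: algebra_simps)
  also have "\<dots> = l * (2 * (p\<^sup>2 + q\<^sup>2) * (\<alpha> * \<alpha> + \<beta> * \<beta>))"
    unfolding r c by (simp add: power2_eq_square algebra_simps)
  also have "\<dots> = l * 2" unfolding pq unit by simp
  finally have "real_of_int (c2 * r2 + c3 * r3) = 2" using l by simp
  then have "c2 * r2 + c3 * r3 = 2" by linarith
  then show "c1 * 0 + c2 * r2 + c3 * r3 + 0 * r4 = 2" by simp
qed

text \<open>(p, q) fits the Gaussian integers to the base triangle. For c = 1/2 the axes agree; for
  c = sqrt 2 / 2 they are turned by 45 degrees, so that the Gaussian units lie over the points with
  coordinates c or -c, where the ideal corners are.\<close>

definition cusp_lattice :: "real \<Rightarrow> real \<Rightarrow> real \<Rightarrow> bool" where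
  "cusp_lattice c p q \<longleftrightarrow> (c = 1 / 2 \<and> p = 1 \<and> q = 0) \<or> (c = sqrt 2 / 2 \<and> p = sqrt 2 / 2 \<and> q = sqrt 2 / 2)"

lemma cusp_lattice_unit:
  assumes "cusp_lattice c p q"
  shows "p\<^sup>2 + q\<^sup>2 = 1" "0 < c" "2 * c\<^sup>2 \<le> 1"
  using assms unfolding cusp_lattice_def by (elim disjE conjE; hypsubst; simp add: power_divide)+

text \<open>For each mirror \<open>l\<close> is chosen to clear the denominator 2 or the root of 2
  in the normal; the integers are then forced by the equations of
  \<open>primitive_cusps_plane\<close>.\<close>

lemma primitive_cusps_mirrors:
  assumes cpq: "cusp_lattice c p q" and w: "w \<in> primitive_cusps p q"
  shows "reflection (plane 1 0 c) w \<in> primitive_cusps p q"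
    "reflection (plane 0 1 c) w \<in> primitive_cusps p q"
    "reflection (plane 0 (- 1) 0) w \<in> primitive_cusps p q"
    "reflection (plane (- sqrt 2 / 2) (sqrt 2 / 2) 0) w \<in> primitive_cusps p q"
    "reflection (plane (- sqrt 2 / 2) (- sqrt 2 / 2) 0) w \<in> primitive_cusps p q"
proof -
  note P = primitive_cusps_plane[OF w cusp_lattice_unit(1)[OF cpq]]
  have cases: "c = 1 / 2 \<and> p = 1 \<and> q = 0 \<or> c = sqrt 2 / 2 \<and> p = sqrt 2 / 2 \<and> q = sqrt 2 / 2"
    using cpq by (simp add: cusp_lattice_def)
  show "reflection (plane 1 0 c) w \<in> primitive_cusps p q"
    using cases
  proof
    assume "c = 1 / 2 \<and> p = 1 \<and> q = 0"
    then have eqs: "c = 1 / 2" "p = 1" "q = 0" by blast+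
    show ?thesis
      by (intro P[where l = 2 and ?c1.0 = "-1" and ?c2.0 = 2 and ?c3.0 = 0 and ?r2.0 = 1 and ?r3.0 = 0 and ?r4.0 = 1]) (simp_all add: eqs)
  next
    assume "c = sqrt 2 / 2 \<and> p = sqrt 2 / 2 \<and> q = sqrt 2 / 2"
    then have eqs: "c = sqrt 2 / 2" "p = sqrt 2 / 2" "q = sqrt 2 / 2" by blast+
    show ?thesis
      by (intro P[where l = "sqrt 2" and ?c1.0 = "-1" and ?c2.0 = 1 and ?c3.0 = 1 and ?r2.0 = 1 and ?r3.0 = 1 and ?r4.0 = 2]) (simp_all add: eqs)
  qed
  show "reflection (plane 0 1 c) w \<in> primitive_cusps p q"
    using cases
  proof
    assume "c = 1 / 2 \<and> p = 1 \<and> q = 0"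
    then have eqs: "c = 1 / 2" "p = 1" "q = 0" by blast+
    show ?thesis
      by (intro P[where l = 2 and ?c1.0 = "-1" and ?c2.0 = 0 and ?c3.0 = "-2" and ?r2.0 = 0 and ?r3.0 = "-1" and ?r4.0 = 1]) (simp_all add: eqs)
  next
    assume "c = sqrt 2 / 2 \<and> p = sqrt 2 / 2 \<and> q = sqrt 2 / 2"
    then have eqs: "c = sqrt 2 / 2" "p = sqrt 2 / 2" "q = sqrt 2 / 2" by blast+
    show ?thesis
      by (intro P[where l = "sqrt 2" and ?c1.0 = "-1" and ?c2.0 = 1 and ?c3.0 = "-1" and ?r2.0 = 1 and ?r3.0 = "-1" and ?r4.0 = 2]) (simp_all add: eqs)
  qed
  show "reflection (plane 0 (- 1) 0) w \<in> primitive_cusps p q"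
    using cases
  proof
    assume "c = 1 / 2 \<and> p = 1 \<and> q = 0"
    then have eqs: "c = 1 / 2" "p = 1" "q = 0" by blast+
    show ?thesis
      by (intro P[where l = 1 and ?c1.0 = 0 and ?c2.0 = 0 and ?c3.0 = 1 and ?r2.0 = 0 and ?r3.0 = 2 and ?r4.0 = 0]) (simp_all add: eqs)
  next
    assume "c = sqrt 2 / 2 \<and> p = sqrt 2 / 2 \<and> q = sqrt 2 / 2"
    then have eqs: "c = sqrt 2 / 2" "p = sqrt 2 / 2" "q = sqrt 2 / 2" by blast+
    show ?thesis
      by (intro P[where l = "sqrt 2" and ?c1.0 = 0 and ?c2.0 = "-1" and ?c3.0 = 1 and ?r2.0 = "-1" and ?r3.0 = 1 and ?r4.0 = 0]) (simp_all add: eqs)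
  qed
  show "reflection (plane (- sqrt 2 / 2) (sqrt 2 / 2) 0) w \<in> primitive_cusps p q"
    using cases
  proof
    assume "c = 1 / 2 \<and> p = 1 \<and> q = 0"
    then have eqs: "c = 1 / 2" "p = 1" "q = 0" by blast+
    show ?thesis
      by (intro P[where l = "sqrt 2" and ?c1.0 = 0 and ?c2.0 = "-1" and ?c3.0 = "-1" and ?r2.0 = "-1" and ?r3.0 = "-1" and ?r4.0 = 0]) (simp_all add: eqs)
  next
    assume "c = sqrt 2 / 2 \<and> p = sqrt 2 / 2 \<and> q = sqrt 2 / 2"
    then have eqs: "c = sqrt 2 / 2" "p = sqrt 2 / 2" "q = sqrt 2 / 2" by blast+
    show ?thesis
      by (intro P[where l = 1 and ?c1.0 = 0 and ?c2.0 = 0 and ?c3.0 = "-1" and ?r2.0 = 0 and ?r3.0 = "-2" and ?r4.0 = 0]) (simp_all add: eqs)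
  qed
  show "reflection (plane (- sqrt 2 / 2) (- sqrt 2 / 2) 0) w \<in> primitive_cusps p q"
    using cases
  proof
    assume "c = 1 / 2 \<and> p = 1 \<and> q = 0"
    then have eqs: "c = 1 / 2" "p = 1" "q = 0" by blast+
    show ?thesis
      by (intro P[where l = "sqrt 2" and ?c1.0 = 0 and ?c2.0 = "-1" and ?c3.0 = 1 and ?r2.0 = "-1" and ?r3.0 = 1 and ?r4.0 = 0]) (simp_all add: eqs)
  next
    assume "c = sqrt 2 / 2 \<and> p = sqrt 2 / 2 \<and> q = sqrt 2 / 2"
    then have eqs: "c = sqrt 2 / 2" "p = sqrt 2 / 2" "q = sqrt 2 / 2" by blast+
    show ?thesis
      by (intro P[where l = 1 and ?c1.0 = 0 and ?c2.0 = "-1" and ?c3.0 = 0 and ?r2.0 = "-2" and ?r3.0 = 0 and ?r4.0 = 0]) (simp_all add: eqs)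
  qed
qed

lemma primitive_cusps_model_normal:
  assumes cpq: "cusp_lattice c p q" and w: "w \<in> primitive_cusps p q" and i: "i < 4"
  shows "reflection (model_normal sh c i) w \<in> primitive_cusps p q"
proof -
  have "\<forall>i<4. reflection (model_normal sh c i) w \<in> primitive_cusps p q"
    unfolding all_less_4 using primitive_cusps_mirrors[OF cpq w] primitive_cusps_unit_sphere[OF w]
    by (cases sh) (simp_all add: model_normal_def)
  then show ?thesis using i by blast
qed

lemma cusp_primitive: "cusp \<in> primitive_cusps p q"
proof -
  have "cusp = lat p q (of_int 0) (of_int 0) (of_int 0) (of_int 1)"
    by (simp add: cusp_def lat_def)
  moreover have "unimodular 0 0 0 1" unfolding unimodular_def by (intro exI[of _ 1]) simp
  ultimately show ?thesis unfolding primitive_cusps_def using lor_cusp(3) by blast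
qed

lemma base_point_primitive:
  assumes "x = p * of_int m + q * of_int n" "y = q * of_int m - p * of_int n" "x\<^sup>2 + y\<^sup>2 = 1"
  shows "2 *\<^sub>R base_point (x, y) \<in> primitive_cusps p q"
proof -
  have "ideal (2 *\<^sub>R base_point (x, y))"
    by (rule ideal_scaleR) (simp_all add: ideal_def lor_base_point assms(3), simp add: base_point_def)
  moreover have "2 *\<^sub>R base_point (x, y) = lat p q (of_int 1) (of_int m) (of_int n) (of_int 1)"
    by (simp add: base_point_def lat_def assms vec_eq_iff forall_3)
  moreover have "unimodular 1 m n 1"
    unfolding unimodular_def by (intro exI[of _ 1] exI[of _ 0]) simp
  ultimately show ?thesis unfolding primitive_cusps_def by blast
qed

text \<open>For c = 1/2 no corner reaches the unit circle. For c = sqrt 2 / 2 the ideal corners are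
  Gaussian units in the rotated axes.\<close>

lemma model_point_primitive:
  assumes cpq: "cusp_lattice c p q" and x: "x \<in> set (model_points sh c)" and 1: "(fst x)\<^sup>2 + (snd x)\<^sup>2 = 1"
  shows "2 *\<^sub>R base_point x \<in> primitive_cusps p q"
proof -
  have le: "(fst x)\<^sup>2 + (snd x)\<^sup>2 \<le> 2 * c\<^sup>2" using x by (cases sh) auto
  have "c \<noteq> 1 / 2"
  proof
    assume "c = 1 / 2"
    then have "2 * c\<^sup>2 = 1 / 2" by (simp only:) (simp add: power_divide)
    with le 1 show False by simp
  qed
  then have c: "c = sqrt 2 / 2" "p = c" "q = c" using cpq by (auto simp only: cusp_lattice_def)
  have c2: "c\<^sup>2 = 1 / 2" unfolding c(1) by (simp add: power_divide)
  then have c4: "c\<^sup>2 + c\<^sup>2 = 1" by simp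
  have pts: "2 *\<^sub>R base_point (c, c) \<in> primitive_cusps c c" "2 *\<^sub>R base_point (c, - c) \<in> primitive_cusps c c"
    "2 *\<^sub>R base_point (- c, c) \<in> primitive_cusps c c"
    using base_point_primitive[of c c 1 c 0 c] base_point_primitive[of c c 0 c 1 "- c"] base_point_primitive[of "- c" c 0 c "-1" c] c4
    by simp_all
  have "x \<in> {(c, c), (c, - c), (- c, c)}"
    using x 1 c2 by (cases sh) auto
  then show ?thesis using pts unfolding c(2,3) by blast
qed

section \<open>Attained radii and the density formula\<close>

definition cusp_indices :: "shape \<Rightarrow> real \<Rightarrow> nat set" where
  "cusp_indices sh c = {k. k < 4 \<and> (k = 0 \<or> (fst (model_points sh c ! (k - 1)))\<^sup>2 + (snd (model_points sh c ! (k - 1)))\<^sup>2 = 1)}"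

lemma ideal_vertices_frame:
  assumes A: "hyp_simplex v e" "model_frame sh c \<sigma> e" "0 < c" "2 * c\<^sup>2 \<le> 1"
  shows "ideal_vertices v = \<sigma> ` cusp_indices sh c"
proof -
  have \<sigma>: "\<sigma> ` {..<4} = {..<4}" using A(2) by (simp add: model_frame_def bij_betw_def)
  have "ideal (v (\<sigma> k)) \<longleftrightarrow> k \<in> cusp_indices sh c" if "k < 4" for k
    using frame_vertex_product(2)[OF A, of k] frame_vertex_product(3)[OF A, of 1] that
    by (cases "k = 0") (auto simp: cusp_indices_def)
  moreover have "ideal_vertices v = {i \<in> \<sigma> ` {..<4}. ideal (v i)}" unfolding \<sigma> by (auto simp: ideal_vertices_def)
  moreover have "cusp_indices sh c \<subseteq> {..<4}" by (auto simp: cusp_indices_def)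
  ultimately show ?thesis by auto
qed

lemma less_4_cases: "k < 4 \<Longrightarrow> k = 0 \<or> k = Suc 0 \<or> k = 2 \<or> k = (3::nat)"
  by linarith

lemma cusp_indices_half: "cusp_indices sh (1 / 2) = {0}"
  by (cases sh) (auto simp: cusp_indices_def power_divide dest!: less_4_cases)

lemma cusp_indices_inverse_sqrt2:
  "cusp_indices One_Leg (sqrt 2 / 2) = {0, 3}"
  "cusp_indices Hypotenuse (sqrt 2 / 2) = {0, 1, 3}"
  "cusp_indices Two_Legs (sqrt 2 / 2) = {0, 1, 2, 3}"
  by (auto simp: cusp_indices_def power_divide dest!: less_4_cases)

text \<open>The primitive lattice vector on the ray: a vector with a = d = 1 has time coordinate 2,
  which explains the factor.\<close>

definition cusp_vector :: "shape \<Rightarrow> real \<Rightarrow> nat \<Rightarrow> lorentz" where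
  "cusp_vector sh c k = (if k = 0 then cusp else 2 *\<^sub>R base_point (model_points sh c ! (k - 1)))"

text \<open>Horoball radii are normalized so that the horoball touching the opposite facet has radius 1;
  the unit horoball of \<open>cusp_vector sh c k\<close> then has radius \<open>1 / cusp_depth sh c k\<close>.\<close>

definition cusp_depth :: "shape \<Rightarrow> real \<Rightarrow> nat \<Rightarrow> real" where
  "cusp_depth sh c k = (if k = 0 then 1 else 2 * facet_distance sh c k)"

lemma lor_cusp_vector: "lor (cusp_vector sh c k) (model_normal sh c k) = - cusp_depth sh c k"
  by (auto simp: cusp_vector_def cusp_depth_def facet_distance_def lor_scaleR_left lor_cusp model_0)

text \<open>Condition (3) for the lattice horoballs: at the ideal vertices other than
  \<open>cusp\<close> the depths are sqrt 2, 2 or 2 sqrt 2.\<close>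

lemma cusp_depth_ge_1:
  assumes "cusp_lattice c p q" "k \<in> cusp_indices sh c"
  shows "1 \<le> cusp_depth sh c k"
proof -
  have "c = 1 / 2 \<or> c = sqrt 2 / 2" using assms(1) by (auto simp only: cusp_lattice_def)
  then show ?thesis
  proof
    assume "c = 1 / 2"
    then have "k = 0" using assms(2) cusp_indices_half by blast
    then show ?thesis by (simp add: cusp_depth_def)
  next
    assume c: "c = sqrt 2 / 2"
    have s: "1 \<le> sqrt 2" by simp
    then have s2: "1 \<le> 2 * sqrt 2" by linarith
    have k: "k < 4" using assms(2) by (simp add: cusp_indices_def)
    show ?thesis using less_4_cases[OF k] s s2 unfolding c by (cases sh) (auto simp: cusp_depth_def)
  qed
qed

lemma cusp_vector_primitive:
  assumes "cusp_lattice c p q" "k \<in> cusp_indices sh c"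
  shows "cusp_vector sh c k \<in> primitive_cusps p q"
proof (cases "k = 0")
  case True
  then show ?thesis by (simp add: cusp_vector_def cusp_primitive)
next
  case False
  have "length (model_points sh c) = 3" by (cases sh) auto
  then have "model_points sh c ! (k - 1) \<in> set (model_points sh c)"
    using assms(2) False by (intro nth_mem) (auto simp: cusp_indices_def)
  from model_point_primitive[OF assms(1) this] show ?thesis
    using assms(2) False by (simp add: cusp_vector_def cusp_indices_def)
qed

lemma model_vertex_cusp_vector:
  assumes "k \<in> cusp_indices sh c"
  shows "\<exists>t>0. model_vertex sh c k = t *\<^sub>R cusp_vector sh c k"
proof (cases "k = 0")
  case True
  then show ?thesis by (intro exI[of _ 1]) (simp add: cusp_vector_def model_0)
next
  case False
  have len: "length (model_points sh c) = 3" by (cases sh) auto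
  have "k < 4" using assms by (simp add: cusp_indices_def)
  then have "k - 1 < length (model_points sh c)" unfolding len by linarith
  then have "model_vertex sh c k = vertex_over (model_points sh c ! (k - 1))"
    using False by (simp add: model_vertex_def nth_Cons')
  also have "\<dots> = base_point (model_points sh c ! (k - 1))"
    using assms False by (simp add: vertex_over_def cusp_indices_def)
  finally show ?thesis using False by (intro exI[of _ "1 / 2"]) (simp add: cusp_vector_def)
qed

text \<open>The lattice packing of the model is carried over by the isometry \<open>L\<close>. It
  has radius 1 at the vertex \<open>\<sigma> 0\<close> and the reciprocal depths at the
  others.\<close>

lemma frame_packing:
  assumes s: "hyp_simplex v e" and f: "model_frame sh c \<sigma> e" and cpq: "cusp_lattice c p q"
  obtains B b s where "horoball_packing v e B b"
    "\<And>k. k \<in> cusp_indices sh c \<Longrightarrow> s (\<sigma> k) = 1 / cusp_depth sh c k"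
    "\<And>i. i \<in> ideal_vertices v \<Longrightarrow> 0 < s i \<and> s i \<le> 1"
    "\<And>i. i \<in> ideal_vertices v \<Longrightarrow> b i = {x \<in> hyp3. - lor x (v i) \<le> s i * - lor (v i) (e i)}"
proof -
  note c = cusp_lattice_unit[OF cpq]
  note iv = ideal_vertices_frame[OF s f c(2,3)]
  obtain L where L: "lor_isometry L" "\<And>x. lor x x < 0 \<Longrightarrow> 0 < fst (L x) \<longleftrightarrow> 0 < fst x"
    "\<And>i. i < 4 \<Longrightarrow> L (model_normal sh c i) = e (\<sigma> i)"
    "\<And>i. i < 4 \<Longrightarrow> \<exists>r>0. v (\<sigma> i) = r *\<^sub>R L (model_vertex sh c i)"
    "L -` simplex_body e = simplex_body (model_normal sh c)"
    using model_frame_isometry[OF s f c(2,3)] by blast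
  note iso = lor_isometryD[OF L(1)]
  have lin: "linear L" using L(1) unfolding lor_isometry_def by blast
  have \<sigma>: "inj_on \<sigma> {..<4}" "\<sigma> ` {..<4} = {..<4}" using f by (auto simp: model_frame_def bij_betw_def)
  have idx: "k < 4" if "k \<in> cusp_indices sh c" for k using that by (simp add: cusp_indices_def)
  let ?X = "L ` primitive_cusps p q"
  \<comment> \<open>Lattice vectors are numbered in the model, vertices in the simplex; the inverse
    of \<open>\<sigma>\<close> translates.\<close>
  define u where "u i = L (cusp_vector sh c (inv_into {..<4} \<sigma> i))" for i
  have u\<sigma>: "u (\<sigma> k) = L (cusp_vector sh c k)" if "k < 4" for k
    using inv_into_f_f[OF \<sigma>(1), of k] that by (simp add: u_def)
  have ue: "lor (u (\<sigma> k)) (e (\<sigma> k)) = - cusp_depth sh c k" if "k < 4" for k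
    using iso[of "cusp_vector sh c k" "model_normal sh c k"] by (simp add: u\<sigma>[OF that] L(3)[OF that] lor_cusp_vector)
  have idealX: "ideal (L w)" if w: "w \<in> primitive_cusps p q" for w
  proof -
    have wi: "ideal w" using w by (simp add: primitive_cusps_def)
    define o' :: lorentz where "o' = (1, 0)"
    have o': "o' \<in> hyp3" by (simp add: o'_def hyp3_def lor_def)
    then have "L o' \<in> hyp3" using future_isometry_hyp3[OF L(1,2)] by blast
    moreover have "lor (L o') (L w) < 0" using lor_hyp3_ideal[OF o' wi] by (simp add: iso)
    moreover have "lor (L w) (L w) = 0" using wi by (simp add: iso ideal_def)
    ultimately show ?thesis using causal_future[of "L o'" "L w"] by (simp add: ideal_def hyp3_def)
  qed
  have vu: "\<exists>t>0. v (\<sigma> k) = t *\<^sub>R u (\<sigma> k)" if k: "k \<in> cusp_indices sh c" for k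
  proof -
    obtain r where r: "0 < r" "v (\<sigma> k) = r *\<^sub>R L (model_vertex sh c k)" using L(4)[OF idx[OF k]] by blast
    obtain t where t: "0 < t" "model_vertex sh c k = t *\<^sub>R cusp_vector sh c k" using model_vertex_cusp_vector[OF k] by blast
    have "v (\<sigma> k) = (r * t) *\<^sub>R u (\<sigma> k)" by (simp add: r t u\<sigma>[OF idx[OF k]] linear_cmul[OF lin])
    then show ?thesis using r t by (intro exI[of _ "r * t"]) simp
  qed
  have pack: "horoball_packing v e (unit_horoball ` ?X) (\<lambda>i. unit_horoball (u i))"
  proof (rule horoball_packing_of_vectors[OF s])
    show "ideal w" if "w \<in> ?X" for w using that idealX by blast
    show "lor w w' \<le> - 2" if ww: "w \<in> ?X" "w' \<in> ?X" "w \<noteq> w'" for w w'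
    proof -
      obtain y y' where y: "y \<in> primitive_cusps p q" "w = L y" "y' \<in> primitive_cusps p q" "w' = L y'" using ww by blast
      then have "y \<noteq> y'" using ww(3) by blast
      from primitive_cusps_separated[OF c(1) y(1,3) this] show ?thesis by (simp add: y iso)
    qed
    show "reflection (e i) w \<in> ?X" if wi: "w \<in> ?X" "i < 4" for w i
    proof -
      obtain y where y: "y \<in> primitive_cusps p q" "w = L y" using wi by blast
      obtain k where k: "k < 4" "i = \<sigma> k" using \<sigma>(2) wi(2) by (metis imageE lessThan_iff)
      have "reflection (e i) w = L (reflection (model_normal sh c k) y)"
        by (simp add: reflection_def y k L(3)[OF k(1), symmetric] iso linear_diff[OF lin] linear_cmul[OF lin])
      then show ?thesis using primitive_cusps_model_normal[OF cpq y(1) k(1)] by blast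
    qed
    fix i assume "i \<in> ideal_vertices v"
    then obtain k where k: "k \<in> cusp_indices sh c" "i = \<sigma> k" unfolding iv by blast
    show "u i \<in> ?X" unfolding k(2) u\<sigma>[OF idx[OF k(1)]] using cusp_vector_primitive[OF cpq k(1)] by blast
    show "\<exists>t>0. v i = t *\<^sub>R u i" unfolding k(2) by (rule vu[OF k(1)])
    show "lor (u i) (e i) \<le> - 1" unfolding k(2) ue[OF idx[OF k(1)]] using cusp_depth_ge_1[OF cpq k(1)] by simp
  qed
  define s where "s i = 1 / - lor (u i) (e i)" for i
  have s\<sigma>: "s (\<sigma> k) = 1 / cusp_depth sh c k" if "k \<in> cusp_indices sh c" for k
    by (simp add: s_def ue[OF idx[OF that]])
  show ?thesis
  proof (rule that[OF pack s\<sigma>])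
    fix i assume "i \<in> ideal_vertices v"
    then obtain k where k: "k \<in> cusp_indices sh c" "i = \<sigma> k" unfolding iv by blast
    have d: "1 \<le> cusp_depth sh c k" by (rule cusp_depth_ge_1[OF cpq k(1)])
    then show "0 < s i \<and> s i \<le> 1" unfolding k(2) s\<sigma>[OF k(1)] by simp
    obtain t where t: "0 < t" "v i = t *\<^sub>R u i" using vu[OF k(1)] k(2) by blast
    have "s i * - lor (v i) (e i) = t"
      using d ue[OF idx[OF k(1)]] unfolding k(2)[symmetric] by (simp add: s_def t lor_scaleR_left)
    moreover have "- lor x (v i) \<le> t \<longleftrightarrow> - lor x (u i) \<le> 1" for x
      using mult_le_cancel_left_pos[OF t(1), of "- lor x (u i)" 1] by (simp add: t lor_scaleR_right)
    ultimately show "unit_horoball (u i) = {x \<in> hyp3. - lor x (v i) \<le> s i * - lor (v i) (e i)}"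
      by (simp add: unit_horoball_def)
  qed
qed

text \<open>By \<open>f\<close> each ideal vertex can itself be moved to infinity over the same
  triangle, so the same volume formula holds at all of them. The number of copies of the small
  triangle cancels.\<close>

lemma packing_density_frame:
  assumes s: "hyp_simplex v e" and c: "0 < c" "2 * c\<^sup>2 \<le> 1"
    and f: "\<And>i. i \<in> ideal_vertices v \<Longrightarrow> \<exists>\<sigma>. model_frame sh c \<sigma> e \<and> \<sigma> 0 = i"
    and ne: "ideal_vertices v \<noteq> {}"
    and vol: "triangle_vol c = ennreal I" "0 < I"
    and r: "\<And>i. i \<in> ideal_vertices v \<Longrightarrow> 0 < s i \<and> s i \<le> 1"
    and b: "\<And>i. i \<in> ideal_vertices v \<Longrightarrow> b i = {x \<in> hyp3. - lor x (v i) \<le> s i * - lor (v i) (e i)}"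
  shows "packing_density v e b = ennreal ((\<Sum>i\<in>ideal_vertices v. (s i)\<^sup>2) * (c\<^sup>2 / (4 * I)))"
proof -
  define M where "M = real (piece_count sh)"
  have M: "0 < M" by (cases sh) (simp_all add: M_def)
  obtain i where "i \<in> ideal_vertices v" using ne by blast
  then obtain \<sigma> where "model_frame sh c \<sigma> e" using f by blast
  from emeasure_frame_body[OF s this c]
  have body: "emeasure hyp_vol (simplex_body e) = ennreal (M * I)"
    by (simp add: vol(1) M_def ennreal_mult' ennreal_of_nat_eq_real_of_nat)
  have "(\<Sum>i\<in>ideal_vertices v. emeasure hyp_vol (b i \<inter> simplex_body e)) = (\<Sum>i\<in>ideal_vertices v. ennreal (M * ((s i)\<^sup>2 * c\<^sup>2 / 4)))"
  proof (rule sum.cong[OF refl])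
    fix i assume i: "i \<in> ideal_vertices v"
    obtain \<sigma> where \<sigma>: "model_frame sh c \<sigma> e" "\<sigma> 0 = i" using f[OF i] by blast
    show "emeasure hyp_vol (b i \<inter> simplex_body e) = ennreal (M * ((s i)\<^sup>2 * c\<^sup>2 / 4))"
      using emeasure_frame_horoball[OF s \<sigma>(1) c, of "s i"] r[OF i] unfolding b[OF i] \<sigma>(2) M_def by blast
  qed
  also have "\<dots> = ennreal (\<Sum>i\<in>ideal_vertices v. M * ((s i)\<^sup>2 * c\<^sup>2 / 4))"
    using M by (intro sum_ennreal) simp
  finally have "packing_density v e b = ennreal (\<Sum>i\<in>ideal_vertices v. M * ((s i)\<^sup>2 * c\<^sup>2 / 4)) / ennreal (M * I)"
    by (simp add: packing_density_def body)
  also have "\<dots> = ennreal ((\<Sum>i\<in>ideal_vertices v. M * ((s i)\<^sup>2 * c\<^sup>2 / 4)) / (M * I))"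
    using M vol(2) by (intro divide_ennreal sum_nonneg) auto
  also have "(\<Sum>i\<in>ideal_vertices v. M * ((s i)\<^sup>2 * c\<^sup>2 / 4)) = M * (c\<^sup>2 / 4) * (\<Sum>i\<in>ideal_vertices v. (s i)\<^sup>2)"
    by (simp add: sum_distrib_left mult_ac)
  also have "M * (c\<^sup>2 / 4) * (\<Sum>i\<in>ideal_vertices v. (s i)\<^sup>2) / (M * I) = (\<Sum>i\<in>ideal_vertices v. (s i)\<^sup>2) * (c\<^sup>2 / (4 * I))"
    using M by simp
  finally show ?thesis .
qed

text \<open>In \<open>frame_vertex_product\<close> the product P of the two distances to the facets
  equals - lor of the vertices times the Euclidean distance; dividing the disjointness condition by
  P leaves the normalised radii.\<close>

lemma frame_radii_bound:
  assumes A: "hyp_simplex v e" "model_frame sh c \<sigma> e" "0 < c" "2 * c\<^sup>2 \<le> 1" and k: "0 < k" "k < 4"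
    and b: "2 * (s (\<sigma> 0) * - lor (v (\<sigma> 0)) (e (\<sigma> 0))) * (s (\<sigma> k) * - lor (v (\<sigma> k)) (e (\<sigma> k))) \<le> - lor (v (\<sigma> 0)) (v (\<sigma> k))"
  shows "2 * (s (\<sigma> 0) * s (\<sigma> k)) * facet_distance sh c k \<le> 1"
proof -
  define P where "P = - lor (v (\<sigma> 0)) (e (\<sigma> 0)) * - lor (v (\<sigma> k)) (e (\<sigma> k))"
  have \<sigma>4: "\<sigma> i < 4" if "i < 4" for i using A(2) that by (auto simp: model_frame_def dest: bij_betwE)
  have P: "0 < P" unfolding P_def
    using hyp_simplexD(3)[OF A(1) \<sigma>4[of 0]] hyp_simplexD(3)[OF A(1) \<sigma>4[OF k(2)]] by (intro mult_pos_pos) auto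
  have d: "0 < facet_distance sh c k"
    using less_4_cases[OF k(2)] k(1) A(3) by (cases sh) auto
  have "2 * (s (\<sigma> 0) * s (\<sigma> k)) * P * facet_distance sh c k \<le> - lor (v (\<sigma> 0)) (v (\<sigma> k)) * facet_distance sh c k"
    using b d by (intro mult_right_mono) (simp_all add: P_def mult_ac)
  also have "\<dots> = P" using frame_vertex_product(1)[OF A k] by (simp add: P_def)
  finally have "P * (2 * (s (\<sigma> 0) * s (\<sigma> k)) * facet_distance sh c k) \<le> P * 1" by (simp add: mult_ac)
  then show ?thesis using P by (simp only: mult_le_cancel_left_pos)
qed

lemma triangle_vol_half: "triangle_vol (1 / 2) = ennreal (catalan_const / 12)"
  by (rule triangle_vol_eq) (use has_integral_triangle_half in \<open>simp_all add: power_divide\<close>)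

lemma triangle_vol_inverse_sqrt2: "triangle_vol (sqrt 2 / 2) = ennreal (catalan_const / 4)"
  by (rule triangle_vol_eq) (use has_integral_triangle_inverse_sqrt2 in \<open>simp_all add: power_divide\<close>)

text \<open>The maximum of the sum of the squared normalized radii over all packings.\<close>

definition cusp_weight :: "real \<Rightarrow> real" where
  "cusp_weight c = (if c = 1 / 2 then 1 else 3 / 2)"

lemma sum_cusp_depth:
  assumes "cusp_lattice c p q"
  shows "(\<Sum>k\<in>cusp_indices sh c. (1 / cusp_depth sh c k)\<^sup>2) = cusp_weight c"
proof -
  have "c = 1 / 2 \<or> c = sqrt 2 / 2" using assms by (auto simp only: cusp_lattice_def)
  then show ?thesis
  proof
    assume c: "c = 1 / 2"
    show ?thesis unfolding c cusp_indices_half by (simp add: cusp_depth_def cusp_weight_def)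
  next
    assume c: "c = sqrt 2 / 2"
    show ?thesis unfolding c
      by (cases sh) (simp_all add: cusp_indices_inverse_sqrt2 cusp_depth_def cusp_weight_def power_divide power_mult_distrib)
  qed
qed

lemma density_const:
  assumes "cusp_lattice c p q"
  obtains I where "triangle_vol c = ennreal I" "0 < I" "cusp_weight c * (c\<^sup>2 / (4 * I)) = 3 / 4 * inverse catalan_const"
proof -
  have "c = 1 / 2 \<or> c = sqrt 2 / 2" using assms by (auto simp only: cusp_lattice_def)
  then show ?thesis
  proof
    assume c: "c = 1 / 2"
    show ?thesis
      by (rule that[of "catalan_const / 12"])
         (use catalan_pos in \<open>simp_all add: c triangle_vol_half cusp_weight_def power_divide inverse_eq_divide\<close>)
  next
    assume c: "c = sqrt 2 / 2"
    show ?thesis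
      by (rule that[of "catalan_const / 4"])
         (use catalan_pos in \<open>simp_all add: c triangle_vol_inverse_sqrt2 cusp_weight_def power_divide inverse_eq_divide\<close>)
  qed
qed

text \<open>Reduces each diagram to a finite extremal problem, the assumption \<open>upper\<close>:
  maximise the sum of squares of radii in (0, 1] under bounds on products of pairs. The lattice
  packing attains the value \<open>cusp_weight c\<close>.\<close>

lemma optimal_density_frame:
  assumes s: "hyp_simplex v e" and cpq: "cusp_lattice c p q"
    and f: "\<And>i. i \<in> ideal_vertices v \<Longrightarrow> \<exists>\<sigma>. model_frame sh c \<sigma> e \<and> \<sigma> 0 = i"
    and ne: "ideal_vertices v \<noteq> {}"
    and upper: "\<And>s. (\<And>i. i \<in> ideal_vertices v \<Longrightarrow> 0 < s i \<and> s i \<le> 1) \<Longrightarrow>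
      (\<And>\<sigma> k. model_frame sh c \<sigma> e \<Longrightarrow> \<sigma> 0 \<in> ideal_vertices v \<Longrightarrow> \<sigma> k \<in> ideal_vertices v \<Longrightarrow> 0 < k \<Longrightarrow> k < 4 \<Longrightarrow>
        2 * (s (\<sigma> 0) * s (\<sigma> k)) * facet_distance sh c k \<le> 1) \<Longrightarrow>
      (\<Sum>i\<in>ideal_vertices v. (s i)\<^sup>2) \<le> cusp_weight c"
  shows "optimal_density v e = ennreal (3 / 4 * inverse catalan_const)"
proof -
  note c = cusp_lattice_unit[OF cpq]
  obtain I where I: "triangle_vol c = ennreal I" "0 < I" "cusp_weight c * (c\<^sup>2 / (4 * I)) = 3 / 4 * inverse catalan_const"
    using density_const[OF cpq] .
  have dens: "packing_density v e b = ennreal ((\<Sum>i\<in>ideal_vertices v. (s i)\<^sup>2) * (c\<^sup>2 / (4 * I)))"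
    if "\<And>i. i \<in> ideal_vertices v \<Longrightarrow> 0 < s i \<and> s i \<le> 1"
      "\<And>i. i \<in> ideal_vertices v \<Longrightarrow> b i = {x \<in> hyp3. - lor x (v i) \<le> s i * - lor (v i) (e i)}" for b s
    using packing_density_frame[OF s c(2,3) f ne I(1,2) that] .
  show ?thesis
  proof (rule antisym)
    show "optimal_density v e \<le> ennreal (3 / 4 * inverse catalan_const)"
      unfolding optimal_density_def
    proof (rule Sup_least, clarify)
      fix B b assume pack: "horoball_packing v e B b"
      obtain t where t: "\<And>i. i \<in> ideal_vertices v \<Longrightarrow> 0 < t i \<and> t i \<le> 1"
        "\<And>i. i \<in> ideal_vertices v \<Longrightarrow> b i = {x \<in> hyp3. - lor x (v i) \<le> t i * - lor (v i) (e i)}"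
        "\<And>i j. i \<in> ideal_vertices v \<Longrightarrow> j \<in> ideal_vertices v \<Longrightarrow> i \<noteq> j \<Longrightarrow>
           2 * (t i * - lor (v i) (e i)) * (t j * - lor (v j) (e j)) \<le> - lor (v i) (v j)"
        using packing_radii[OF s pack] by blast
      have "(\<Sum>i\<in>ideal_vertices v. (t i)\<^sup>2) \<le> cusp_weight c"
      proof (rule upper[OF t(1)])
        fix \<sigma> k assume \<sigma>: "model_frame sh c \<sigma> e" "\<sigma> 0 \<in> ideal_vertices v" "\<sigma> k \<in> ideal_vertices v" "0 < k" "k < 4"
        have "\<sigma> 0 \<noteq> \<sigma> k" using \<sigma> by (auto simp: model_frame_def bij_betw_def inj_on_eq_iff)
        from frame_radii_bound[OF s \<sigma>(1) c(2,3) \<sigma>(4,5) t(3)[OF \<sigma>(2,3) this]]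
        show "2 * (t (\<sigma> 0) * t (\<sigma> k)) * facet_distance sh c k \<le> 1" .
      qed
      then have "(\<Sum>i\<in>ideal_vertices v. (t i)\<^sup>2) * (c\<^sup>2 / (4 * I)) \<le> cusp_weight c * (c\<^sup>2 / (4 * I))"
        using I(2) by (intro mult_right_mono) auto
      then have le: "(\<Sum>i\<in>ideal_vertices v. (t i)\<^sup>2) * (c\<^sup>2 / (4 * I)) \<le> 3 / 4 * inverse catalan_const"
        unfolding I(3) .
      have "packing_density v e b = ennreal ((\<Sum>i\<in>ideal_vertices v. (t i)\<^sup>2) * (c\<^sup>2 / (4 * I)))"
        by (rule dens) (rule t, assumption)+
      also have "\<dots> \<le> ennreal (3 / 4 * inverse catalan_const)" using le by (rule ennreal_leI)
      finally show "packing_density v e b \<le> ennreal (3 / 4 * inverse catalan_const)" .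
    qed
    obtain i where "i \<in> ideal_vertices v" using ne by blast
    then obtain \<sigma> where \<sigma>: "model_frame sh c \<sigma> e" using f by blast
    obtain B b t where t: "horoball_packing v e B b"
      "\<And>k. k \<in> cusp_indices sh c \<Longrightarrow> t (\<sigma> k) = 1 / cusp_depth sh c k"
      "\<And>i. i \<in> ideal_vertices v \<Longrightarrow> 0 < t i \<and> t i \<le> 1"
      "\<And>i. i \<in> ideal_vertices v \<Longrightarrow> b i = {x \<in> hyp3. - lor x (v i) \<le> t i * - lor (v i) (e i)}"
      using frame_packing[OF s \<sigma> cpq] by blast
    have "inj_on \<sigma> {..<4}" using \<sigma> by (simp add: model_frame_def bij_betw_def)
    then have inj: "inj_on \<sigma> (cusp_indices sh c)" by (rule inj_on_subset) (auto simp: cusp_indices_def)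
    have "(\<Sum>i\<in>ideal_vertices v. (t i)\<^sup>2) = (\<Sum>k\<in>cusp_indices sh c. (t (\<sigma> k))\<^sup>2)"
      unfolding ideal_vertices_frame[OF s \<sigma> c(2,3)] by (simp add: sum.reindex[OF inj])
    also have "\<dots> = (\<Sum>k\<in>cusp_indices sh c. (1 / cusp_depth sh c k)\<^sup>2)"
      by (intro sum.cong) (auto simp: t(2))
    also have "\<dots> = cusp_weight c" by (rule sum_cusp_depth[OF cpq])
    finally have sum: "(\<Sum>i\<in>ideal_vertices v. (t i)\<^sup>2) = cusp_weight c" .
    have "packing_density v e b = ennreal ((\<Sum>i\<in>ideal_vertices v. (t i)\<^sup>2) * (c\<^sup>2 / (4 * I)))"
      by (rule dens) (rule t, assumption)+
    then have "packing_density v e b = ennreal (3 / 4 * inverse catalan_const)" unfolding sum I(3) .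
    moreover have "packing_density v e b \<le> optimal_density v e"
      unfolding optimal_density_def by (rule Sup_upper) (use t(1) in blast)
    ultimately show "ennreal (3 / 4 * inverse catalan_const) \<le> optimal_density v e" by simp
  qed
qed

section \<open>The six diagrams\<close>

definition diagram_gram :: "diagram \<Rightarrow> nat \<Rightarrow> nat \<Rightarrow> real" where
  "diagram_gram D i j = (if i = j then 1 else - cos (pi / real (D i j)))"

definition diagram_frame :: "shape \<Rightarrow> real \<Rightarrow> (nat \<Rightarrow> nat) \<Rightarrow> diagram \<Rightarrow> bool" where
  "diagram_frame sh c \<sigma> D \<longleftrightarrow> bij_betw \<sigma> {..<4} {..<4} \<and>
     (\<forall>i<4. \<forall>j<4. diagram_gram D (\<sigma> i) (\<sigma> j) = lor (model_normal sh c i) (model_normal sh c j))"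

lemma coxeter_simplex_gram:
  assumes "coxeter_simplex D v e" "i < 4" "j < 4"
  shows "lor (e i) (e j) = diagram_gram D i j"
proof (cases "i = j")
  case True
  then show ?thesis using assms hyp_simplexD(2)[of v e i] by (simp add: coxeter_simplex_def diagram_gram_def)
next
  case False
  then show ?thesis using assms unfolding coxeter_simplex_def has_dihedral_angle_def diagram_gram_def by auto
qed

lemma diagram_frame_model_frame:
  assumes "coxeter_simplex D v e" "diagram_frame sh c \<sigma> D"
  shows "model_frame sh c \<sigma> e"
proof -
  have "\<sigma> i < 4" if "i < 4" for i using assms(2) that by (auto simp: diagram_frame_def dest: bij_betwE)
  then show ?thesis using assms coxeter_simplex_gram[OF assms(1)] by (simp add: model_frame_def diagram_frame_def)
qed

text \<open>The model simplex, renumbered by the inverse of \<open>\<sigma>\<close>, realises the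
  diagram, so the density statement for all simplices of a diagram is not vacuous.\<close>

lemma coxeter_simplex_exists:
  assumes cpq: "cusp_lattice c p q" and f: "diagram_frame sh c \<sigma> D"
    and labels: "\<And>i j. i < 4 \<Longrightarrow> j < 4 \<Longrightarrow> i \<noteq> j \<Longrightarrow> 2 \<le> D i j"
  shows "\<exists>v e. coxeter_simplex D v e"
proof -
  note c = cusp_lattice_unit[OF cpq]
  define \<tau> where "\<tau> = inv_into {..<4} \<sigma>"
  have \<sigma>: "bij_betw \<sigma> {..<4} {..<4}" using f by (simp add: diagram_frame_def)
  have \<tau>: "bij_betw \<tau> {..<4} {..<4}" unfolding \<tau>_def by (rule bij_betw_inv_into[OF \<sigma>])
  have \<tau>4: "\<tau> i < 4" "\<sigma> (\<tau> i) = i" if "i < 4" for i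
    using bij_betwE[OF \<tau>] bij_betw_inv_into_right[OF \<sigma>] that by (auto simp: \<tau>_def)
  let ?v = "model_vertex sh c \<circ> \<tau>" and ?e = "model_normal sh c \<circ> \<tau>"
  obtain I where I: "triangle_vol c = ennreal I" using density_const[OF cpq] by metis
  have "hyp_simplex ?v ?e" by (rule hyp_simplex_permute[OF model_simplex[OF c(2,3)] \<tau>])
  moreover have "emeasure hyp_vol (simplex_body ?e) < \<infinity>"
    unfolding simplex_body_permute[OF \<tau>] emeasure_model_body I by (simp add: ennreal_of_nat_eq_real_of_nat ennreal_mult_less_top)
  moreover have "has_dihedral_angle (?e i) (?e j) (pi / real (D i j))" if ij: "i < 4" "j < 4" "i \<noteq> j" for i j
  proof -
    have D: "2 \<le> real (D i j)" using labels[OF ij] by linarith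
    have "pi / real (D i j) \<le> pi / 2" using D by (intro divide_left_mono) auto
    then have "pi / real (D i j) < pi" using pi_gt_zero by linarith
    moreover have "0 < pi / real (D i j)" using D by simp
    moreover have "lor (?e i) (?e j) = diagram_gram D i j"
      using f \<tau>4[OF ij(1)] \<tau>4[OF ij(2)] unfolding diagram_frame_def comp_def by metis
    ultimately show ?thesis using ij(3) by (simp add: has_dihedral_angle_def diagram_gram_def)
  qed
  ultimately show ?thesis unfolding coxeter_simplex_def by blast
qed

section \<open>The extremal problems for the radii\<close>

lemma sum_squares_two:
  fixes x y :: real
  assumes "0 < x \<and> x \<le> 1" "0 < y \<and> y \<le> 1" "x * y * sqrt 2 \<le> 1"
  shows "x\<^sup>2 + y\<^sup>2 \<le> 3 / 2"
proof -
  have "(x * y * sqrt 2)\<^sup>2 \<le> 1\<^sup>2" using assms by (intro power_mono) auto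
  then have p: "x\<^sup>2 * y\<^sup>2 * 2 \<le> 1" by (simp add: power_mult_distrib)
  have "x\<^sup>2 \<le> 1" "y\<^sup>2 \<le> 1" using assms by (auto intro: power_le_one)
  then have "0 \<le> (1 - x\<^sup>2) * (1 - y\<^sup>2)" by simp
  then have "x\<^sup>2 + y\<^sup>2 \<le> 1 + x\<^sup>2 * y\<^sup>2" by (simp add: algebra_simps)
  then show ?thesis using p by linarith
qed

text \<open>The sum is at most A + 1 / (2 A), a convex function with the value 3/2 at both ends A =
  1/2 and A = 1.\<close>

lemma large_term_bound:
  fixes A R :: real
  assumes "1 / 2 \<le> A" "A \<le> 1" "A * R \<le> 1 / 2"
  shows "A + R \<le> 3 / 2"
proof -
  have "0 \<le> (2 * A - 1) * (1 - A)" using assms by simp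
  then have "A * (A + R) \<le> A * (3 / 2)" using assms(3) by (simp add: algebra_simps)
  then show ?thesis using assms(1) by simp
qed

text \<open>If some square is at least 1/2, it serves as the large term: its products with the other
  two add up to at most 1/2. Otherwise all three squares are below 1/2.\<close>

lemma sum_squares_three:
  fixes x y z :: real
  assumes "0 < x \<and> x \<le> 1" "0 < y \<and> y \<le> 1" "0 < z \<and> z \<le> 1"
    and "2 * (x * y) \<le> 1" "2 * (x * z) \<le> 1" "2 * (y * z) \<le> 1"
  shows "x\<^sup>2 + y\<^sup>2 + z\<^sup>2 \<le> 3 / 2"
proof -
  have sq: "a\<^sup>2 * b\<^sup>2 \<le> 1 / 4" if "0 < a" "0 < b" "2 * (a * b) \<le> 1" for a b :: real
  proof -
    have "(2 * (a * b))\<^sup>2 \<le> 1\<^sup>2" using that by (intro power_mono) auto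
    then show ?thesis by (simp add: power_mult_distrib)
  qed
  have le: "x\<^sup>2 \<le> 1" "y\<^sup>2 \<le> 1" "z\<^sup>2 \<le> 1" using assms by (auto intro: power_le_one)
  have p: "x\<^sup>2 * y\<^sup>2 \<le> 1 / 4" "x\<^sup>2 * z\<^sup>2 \<le> 1 / 4" "y\<^sup>2 * z\<^sup>2 \<le> 1 / 4"
    using sq assms by auto
  have large: "A + (B + C) \<le> 3 / 2" if "1 / 2 \<le> A" "A \<le> 1" "A * B \<le> 1 / 4" "A * C \<le> 1 / 4" for A B C :: real
    using that by (intro large_term_bound) (auto simp: distrib_left)
  show ?thesis
    using large[of "x\<^sup>2" "y\<^sup>2" "z\<^sup>2"] large[of "y\<^sup>2" "x\<^sup>2" "z\<^sup>2"] large[of "z\<^sup>2" "x\<^sup>2" "y\<^sup>2"] le p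
    by (cases "1 / 2 \<le> x\<^sup>2"; cases "1 / 2 \<le> y\<^sup>2"; cases "1 / 2 \<le> z\<^sup>2") (simp_all add: mult.commute)
qed

text \<open>A is the largest square, B and D belong to its neighbours, C to the opposite node. For A
  >= 1/2 the three products sum to 1/2. For A between 1/4 and 1/2 the bound C <= A replaces the one
  on A C, and 2 A^2 + 1/4 <= 3 A / 2 is (4 A - 1) (1 - 2 A) >= 0. Below 1/4 the sum is below
  1.\<close>

lemma sum_squares_cycle_max:
  fixes A B C D :: real
  assumes "0 < A" "A \<le> 1" "B \<le> A" "C \<le> A" "D \<le> A" "A * B \<le> 1 / 8" "A * D \<le> 1 / 8" "A * C \<le> 1 / 4"
  shows "A + B + C + D \<le> 3 / 2"
proof (cases "1 / 2 \<le> A")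
  case True
  have "A + (B + C + D) \<le> 3 / 2" using assms True by (intro large_term_bound) (auto simp: distrib_left)
  then show ?thesis by simp
next
  case False
  show ?thesis
  proof (cases "1 / 4 \<le> A")
    case True
    have "0 \<le> (4 * A - 1) * (1 - 2 * A)" using False True by simp
    moreover have "A * C \<le> A * A" using assms by (intro mult_left_mono) auto
    ultimately have "A * (A + B + C + D) \<le> A * (3 / 2)" using assms(6,7) by (simp add: algebra_simps)
    then show ?thesis using assms(1) by simp
  qed (use assms in linarith)
qed

text \<open>The conditions are invariant under rotating the cycle, so the largest square may be
  taken as the first.\<close>

lemma sum_squares_cycle:
  fixes a b c d :: real
  assumes "0 < a \<and> a \<le> 1" "0 < b \<and> b \<le> 1" "0 < c \<and> c \<le> 1" "0 < d \<and> d \<le> 1"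
    and "2 * (a * b) * sqrt 2 \<le> 1" "2 * (b * c) * sqrt 2 \<le> 1" "2 * (c * d) * sqrt 2 \<le> 1" "2 * (d * a) * sqrt 2 \<le> 1"
    and "2 * (a * c) \<le> 1" "2 * (b * d) \<le> 1"
  shows "a\<^sup>2 + b\<^sup>2 + c\<^sup>2 + d\<^sup>2 \<le> 3 / 2"
proof -
  have adj: "x\<^sup>2 * y\<^sup>2 \<le> 1 / 8" if "0 < x" "0 < y" "2 * (x * y) * sqrt 2 \<le> 1" for x y :: real
  proof -
    have "(2 * (x * y) * sqrt 2)\<^sup>2 \<le> 1\<^sup>2" using that by (intro power_mono) auto
    then show ?thesis by (simp add: power_mult_distrib)
  qed
  have opp: "x\<^sup>2 * y\<^sup>2 \<le> 1 / 4" if "0 < x" "0 < y" "2 * (x * y) \<le> 1" for x y :: real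
  proof -
    have "(2 * (x * y))\<^sup>2 \<le> 1\<^sup>2" using that by (intro power_mono) auto
    then show ?thesis by (simp add: power_mult_distrib)
  qed
  define A B C D where "A = a\<^sup>2" and "B = b\<^sup>2" and "C = c\<^sup>2" and "D = d\<^sup>2"
  have pos: "0 < A" "0 < B" "0 < C" "0 < D" "A \<le> 1" "B \<le> 1" "C \<le> 1" "D \<le> 1"
    using assms(1-4) by (auto simp: A_def B_def C_def D_def intro: power_le_one)
  have p: "A * B \<le> 1 / 8" "B * C \<le> 1 / 8" "C * D \<le> 1 / 8" "D * A \<le> 1 / 8" "A * C \<le> 1 / 4" "B * D \<le> 1 / 4"
    unfolding A_def B_def C_def D_def using adj opp assms by auto
  have p': "B * A \<le> 1 / 8" "C * B \<le> 1 / 8" "D * C \<le> 1 / 8" "A * D \<le> 1 / 8" "C * A \<le> 1 / 4" "D * B \<le> 1 / 4"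
    using p by (simp_all add: mult.commute)
  consider "B \<le> A \<and> C \<le> A \<and> D \<le> A" | "A \<le> B \<and> C \<le> B \<and> D \<le> B" | "A \<le> C \<and> B \<le> C \<and> D \<le> C" | "A \<le> D \<and> B \<le> D \<and> C \<le> D"
    by linarith
  then have "A + B + C + D \<le> 3 / 2"
  proof cases
    case 1
    then show ?thesis using sum_squares_cycle_max[of A B C D] pos p p' by blast
  next
    case 2
    then have "B + C + D + A \<le> 3 / 2" using sum_squares_cycle_max[of B C D A] pos p p' by blast
    then show ?thesis by simp
  next
    case 3
    then have "C + D + A + B \<le> 3 / 2" using sum_squares_cycle_max[of C D A B] pos p p' by blast
    then show ?thesis by simp
  next
    case 4
    then have "D + A + B + C \<le> 3 / 2" using sum_squares_cycle_max[of D A B C] pos p p' by blast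
    then show ?thesis by simp
  qed
  then show ?thesis unfolding A_def B_def C_def D_def .
qed

lemma cusp_lattices: "cusp_lattice (1 / 2) 1 0" "cusp_lattice (sqrt 2 / 2) (sqrt 2 / 2) (sqrt 2 / 2)"
  by (simp_all add: cusp_lattice_def)

lemma cusp_weights: "cusp_weight (1 / 2) = 1" "cusp_weight (sqrt 2 / 2) = 3 / 2"
  by (simp_all add: cusp_weight_def)

lemma optimal_density_one_cusp:
  assumes D: "coxeter_simplex D v e" and f: "diagram_frame sh (1 / 2) \<sigma> D"
  shows "optimal_density v e = ennreal (3 / 4 * inverse catalan_const)"
proof -
  have s: "hyp_simplex v e" using D by (simp add: coxeter_simplex_def)
  note F = diagram_frame_model_frame[OF D f]
  have iv: "ideal_vertices v = {\<sigma> 0}"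
    unfolding ideal_vertices_frame[OF s F cusp_lattice_unit(2,3)[OF cusp_lattices(1)]] cusp_indices_half by simp
  show ?thesis
  proof (rule optimal_density_frame[OF s cusp_lattices(1)])
    show "\<exists>\<sigma>. model_frame sh (1 / 2) \<sigma> e \<and> \<sigma> 0 = i" if "i \<in> ideal_vertices v" for i
      by (intro exI[of _ \<sigma>]) (use that F iv in simp)
    fix t :: "nat \<Rightarrow> real" assume "\<And>i. i \<in> ideal_vertices v \<Longrightarrow> 0 < t i \<and> t i \<le> 1"
    then show "(\<Sum>i\<in>ideal_vertices v. (t i)\<^sup>2) \<le> cusp_weight (1 / 2)"
      by (simp add: iv cusp_weights power_le_one)
  qed (simp add: iv)
qed

lemma bij_betw_list4:
  assumes "length xs = 4" "distinct xs" "set xs = {0, 1, 2, 3}"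
  shows "bij_betw (\<lambda>k. xs ! k) {..<4} {..<4::nat}"
  by (rule bij_betw_nth[OF assms(2)]) (simp_all only: assms lessThan_4)

lemmas diagram_simps = diagram_frame_def all_less_4 diagram_gram_def model_normal_def lor_plane
  path_diagram_def star_diagram_def cycle_diagram_def doubleton_eq_iff cos_60 cos_45

text \<open>\<open>\<sigma> 0\<close> is a node whose removal leaves a path 4, 4, the diagram of the
  base triangle; the middle node of that path is the hypotenuse and goes to index 2. The same rule
  gives the numberings for the other diagrams.\<close>

lemma R3_frame: "diagram_frame One_Leg (1 / 2) (\<lambda>k. [0, 1, 2, 3] ! k) R3_diagram"
  unfolding diagram_frame_def R3_diagram_def
  by (intro conjI bij_betw_list4) (simp_all add: diagram_simps)

lemma O3_frame: "diagram_frame Hypotenuse (1 / 2) (\<lambda>k. [1, 2, 0, 3] ! k) O3_diagram"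
  unfolding diagram_frame_def O3_diagram_def
  by (intro conjI bij_betw_list4) (auto simp: diagram_simps)

lemma BR3_frame: "diagram_frame Two_Legs (1 / 2) (\<lambda>k. [1, 0, 3, 2] ! k) BR3_diagram"
  unfolding diagram_frame_def BR3_diagram_def
  by (intro conjI bij_betw_list4) (auto simp: diagram_simps)

text \<open>With several ideal vertices, one numbering is given for each of them, since each has to
  be moved to infinity in turn.\<close>

lemma N3_frame:
  "diagram_frame One_Leg (sqrt 2 / 2) (\<lambda>k. [0, 1, 2, 3] ! k) N3_diagram"
  "diagram_frame One_Leg (sqrt 2 / 2) (\<lambda>k. [3, 2, 1, 0] ! k) N3_diagram"
  unfolding diagram_frame_def N3_diagram_def
  by (intro conjI bij_betw_list4; auto simp: diagram_simps)+

lemma M3_frame: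
  "diagram_frame Hypotenuse (sqrt 2 / 2) (\<lambda>k. [1, 2, 0, 3] ! k) M3_diagram"
  "diagram_frame Hypotenuse (sqrt 2 / 2) (\<lambda>k. [2, 1, 0, 3] ! k) M3_diagram"
  "diagram_frame Hypotenuse (sqrt 2 / 2) (\<lambda>k. [3, 1, 0, 2] ! k) M3_diagram"
  unfolding diagram_frame_def M3_diagram_def
  by (intro conjI bij_betw_list4; auto simp: diagram_simps)+

lemma RR3_frame:
  "diagram_frame Two_Legs (sqrt 2 / 2) (\<lambda>k. [0, 1, 2, 3] ! k) RR3_diagram"
  "diagram_frame Two_Legs (sqrt 2 / 2) (\<lambda>k. [1, 2, 3, 0] ! k) RR3_diagram"
  "diagram_frame Two_Legs (sqrt 2 / 2) (\<lambda>k. [2, 3, 0, 1] ! k) RR3_diagram"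
  "diagram_frame Two_Legs (sqrt 2 / 2) (\<lambda>k. [3, 0, 1, 2] ! k) RR3_diagram"
  unfolding diagram_frame_def RR3_diagram_def
  by (intro conjI bij_betw_list4; auto simp: diagram_simps)+

lemma optimal_density_N3:
  assumes D: "coxeter_simplex N3_diagram v e"
  shows "optimal_density v e = ennreal (3 / 4 * inverse catalan_const)"
proof -
  have s: "hyp_simplex v e" using D by (simp add: coxeter_simplex_def)
  note F = N3_frame[THEN diagram_frame_model_frame[OF D]]
  have iv: "ideal_vertices v = {0, 3}"
    unfolding ideal_vertices_frame[OF s F(1) cusp_lattice_unit(2,3)[OF cusp_lattices(2)]] cusp_indices_inverse_sqrt2 by simp
  show ?thesis
  proof (rule optimal_density_frame[OF s cusp_lattices(2)])
    show "\<exists>\<sigma>. model_frame One_Leg (sqrt 2 / 2) \<sigma> e \<and> \<sigma> 0 = i" if "i \<in> ideal_vertices v" for i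
    proof -
      have "i = 0 \<or> i = 3" using that iv by simp
      then show ?thesis
        by (elim disjE) (rule exI, rule conjI, rule F(1), simp, rule exI, rule conjI, rule F(2), simp)
    qed
    fix t :: "nat \<Rightarrow> real"
    assume t: "\<And>i. i \<in> ideal_vertices v \<Longrightarrow> 0 < t i \<and> t i \<le> 1"
      and b: "\<And>\<sigma> k. model_frame One_Leg (sqrt 2 / 2) \<sigma> e \<Longrightarrow> \<sigma> 0 \<in> ideal_vertices v \<Longrightarrow> \<sigma> k \<in> ideal_vertices v \<Longrightarrow>
        0 < k \<Longrightarrow> k < 4 \<Longrightarrow> 2 * (t (\<sigma> 0) * t (\<sigma> k)) * facet_distance One_Leg (sqrt 2 / 2) k \<le> 1"
    \<comment> \<open>Facet distance c = sqrt 2 / 2.\<close>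
    have "t 0 * t 3 * sqrt 2 \<le> 1" using b[OF F(1), of 3] by (simp add: iv)
    then show "(\<Sum>i\<in>ideal_vertices v. (t i)\<^sup>2) \<le> cusp_weight (sqrt 2 / 2)"
      using sum_squares_two[OF t[of 0] t[of 3]] by (simp add: iv cusp_weights)
  qed (simp add: iv)
qed

lemma optimal_density_M3:
  assumes D: "coxeter_simplex M3_diagram v e"
  shows "optimal_density v e = ennreal (3 / 4 * inverse catalan_const)"
proof -
  have s: "hyp_simplex v e" using D by (simp add: coxeter_simplex_def)
  note F = M3_frame[THEN diagram_frame_model_frame[OF D]]
  have iv: "ideal_vertices v = {1, 2, 3}"
    unfolding ideal_vertices_frame[OF s F(1) cusp_lattice_unit(2,3)[OF cusp_lattices(2)]] cusp_indices_inverse_sqrt2 by simp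
  show ?thesis
  proof (rule optimal_density_frame[OF s cusp_lattices(2)])
    show "\<exists>\<sigma>. model_frame Hypotenuse (sqrt 2 / 2) \<sigma> e \<and> \<sigma> 0 = i" if "i \<in> ideal_vertices v" for i
    proof -
      have "i = 1 \<or> i = 2 \<or> i = 3" using that iv by simp
      then show ?thesis
        by (elim disjE) (rule exI, rule conjI, rule F(1), simp, rule exI, rule conjI, rule F(2), simp,
          rule exI, rule conjI, rule F(3), simp)
    qed
    fix t :: "nat \<Rightarrow> real"
    assume t: "\<And>i. i \<in> ideal_vertices v \<Longrightarrow> 0 < t i \<and> t i \<le> 1"
      and b: "\<And>\<sigma> k. model_frame Hypotenuse (sqrt 2 / 2) \<sigma> e \<Longrightarrow> \<sigma> 0 \<in> ideal_vertices v \<Longrightarrow> \<sigma> k \<in> ideal_vertices v \<Longrightarrow>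
        0 < k \<Longrightarrow> k < 4 \<Longrightarrow> 2 * (t (\<sigma> 0) * t (\<sigma> k)) * facet_distance Hypotenuse (sqrt 2 / 2) k \<le> 1"
    \<comment> \<open>Facet distance c sqrt 2 = 1 for every pair.\<close>
    have "2 * (t 1 * t 2) \<le> 1" "2 * (t 1 * t 3) \<le> 1" "2 * (t 2 * t 3) \<le> 1"
      using b[OF F(1), of 1] b[OF F(1), of 3] b[OF F(2), of 3] by (simp_all add: iv)
    then have "(t 1)\<^sup>2 + (t 2)\<^sup>2 + (t 3)\<^sup>2 \<le> 3 / 2"
      using t by (intro sum_squares_three) (simp_all add: iv)
    then show "(\<Sum>i\<in>ideal_vertices v. (t i)\<^sup>2) \<le> cusp_weight (sqrt 2 / 2)"
      by (simp add: iv cusp_weights)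
  qed (simp add: iv)
qed

lemma optimal_density_RR3:
  assumes D: "coxeter_simplex RR3_diagram v e"
  shows "optimal_density v e = ennreal (3 / 4 * inverse catalan_const)"
proof -
  have s: "hyp_simplex v e" using D by (simp add: coxeter_simplex_def)
  note F = RR3_frame[THEN diagram_frame_model_frame[OF D]]
  have iv: "ideal_vertices v = {0, 1, 2, 3}"
    unfolding ideal_vertices_frame[OF s F(1) cusp_lattice_unit(2,3)[OF cusp_lattices(2)]] cusp_indices_inverse_sqrt2 by simp
  show ?thesis
  proof (rule optimal_density_frame[OF s cusp_lattices(2)])
    show "\<exists>\<sigma>. model_frame Two_Legs (sqrt 2 / 2) \<sigma> e \<and> \<sigma> 0 = i" if "i \<in> ideal_vertices v" for i
    proof -
      have "i = 0 \<or> i = 1 \<or> i = 2 \<or> i = 3" using that iv by simp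
      then show ?thesis
        by (elim disjE) (rule exI, rule conjI, rule F(1), simp, rule exI, rule conjI, rule F(2), simp,
          rule exI, rule conjI, rule F(3), simp, rule exI, rule conjI, rule F(4), simp)
    qed
    fix t :: "nat \<Rightarrow> real"
    assume t: "\<And>i. i \<in> ideal_vertices v \<Longrightarrow> 0 < t i \<and> t i \<le> 1"
      and b: "\<And>\<sigma> k. model_frame Two_Legs (sqrt 2 / 2) \<sigma> e \<Longrightarrow> \<sigma> 0 \<in> ideal_vertices v \<Longrightarrow> \<sigma> k \<in> ideal_vertices v \<Longrightarrow>
        0 < k \<Longrightarrow> k < 4 \<Longrightarrow> 2 * (t (\<sigma> 0) * t (\<sigma> k)) * facet_distance Two_Legs (sqrt 2 / 2) k \<le> 1"
    \<comment> \<open>Neighbours in the cycle have facet distance 2 c = sqrt 2, opposite nodes c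
      sqrt 2 = 1.\<close>
    have "2 * (t 0 * t 1) * sqrt 2 \<le> 1" "2 * (t 1 * t 2) * sqrt 2 \<le> 1" "2 * (t 2 * t 3) * sqrt 2 \<le> 1"
      "2 * (t 3 * t 0) * sqrt 2 \<le> 1" "2 * (t 0 * t 2) \<le> 1" "2 * (t 1 * t 3) \<le> 1"
      using b[OF F(1), of 1] b[OF F(2), of 1] b[OF F(3), of 1] b[OF F(4), of 1] b[OF F(1), of 2] b[OF F(2), of 2]
      by (simp_all add: iv)
    then have "(t 0)\<^sup>2 + (t 1)\<^sup>2 + (t 2)\<^sup>2 + (t 3)\<^sup>2 \<le> 3 / 2"
      using t by (intro sum_squares_cycle) (simp_all add: iv)
    then show "(\<Sum>i\<in>ideal_vertices v. (t i)\<^sup>2) \<le> cusp_weight (sqrt 2 / 2)"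
      by (simp add: iv cusp_weights)
  qed (simp add: iv)
qed

lemma diagram_labels:
  assumes "D \<in> {R3_diagram, O3_diagram, BR3_diagram, N3_diagram, M3_diagram, RR3_diagram}"
  shows "2 \<le> D i j"
  using assms
  by (auto simp: R3_diagram_def O3_diagram_def BR3_diagram_def N3_diagram_def M3_diagram_def RR3_diagram_def
      path_diagram_def star_diagram_def cycle_diagram_def)

theorem theorem2:
  fixes D :: diagram
  assumes "D \<in> {R3_diagram, O3_diagram, BR3_diagram, N3_diagram, M3_diagram, RR3_diagram}"
  shows "(\<exists>v e. coxeter_simplex D v e) \<and>
         (\<forall>v e. coxeter_simplex D v e \<longrightarrow>
            optimal_density v e = ennreal (3 / 4 * inverse catalan_const)) \<and>
         \<bar>3 / 4 * inverse catalan_const - 0.818808\<bar> < 0.0000005"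
proof (intro conjI allI impI)
  note labels = diagram_labels[OF assms]
  have simplex: "\<exists>v e. coxeter_simplex D v e" if "cusp_lattice c p q" "diagram_frame sh c \<sigma> D" for sh c p q \<sigma>
    by (rule coxeter_simplex_exists[OF that labels])
  consider "D = R3_diagram" | "D = O3_diagram" | "D = BR3_diagram" | "D = N3_diagram" | "D = M3_diagram" | "D = RR3_diagram"
    using assms by blast
  note D_cases = this
  show "\<exists>v e. coxeter_simplex D v e"
  proof (cases rule: D_cases)
    case 1
    show ?thesis by (rule simplex[OF cusp_lattices(1) R3_frame[folded 1]])
  next
    case 2
    show ?thesis by (rule simplex[OF cusp_lattices(1) O3_frame[folded 2]])
  next
    case 3
    show ?thesis by (rule simplex[OF cusp_lattices(1) BR3_frame[folded 3]])
  next
    case 4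
    show ?thesis by (rule simplex[OF cusp_lattices(2) N3_frame(1)[folded 4]])
  next
    case 5
    show ?thesis by (rule simplex[OF cusp_lattices(2) M3_frame(1)[folded 5]])
  next
    case 6
    show ?thesis by (rule simplex[OF cusp_lattices(2) RR3_frame(1)[folded 6]])
  qed
  fix v e assume "coxeter_simplex D v e"
  then show "optimal_density v e = ennreal (3 / 4 * inverse catalan_const)"
    using optimal_density_one_cusp[OF _ R3_frame] optimal_density_one_cusp[OF _ O3_frame] optimal_density_one_cusp[OF _ BR3_frame]
      optimal_density_N3 optimal_density_M3 optimal_density_RR3
    by (cases rule: D_cases) blast+
next
  show "\<bar>3 / 4 * inverse catalan_const - 0.818808\<bar> < 0.0000005" by (rule density_numeric)
qed

end
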